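(* Let $\mathbf{P}\subseteq\mathbb{N}$. The following conditions are equivalent, and they imply that Problem 5 for $\mathbf{P}$ is computable: (1) $\mathbf{P}$ is ultimately periodic (there are $0<p$ and $d\in\mathbb{N}$ with $n\in\mathbf{P}\leftrightarrow n+p\in\mathbf{P}$ for all $n>d$). (2) For every MLO formula $\psi(X,Y,P)$, either there is a finite state C-operator $F$ such that $\langle\mathbb{N},<\rangle\models\forall X\,\psi(X,F(X),\mathbf{P})$, or there is a finite state SC-operator $G$ such that $\langle\mathbb{N},<\rangle\models\forall Y\,\neg\psi(G(Y),Y,\mathbf{P})$; moreover, it is decidable which of these cases holds and the corresponding operator is computable from $\psi$.
   Context: MLO is monadic second-order logic over $<$ and unary predicate symbols, interpreted over $\mathbb{N}$ with set variables ranging over subsets of $\mathbb{N}$, identified with $\omega$-strings over $\{0,1\}$. An operator $F:\{0,1\}^\omega\to\{0,1\}^\omega$ is causal (C-operator) if whenever inputs coincide on $[0,t]$ the outputs coincide on $[0,t]$; strongly causal (SC-operator) if whenever inputs coincide on $[0,t)$ the outputs coincide on $[0,t]$. A C-operator is finite state if there are a finite set $Q$, $q_{init}\in Q$, $\delta:Q\times\{0,1\}\to Q$ (extended to strings) and $out:Q\times\{0,1\}\to\{0,1\}$ such that the $i$-th output letter on input $a_0a_1\dots$ is $out(\delta(q_{init},a_0\dots a_{i-1}),a_i)$; an SC-operator is finite state if the same holds with $out:Q\to\{0,1\}$ and $i$-th output letter $out(\delta(q_{init},a_0\dots a_{i-1}))$. Problem 5 for $\mathbf{P}$: given an MLO formula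 $\psi(X,Y,P)$, decide whether there is a finite state C-operator $Y=F(X)$ with $\langle\mathbb{N},<\rangle\models\forall X\,\psi(X,F(X),\mathbf{P})$, and if so construct it; computable means some algorithm does this for all inputs. *)

theory Defs
  imports Main "HOL-Library.Nat_Bijection"
begin

text \<open>MLO formulas over the single predicate symbol \<open>P\<close>. First-order and set variables are both
  named by natural numbers, in separate name spaces.\<close>

datatype mlo =
    Less nat nat
  | Equal nat nat
  | InVar nat nat  \<comment> \<open>\<open>InVar i j\<close>: the element \<open>i\<close> belongs to the set variable \<open>j\<close>\<close>
  | InP nat
  | Neg mlo
  | Conj mlo mlo
  | ExElem nat mlo
  | ExSet nat mlo

fun sat :: "nat set \<Rightarrow> (nat \<Rightarrow> nat) \<Rightarrow> (nat \<Rightarrow> nat set) \<Rightarrow> mlo \<Rightarrow> bool" where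
  "sat P v V (Less i j) \<longleftrightarrow> v i < v j"
| "sat P v V (Equal i j) \<longleftrightarrow> v i = v j"
| "sat P v V (InVar i j) \<longleftrightarrow> v i \<in> V j"
| "sat P v V (InP i) \<longleftrightarrow> v i \<in> P"
| "sat P v V (Neg \<phi>) \<longleftrightarrow> \<not> sat P v V \<phi>"
| "sat P v V (Conj \<phi> \<psi>) \<longleftrightarrow> sat P v V \<phi> \<and> sat P v V \<psi>"
| "sat P v V (ExElem i \<phi>) \<longleftrightarrow> (\<exists>n. sat P (v(i := n)) V \<phi>)"
| "sat P v V (ExSet j \<phi>) \<longleftrightarrow> (\<exists>A. sat P v (V(j := A)) \<phi>)"

fun free_elem :: "mlo \<Rightarrow> nat set" where
  "free_elem (Less i j) = {i, j}"
| "free_elem (Equal i j) = {i, j}"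
| "free_elem (InVar i j) = {i}"
| "free_elem (InP i) = {i}"
| "free_elem (Neg \<phi>) = free_elem \<phi>"
| "free_elem (Conj \<phi> \<psi>) = free_elem \<phi> \<union> free_elem \<psi>"
| "free_elem (ExElem i \<phi>) = free_elem \<phi> - {i}"
| "free_elem (ExSet j \<phi>) = free_elem \<phi>"

fun free_set :: "mlo \<Rightarrow> nat set" where
  "free_set (Less i j) = {}"
| "free_set (Equal i j) = {}"
| "free_set (InVar i j) = {j}"
| "free_set (InP i) = {}"
| "free_set (Neg \<phi>) = free_set \<phi>"
| "free_set (Conj \<phi> \<psi>) = free_set \<phi> \<union> free_set \<psi>"
| "free_set (ExElem i \<phi>) = free_set \<phi>"
| "free_set (ExSet j \<phi>) = free_set \<phi> - {j}"

text \<open>The formulas \<open>\<psi>(X,Y,P)\<close>: set variable 0 plays the role of \<open>X\<close>, set variable 1 that of \<open>Y\<close>,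
  and nothing else is free.\<close>

definition formulas_XYP :: "mlo set" where
  "formulas_XYP = {\<psi>. free_elem \<psi> = {} \<and> free_set \<psi> \<subseteq> {0, 1}}"

type_synonym omega_string = "nat \<Rightarrow> bool"
type_synonym operator = "omega_string \<Rightarrow> omega_string"

text \<open>Truth of \<open>\<psi>(X,Y,P)\<close>. The values given to the remaining variables are irrelevant for members
  of \<^const>\<open>formulas_XYP\<close>.\<close>

definition holds :: "nat set \<Rightarrow> mlo \<Rightarrow> omega_string \<Rightarrow> omega_string \<Rightarrow> bool" where
  "holds P \<psi> X Y \<longleftrightarrow> sat P (\<lambda>_. 0) ((\<lambda>_. {})(0 := {n. X n}, 1 := {n. Y n})) \<psi>"

definition causal :: "operator \<Rightarrow> bool" where
  "causal F \<longleftrightarrow> (\<forall>X X' t. (\<forall>i\<le>t. X i = X' i) \<longrightarrow> (\<forall>i\<le>t. F X i = F X' i))"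

definition strongly_causal :: "operator \<Rightarrow> bool" where
  "strongly_causal F \<longleftrightarrow> (\<forall>X X' t. (\<forall>i<t. X i = X' i) \<longrightarrow> (\<forall>i\<le>t. F X i = F X' i))"

text \<open>The state reached from \<open>q\<close> after reading the first \<open>i\<close> letters of \<open>X\<close>.\<close>

definition run :: "(nat \<Rightarrow> bool \<Rightarrow> nat) \<Rightarrow> nat \<Rightarrow> omega_string \<Rightarrow> nat \<Rightarrow> nat" where
  "run \<delta> q X i = foldl \<delta> q (map X [0..<i])"

text \<open>Taking states to be natural numbers loses no generality, as state sets are finite.\<close>

definition transition_system :: "nat set \<Rightarrow> nat \<Rightarrow> (nat \<Rightarrow> bool \<Rightarrow> nat) \<Rightarrow> bool" where
  "transition_system Q q \<delta> \<longleftrightarrow> finite Q \<and> q \<in> Q \<and> (\<forall>s\<in>Q. \<forall>a. \<delta> s a \<in> Q)"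

definition computed_by_C ::
    "nat set \<Rightarrow> nat \<Rightarrow> (nat \<Rightarrow> bool \<Rightarrow> nat) \<Rightarrow> (nat \<Rightarrow> bool \<Rightarrow> bool) \<Rightarrow> operator \<Rightarrow> bool" where
  "computed_by_C Q q \<delta> out F \<longleftrightarrow>
     transition_system Q q \<delta> \<and> (\<forall>X i. F X i = out (run \<delta> q X i) (X i))"

definition computed_by_SC ::
    "nat set \<Rightarrow> nat \<Rightarrow> (nat \<Rightarrow> bool \<Rightarrow> nat) \<Rightarrow> (nat \<Rightarrow> bool) \<Rightarrow> operator \<Rightarrow> bool" where
  "computed_by_SC Q q \<delta> out F \<longleftrightarrow>
     transition_system Q q \<delta> \<and> (\<forall>X i. F X i = out (run \<delta> q X i))"

definition finite_state_C :: "operator \<Rightarrow> bool" where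
  "finite_state_C F \<longleftrightarrow> causal F \<and> (\<exists>Q q \<delta> out. computed_by_C Q q \<delta> out F)"

definition finite_state_SC :: "operator \<Rightarrow> bool" where
  "finite_state_SC F \<longleftrightarrow> strongly_causal F \<and> (\<exists>Q q \<delta> out. computed_by_SC Q q \<delta> out F)"

definition C_solution :: "nat set \<Rightarrow> mlo \<Rightarrow> operator \<Rightarrow> bool" where
  "C_solution P \<psi> F \<longleftrightarrow> finite_state_C F \<and> (\<forall>X. holds P \<psi> X (F X))"

definition SC_counter :: "nat set \<Rightarrow> mlo \<Rightarrow> operator \<Rightarrow> bool" where
  "SC_counter P \<psi> G \<longleftrightarrow> finite_state_SC G \<and> (\<forall>Y. \<not> holds P \<psi> (G Y) Y)"

definition ultimately_periodic :: "nat set \<Rightarrow> bool" where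
  "ultimately_periodic P \<longleftrightarrow> (\<exists>p>0. \<exists>d. \<forall>n>d. n \<in> P \<longleftrightarrow> n + p \<in> P)"

text \<open>Algorithms are partial recursive functions: \<open>eval f xs y\<close> says that \<open>f\<close> halts on the argument
  list \<open>xs\<close> with value \<open>y\<close>.\<close>

datatype recf = Zero | Succ | Proj nat | Comp recf "recf list" | PrimRec recf recf | Mu recf

inductive eval :: "recf \<Rightarrow> nat list \<Rightarrow> nat \<Rightarrow> bool" where
  eval_Zero: "eval Zero xs 0"
| eval_Succ: "eval Succ [x] (Suc x)"
| eval_Proj: "i < length xs \<Longrightarrow> eval (Proj i) xs (xs ! i)"
| eval_Comp: "list_all2 (\<lambda>g y. eval g xs y) gs ys \<Longrightarrow> eval f ys z \<Longrightarrow> eval (Comp f gs) xs z"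
| eval_PrimRec_0: "eval f xs y \<Longrightarrow> eval (PrimRec f g) (0 # xs) y"
| eval_PrimRec_Suc: "eval (PrimRec f g) (n # xs) y \<Longrightarrow> eval g (n # y # xs) z
    \<Longrightarrow> eval (PrimRec f g) (Suc n # xs) z"
| eval_Mu: "eval f (n # xs) 0 \<Longrightarrow> (\<forall>i<n. \<exists>k. eval f (i # xs) (Suc k)) \<Longrightarrow> eval (Mu f) xs n"

inductive_cases eval_ZeroE: "eval Zero xs z"
inductive_cases eval_SuccE: "eval Succ xs z"
inductive_cases eval_ProjE: "eval (Proj i) xs z"
inductive_cases eval_CompE: "eval (Comp f gs) xs z"
inductive_cases eval_PrimRec_0E: "eval (PrimRec f g) (0 # xs) z"
inductive_cases eval_PrimRec_SucE: "eval (PrimRec f g) (Suc n # xs) z"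
inductive_cases eval_MuE: "eval (Mu f) xs z"

lemma eval_deterministic: "eval f xs y \<Longrightarrow> eval f xs z \<Longrightarrow> y = z"
proof (induction arbitrary: z rule: eval.induct)
  case (eval_Comp xs gs ys f w)
  from eval_Comp.prems obtain ys' where ys': "list_all2 (\<lambda>g y. eval g xs y) gs ys'" "eval f ys' z"
    by (rule eval_CompE)
  have "ys = ys'"
    by (rule nth_equalityI) (use eval_Comp.IH(1) ys'(1) in \<open>auto simp: list_all2_conv_all_nth\<close>)
  then show ?case using eval_Comp.IH(2) ys'(2) by simp
next
  case (eval_PrimRec_Suc f g n xs y w)
  from eval_PrimRec_Suc.prems obtain y' where "eval (PrimRec f g) (n # xs) y'" "eval g (n # y' # xs) z"
    by (rule eval_PrimRec_SucE)
  then show ?case using eval_PrimRec_Suc.IH by blast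
next
  case (eval_Mu f n xs)
  from eval_Mu.prems have z: "eval f (z # xs) 0" "\<forall>i<z. \<exists>k. eval f (i # xs) (Suc k)"
    by (auto elim: eval_MuE)
  show ?case
  proof (rule linorder_cases[of n z])
    assume "n < z"
    then obtain k where "eval f (n # xs) (Suc k)" using z by blast
    then show ?thesis using eval_Mu.IH(1) by blast
  next
    assume "z < n"
    then show ?thesis using eval_Mu.IH(2) z(1) by fastforce
  qed
next
  case eval_Zero
  then show ?case by (blast elim: eval_ZeroE)
next
  case eval_Succ
  then show ?case by (blast elim: eval_SuccE)
next
  case eval_Proj
  then show ?case by (blast elim: eval_ProjE)
next
  case eval_PrimRec_0
  then show ?case by (blast elim: eval_PrimRec_0E)
qed

text \<open>Inputs and outputs of algorithms are coded by Goedel numbers built from the explicit recursive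
  bijections \<^const>\<open>prod_encode\<close> and \<^const>\<open>list_encode\<close>.\<close>

primrec mlo_code :: "mlo \<Rightarrow> nat" where
  "mlo_code (Less i j) = prod_encode (0, prod_encode (i, j))"
| "mlo_code (Equal i j) = prod_encode (1, prod_encode (i, j))"
| "mlo_code (InVar i j) = prod_encode (2, prod_encode (i, j))"
| "mlo_code (InP i) = prod_encode (3, i)"
| "mlo_code (Neg \<phi>) = prod_encode (4, mlo_code \<phi>)"
| "mlo_code (Conj \<phi> \<psi>) = prod_encode (5, prod_encode (mlo_code \<phi>, mlo_code \<psi>))"
| "mlo_code (ExElem i \<phi>) = prod_encode (6, prod_encode (i, mlo_code \<phi>))"
| "mlo_code (ExSet j \<phi>) = prod_encode (7, prod_encode (j, mlo_code \<phi>))"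

lemma mlo_code_inject: "mlo_code \<phi> = mlo_code \<psi> \<longleftrightarrow> \<phi> = \<psi>"
  by (induction \<phi> arbitrary: \<psi>; case_tac \<psi>; simp)

text \<open>Transition tables. The states are \<open>0, \<dots>, n - 1\<close> where \<open>n\<close> is the number of rows; row \<open>s\<close>
  lists the successors of \<open>s\<close> on the letters 0 and 1, followed by the output (on the letters 0 and 1
  in the case of C-operators). The first component is the initial state.\<close>

type_synonym C_table = "nat \<times> (nat \<times> nat \<times> bool \<times> bool) list"
type_synonym SC_table = "nat \<times> (nat \<times> nat \<times> bool) list"

definition C_table_computes :: "C_table \<Rightarrow> operator \<Rightarrow> bool" where
  "C_table_computes = (\<lambda>(q, rows). computed_by_C {..<length rows} q
     (\<lambda>s a. case rows ! s of (d0, d1, o0, o1) \<Rightarrow> if a then d1 else d0)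
     (\<lambda>s a. case rows ! s of (d0, d1, o0, o1) \<Rightarrow> if a then o1 else o0))"

definition SC_table_computes :: "SC_table \<Rightarrow> operator \<Rightarrow> bool" where
  "SC_table_computes = (\<lambda>(q, rows). computed_by_SC {..<length rows} q
     (\<lambda>s a. case rows ! s of (d0, d1, b) \<Rightarrow> if a then d1 else d0)
     (\<lambda>s. case rows ! s of (d0, d1, b) \<Rightarrow> b))"

definition C_table_code :: "C_table \<Rightarrow> nat" where
  "C_table_code = (\<lambda>(q, rows). prod_encode (q, list_encode (map
     (\<lambda>(d0, d1, o0, o1).
        prod_encode (d0, prod_encode (d1, prod_encode (of_bool o0, of_bool o1)))) rows)))"

definition SC_table_code :: "SC_table \<Rightarrow> nat" where
  "SC_table_code = (\<lambda>(q, rows). prod_encode (q, list_encode (map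
     (\<lambda>(d0, d1, b). prod_encode (d0, prod_encode (d1, of_bool b))) rows)))"

lemma C_table_code_inject: "C_table_code T = C_table_code T' \<longleftrightarrow> T = T'"
proof -
  have "inj (\<lambda>(d0, d1, o0, o1). prod_encode (d0::nat, prod_encode (d1::nat,
    prod_encode (of_bool o0, of_bool o1))))"
    by (auto simp: inj_def)
  then show ?thesis
    by (cases T; cases T') (simp add: C_table_code_def inj_map_eq_map list_encode_eq)
qed

lemma SC_table_code_inject: "SC_table_code T = SC_table_code T' \<longleftrightarrow> T = T'"
proof -
  have "inj (\<lambda>(d0, d1, b). prod_encode (d0::nat, prod_encode (d1::nat, of_bool b)))"
    by (auto simp: inj_def)
  then show ?thesis
    by (cases T; cases T') (simp add: SC_table_code_def inj_map_eq_map list_encode_eq)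
qed

definition decidable :: "(mlo \<Rightarrow> bool) \<Rightarrow> bool" where
  "decidable A \<longleftrightarrow> (\<exists>r. \<forall>\<psi>\<in>formulas_XYP. eval r [mlo_code \<psi>] (if A \<psi> then 1 else 0))"

text \<open>Some algorithm produces, from every formula for which a solution exists, a transition table of
  such a solution.\<close>

definition C_solutions_computable :: "nat set \<Rightarrow> bool" where
  "C_solutions_computable P \<longleftrightarrow> (\<exists>r. \<forall>\<psi>\<in>formulas_XYP. (\<exists>F. C_solution P \<psi> F) \<longrightarrow>
     (\<exists>T F. eval r [mlo_code \<psi>] (C_table_code T) \<and> C_table_computes T F \<and> C_solution P \<psi> F))"

definition SC_counters_computable :: "nat set \<Rightarrow> bool" where
  "SC_counters_computable P \<longleftrightarrow> (\<exists>r. \<forall>\<psi>\<in>formulas_XYP. (\<exists>G. SC_counter P \<psi> G) \<longrightarrow>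
     (\<exists>T G. eval r [mlo_code \<psi>] (SC_table_code T) \<and> SC_table_computes T G \<and> SC_counter P \<psi> G))"

definition problem_computable :: "nat set \<Rightarrow> bool" where
  "problem_computable P \<longleftrightarrow> decidable (\<lambda>\<psi>. \<exists>F. C_solution P \<psi> F) \<and> C_solutions_computable P"

definition effectively_determined :: "nat set \<Rightarrow> bool" where
  "effectively_determined P \<longleftrightarrow>
     (\<forall>\<psi>\<in>formulas_XYP. (\<exists>F. C_solution P \<psi> F) \<or> (\<exists>G. SC_counter P \<psi> G)) \<and>
     decidable (\<lambda>\<psi>. \<exists>F. C_solution P \<psi> F) \<and>
     decidable (\<lambda>\<psi>. \<exists>G. SC_counter P \<psi> G) \<and>
     C_solutions_computable P \<and>
     SC_counters_computable P"

end

theory Submission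
  imports Defs "HOL-Library.Infinite_Set" "HOL-Library.Ramsey"
begin

text \<open>Every MLO formula defines a set of \<open>\<omega>\<close>-words saturated by a congruence of finite index on finite
  words; the existential set quantifier is handled by a power set construction. Such a set is accepted
  by a deterministic parity automaton, so positional determinacy of parity games gives a finite state
  solution or a finite state counter-strategy whenever \<open>P\<close> is ultimately periodic.

  For effectiveness one searches for a transducer together with a certificate that it is correct.
  By Ramsey's theorem and the pigeonhole principle, over an ultimately periodic environment a set
  quantifier may be restricted to ultimately periodic sets whose offset and period are bounded in terms
  of the index of the congruence. Truth of a formula can therefore be certified by a finite table of
  truth values, and checking such a table is recursive. As exactly one of the two kinds of transducers
  exists, the search terminates.

  Conversely, the formula \<open>Y = P\<close> has no counter-strategy, and a finite state operator maps the constant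
  input 0 to an ultimately periodic output.\<close>

section \<open>Parity games\<close>

text \<open>Following the determinacy proof effectively would mean carrying automata and games
  through Goedel numbers, whereas checking a guessed answer takes only computable tests on codes
  with bounded quantifiers. Hence \<open>determined\<close> serves to make the search halt, and
  \<open>not_both\<close> makes its outcome conclusive: the composition of a causal and a strongly
  causal operator has a fixed point. A certificate must also cover all inputs. A failing input with
  its output is a pair of set quantifiers over the graph of the transducer, a safety language of
  index at most (2 * N) ^ N for N states, intersected with the violation of the specification. So
  failure anywhere implies failure on an ultimately periodic pair with bounded parameters, which
  finitely many tests detect. Witnesses of nested quantifiers have loops of different lengths, each
  p times some factor up to K. The period is multiplied by the factorial of K, a common multiple of
  these factors, so that all sets of an environment share one offset and one period. K must be
  computable from codes alone; a tower of exponentials over the Goedel number replaces the exact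
  index.\<close>

text \<open>\<open>c q W\<close> says that the player can force the play from \<open>q\<close> into \<open>W\<close> in one step. The games solved by
  recursion on \<open>k\<close> end as soon as a priority \<open>i < k\<close> is seen, with victory if the state is then in \<open>Z i\<close>;
  \<open>g i\<close> is a progress measure bounding how often \<open>i\<close> can still be seen without a smaller priority, if
  \<open>i\<close> is not \<open>good\<close>.\<close>

definition target :: "('q \<Rightarrow> nat) \<Rightarrow> (nat \<Rightarrow> bool) \<Rightarrow> nat \<Rightarrow> (nat \<Rightarrow> 'q set) \<Rightarrow> 'q set \<Rightarrow> (nat \<Rightarrow> 'q \<Rightarrow> nat) \<Rightarrow>
    'q \<Rightarrow> 'q set"
  where "target pri good k Z U g q = {q'.
     (pri q' < k \<longrightarrow> q' \<in> Z (pri q')) \<and>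
     (k \<le> pri q' \<longrightarrow> q' \<in> U \<and> (\<forall>i. k \<le> i \<and> i \<le> pri q' \<longrightarrow> g i q' \<le> g i q) \<and>
        (\<not> good (pri q') \<longrightarrow> g (pri q') q' < g (pri q') q))}"

definition progress :: "('q \<Rightarrow> 'q set \<Rightarrow> bool) \<Rightarrow> ('q \<Rightarrow> nat) \<Rightarrow> (nat \<Rightarrow> bool) \<Rightarrow> nat \<Rightarrow> (nat \<Rightarrow> 'q set) \<Rightarrow>
    'q set \<Rightarrow> bool"
  where "progress c pri good k Z U \<longleftrightarrow> (\<exists>g. \<forall>q\<in>U. c q (target pri good k Z U g q))"

text \<open>The forcing power of the opponent. Treating one-step forcing abstractly lets a single
  argument serve both players.\<close>

definition dual_force :: "('q \<Rightarrow> 'q set \<Rightarrow> bool) \<Rightarrow> 'q \<Rightarrow> 'q set \<Rightarrow> bool" where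
  "dual_force c q W \<longleftrightarrow> \<not> c q (- W)"

definition forcing :: "'q set \<Rightarrow> ('q \<Rightarrow> 'q set \<Rightarrow> bool) \<Rightarrow> bool" where
  "forcing Q c \<longleftrightarrow> (\<forall>q W W'. q \<in> Q \<longrightarrow> c q W \<longrightarrow> W \<inter> Q \<subseteq> W' \<longrightarrow> c q W')"

text \<open>Determinacy in a form fit for induction on \<open>k\<close>: both regions come with
  measures, and monotonicity in \<open>Z\<close> is what the fixed point iteration of
  \<open>solved_step\<close> rests on.\<close>

definition solved where
  "solved Q c pri good k \<longleftrightarrow> (\<exists>W. mono W \<and> (\<forall>Z. W Z \<subseteq> Q \<and> progress c pri good k Z (W Z) \<and>
     progress (dual_force c) pri (\<lambda>i. \<not> good i) k (\<lambda>i. - Z i) (Q - W Z)))"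

lemma dual_force_idem: "dual_force (dual_force c) = c"
  by (simp add: dual_force_def fun_eq_iff)

lemma forcing_dual: "forcing Q c \<Longrightarrow> forcing Q (dual_force c)"
  unfolding forcing_def dual_force_def
proof (intro allI impI notI)
  fix q W W' assume *: "\<forall>q W W'. q \<in> Q \<longrightarrow> c q W \<longrightarrow> W \<inter> Q \<subseteq> W' \<longrightarrow> c q W'" "q \<in> Q"
    "\<not> c q (- W)" "W \<inter> Q \<subseteq> W'" "c q (- W')"
  have "- W' \<inter> Q \<subseteq> - W" using *(4) by blast
  with * show False by blast
qed

lemma solved_dual:
  assumes "solved Q c pri good k"
  shows "solved Q (dual_force c) pri (\<lambda>i. \<not> good i) k"
proof -
  from assms obtain W where W: "mono W" "\<And>Z. W Z \<subseteq> Q" "\<And>Z. progress c pri good k Z (W Z)"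
    "\<And>Z. progress (dual_force c) pri (\<lambda>i. \<not> good i) k (\<lambda>i. - Z i) (Q - W Z)"
    unfolding solved_def by blast
  define V where "V Z = Q - W (\<lambda>i. - Z i)" for Z
  have "mono V" unfolding V_def
  proof (rule monoI)
    fix X Y :: "nat \<Rightarrow> 'a set" assume "X \<le> Y"
    then have "(\<lambda>i. - Y i) \<le> (\<lambda>i. - X i)" by (auto simp: le_fun_def)
    then show "Q - W (\<lambda>i. - X i) \<subseteq> Q - W (\<lambda>i. - Y i)" using monoD[OF W(1)] by blast
  qed
  moreover have "V Z \<subseteq> Q" for Z by (auto simp: V_def)
  moreover have "progress (dual_force c) pri (\<lambda>i. \<not> good i) k Z (V Z)" for Z
    using W(4)[of "\<lambda>i. - Z i"] by (simp add: V_def)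
  moreover have "progress (dual_force (dual_force c)) pri (\<lambda>i. \<not> \<not> good i) k (\<lambda>i. - Z i) (Q - V Z)"
      for Z
  proof -
    have "Q - V Z = W (\<lambda>i. - Z i)" using W(2) by (auto simp: V_def)
    then show ?thesis using W(3) by (simp add: dual_force_idem)
  qed
  ultimately show ?thesis unfolding solved_def by blast
qed

lemma forcing_mono:
  assumes "forcing Q c" "q \<in> Q" "c q A" "\<And>q'. q' \<in> Q \<Longrightarrow> q' \<in> A \<Longrightarrow> q' \<in> B"
  shows "c q B"
  using assms unfolding forcing_def by blast

text \<open>When a good priority \<open>k\<close> is seen, the play may simply go on inside the
  winning region. The region is therefore the greatest fixed point of the map sending U to
  \<open>W (Z(k := U))\<close>; outside it the opponent is guided by the stage at which a state
  drops out of the iteration.\<close>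

lemma solved_step:
  assumes fin: "finite Q" and frc: "forcing Q c" and S: "solved Q c pri good (Suc k)"
    and good: "good k"
  shows "solved Q c pri good k"
proof -
  from S obtain W where W: "mono W" "\<And>Z. W Z \<subseteq> Q" "\<And>Z. progress c pri good (Suc k) Z (W Z)"
    "\<And>Z. progress (dual_force c) pri (\<lambda>i. \<not> good i) (Suc k) (\<lambda>i. - Z i) (Q - W Z)"
    unfolding solved_def by blast
  define I where "I Z n = ((\<lambda>U. W (Z(k := U))) ^^ n) Q" for Z n
  have I0: "I Z 0 = Q" and IS: "I Z (Suc n) = W (Z(k := I Z n))" for Z n
    by (simp_all add: I_def)
  have IQ: "I Z n \<subseteq> Q" for Z n by (cases n) (simp_all add: I0 IS W(2))
  have Imono: "I Z n \<subseteq> I Z' n" if "Z \<le> Z'" for Z Z' n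
  proof (induction n)
    case (Suc n)
    have "Z(k := I Z n) \<le> Z'(k := I Z' n)" using that Suc by (auto simp: le_fun_def)
    then show ?case using W(1) by (simp add: IS mono_def)
  qed (simp add: I0)
  have Idec1: "I Z (Suc n) \<subseteq> I Z n" for Z n
  proof (induction n)
    case 0 then show ?case using IQ by (metis I0)
  next
    case (Suc n)
    have "Z(k := I Z (Suc n)) \<le> Z(k := I Z n)" using Suc by (auto simp: le_fun_def)
    then show ?case using W(1) unfolding IS[of Z "Suc n"] IS[of Z n] mono_def by blast
  qed
  have Idec: "m \<le> n \<Longrightarrow> I Z n \<subseteq> I Z m" for Z m n
    by (rule lift_Suc_antimono_le[of "I Z"]) (use Idec1 in auto)
  have "\<exists>n. I Z (Suc n) = I Z n" for Z
  proof (rule ccontr)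
    assume "\<nexists>n. I Z (Suc n) = I Z n"
    then have lt: "card (I Z (Suc n)) < card (I Z n)" for n
      using Idec1 IQ fin by (metis finite_subset psubset_card_mono psubsetI)
    have "card (I Z n) + n \<le> card (I Z 0)" for n
    proof (induction n)
      case (Suc n)
      show ?case using lt[of n] Suc by linarith
    qed simp
    from this[of "Suc (card (I Z 0))"] show False by simp
  qed
  then obtain N where N: "\<And>Z. I Z (Suc (N Z)) = I Z (N Z)" by metis
  define V where "V Z = (\<Inter>n. I Z n)" for Z
  have VN: "V Z = I Z (N Z)" for Z
  proof -
    have ge: "I Z (N Z + n) = I Z (N Z)" for n
    proof (induction n)
      case (Suc n)
      have "I Z (N Z + Suc n) = W (Z(k := I Z (N Z + n)))" by (simp add: IS)
      also have "\<dots> = I Z (Suc (N Z))" using Suc by (simp add: IS)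
      finally show ?case by (simp add: N)
    qed simp
    have "I Z (N Z) \<subseteq> I Z n" for n
      using ge[of "n - N Z"] Idec[of n "N Z" Z] by (cases "n \<le> N Z") auto
    then show ?thesis unfolding V_def by blast
  qed
  have V1: "V Z = W (Z(k := V Z))" for Z unfolding VN using N[of Z] IS by metis
  have "mono V"
    by (rule monoI) (use Imono in \<open>fastforce simp: V_def\<close>)
  moreover have "V Z \<subseteq> Q" for Z using IQ by (auto simp: VN)
  moreover have "progress c pri good k Z (V Z)" for Z
  proof -
    have "progress c pri good (Suc k) (Z(k := V Z)) (V Z)"
      using W(3)[of "Z(k := V Z)"] V1[of Z] by simp
    then obtain g where g: "\<And>q. q \<in> V Z \<Longrightarrow> c q (target pri good (Suc k) (Z(k := V Z)) (V Z) g q)"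
      unfolding progress_def by blast
    \<comment> \<open>Seeing \<open>k\<close> leads back into \<open>V Z\<close>, and a good
      priority demands no decrease, so component \<open>k\<close> may be constant.\<close>
    define h where "h = g(k := (\<lambda>_. 0))"
    show ?thesis unfolding progress_def
    proof (intro exI[of _ h] ballI)
      fix q assume q: "q \<in> V Z"
      then have "q \<in> Q" using \<open>\<And>Z. V Z \<subseteq> Q\<close> by blast
      show "c q (target pri good k Z (V Z) h q)"
        using frc \<open>q \<in> Q\<close> g[OF q]
      proof (rule forcing_mono)
        fix q' assume *: "q' \<in> target pri good (Suc k) (Z(k := V Z)) (V Z) g q"
        consider "pri q' < k" | "pri q' = k" | "k < pri q'" by linarith
        then show "q' \<in> target pri good k Z (V Z) h q"
          using * good by cases (auto simp: h_def target_def)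
      qed
    qed
  qed
  moreover have "progress (dual_force c) pri (\<lambda>i. \<not> good i) k (\<lambda>i. - Z i) (Q - V Z)" for Z
  proof -
    have "progress (dual_force c) pri (\<lambda>i. \<not> good i) (Suc k) (\<lambda>i. - (Z(k := I Z n)) i) (Q - I Z
        (Suc n))" for n
      using W(4)[of "Z(k := I Z n)"] IS[of Z n] by simp
    then have "\<forall>n. \<exists>g. \<forall>q\<in>Q - I Z (Suc n).
        dual_force c q (target pri (\<lambda>i. \<not> good i) (Suc k) (\<lambda>i. - (Z(k := I Z n)) i) (Q - I Z
            (Suc n)) g q)"
      unfolding progress_def by (rule allI)
    from choice[OF this] obtain g where g: "\<And>n q. q \<in> Q - I Z (Suc n) \<Longrightarrow>
        dual_force c q (target pri (\<lambda>i. \<not> good i) (Suc k) (\<lambda>i. - (Z(k := I Z n)) i) (Q - I Z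
            (Suc n)) (g n) q)"
      by (elim exE) blast
    \<comment> \<open>The stage at which \<open>q\<close> drops out. If the opponent's move shows
      priority \<open>k\<close>, it lands outside \<open>I Z (r q)\<close>, so this rank
      falls.\<close>
    define r where "r q = (LEAST n. q \<notin> I Z (Suc n))" for q
    have r: "q \<in> Q - I Z (Suc (r q))" if "q \<in> Q - V Z" for q
    proof -
      have "q \<notin> I Z (Suc (N Z))" using that by (simp add: VN N)
      then have "q \<notin> I Z (Suc (r q))" unfolding r_def by (rule LeastI)
      then show ?thesis using that by blast
    qed
    have r_le: "r q \<le> n" if "q \<notin> I Z (Suc n)" for q n
      unfolding r_def using that by (rule Least_le)
    define P where "P = insert k (pri ` Q)"
    have "finite (\<Union>q\<in>Q. (\<lambda>i. g (r q) i q) ` {..Max P})" using fin by blast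
    then obtain M where M: "\<And>q i. q \<in> Q \<Longrightarrow> i \<le> Max P \<Longrightarrow> g (r q) i q < M"
      unfolding finite_nat_set_iff_bounded by blast
    have pP: "pri q \<le> Max P" if "q \<in> Q" for q
      by (rule Max_ge) (use that fin in \<open>auto simp: P_def\<close>)
    \<comment> \<open>When the rank falls, another measure \<open>g (r q)\<close> takes over.
      Scaling the rank by the bound \<open>M\<close> makes every component up to the current
      priority fall at that moment, whatever the new measure is.\<close>
    define h where "h i q = (if i = k then r q else r q * M + g (r q) i q)" for i q
    show ?thesis unfolding progress_def
    proof (intro exI[of _ h] ballI)
      fix q assume q: "q \<in> Q - V Z"
      show "dual_force c q (target pri (\<lambda>i. \<not> good i) k (\<lambda>i. - Z i) (Q - V Z) h q)"
        using forcing_dual[OF frc] _ g[OF r[OF q]]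
      proof (rule forcing_mono)
        show "q \<in> Q" using q by blast
      next
        fix q' assume 1: "q' \<in> Q"
          and t: "q' \<in> target pri (\<lambda>i. \<not> good i) (Suc k) (\<lambda>i. - (Z(k := I Z (r q))) i) (Q - I Z
              (Suc (r q))) (g (r q)) q"
        show "q' \<in> target pri (\<lambda>i. \<not> good i) k (\<lambda>i. - Z i) (Q - V Z) h q"
        proof (cases "pri q' < k")
          case True
          then show ?thesis using t by (auto simp: target_def)
        next
          case nlt: False
          note 2 = 1 nlt t[unfolded target_def]
          show ?thesis
          proof (cases "pri q' = k")
            case True
            then have nI: "q' \<notin> I Z (r q)" using 2 by auto
            then obtain m where m: "r q = Suc m" using I0 2(1) by (cases "r q") auto
            have "r q' < r q" using r_le[of q' m] nI m by simp
            then show ?thesis using True nI 2(1) good by (auto simp: h_def V_def target_def)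
          next
            case False
            then have gt: "k < pri q'" using 2 by simp
            then have nI: "q' \<notin> I Z (Suc (r q))" and
              le: "\<And>i. Suc k \<le> i \<Longrightarrow> i \<le> pri q' \<Longrightarrow> g (r q) i q' \<le> g (r q) i q" and
              st: "good (pri q') \<Longrightarrow> g (r q) (pri q') q' < g (r q) (pri q') q"
              using 2 by auto
            have V: "q' \<in> Q - V Z" using nI 2(1) by (auto simp: V_def)
            have "r q' \<le> r q" using r_le nI by blast
            then consider "r q' < r q" | "r q' = r q" by linarith
            then show ?thesis
            proof cases
              case 1
              have lt: "h i q' < h i q" if "k \<le> i" "i \<le> pri q'" for i
              proof (cases "i = k")
                case False
                have "g (r q') i q' < M" using M 2(1) that pP order.trans by blast
                then have "h i q' < Suc (r q') * M" using False by (simp add: h_def)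
                also have "\<dots> \<le> r q * M" using 1 by (intro mult_le_mono1) simp
                also have "\<dots> \<le> h i q" using False by (simp add: h_def)
                finally show ?thesis .
              qed (use 1 in \<open>simp add: h_def\<close>)
              then show ?thesis using V gt by (simp add: less_imp_le target_def)
            next
              case 2
              then show ?thesis using V gt le st by (auto simp: h_def target_def)
            qed
          qed
        qed
      qed
    qed
  qed
  ultimately show ?thesis unfolding solved_def by blast
qed

lemma solved_all:
  assumes fin: "finite Q" and frc: "forcing Q c"
  shows "solved Q c pri good k"
proof -
  obtain d where d: "\<And>q. q \<in> Q \<Longrightarrow> pri q < d"
    using fin by (metis finite_imageI finite_nat_set_iff_bounded imageI)
  \<comment> \<open>Beyond all priorities every move ends the play, so one step of forcing settles
    the game.\<close>
  have base: "solved Q c pri good k" if "d \<le> k" for k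
  proof -
    define W where "W Z = {q\<in>Q. c q {q'. q' \<in> Z (pri q')}}" for Z
    have "mono W"
      by (rule monoI) (auto simp: W_def le_fun_def elim!: forcing_mono[OF frc])
    moreover have "progress c pri good k Z (W Z)" for Z
      unfolding progress_def W_def
    proof (intro exI[of _ "\<lambda>_ _. 0"] ballI, goal_cases)
      case (1 q)
      then have "c q {q'. q' \<in> Z (pri q')}" "q \<in> Q" by auto
      then show ?case
        by (elim forcing_mono[OF frc, rotated]) (use d that in \<open>auto simp: target_def dest!: d\<close>)
    qed
    moreover have "progress (dual_force c) pri (\<lambda>i. \<not> good i) k (\<lambda>i. - Z i) (Q - W Z)" for Z
      unfolding progress_def
    proof (intro exI[of _ "\<lambda>_ _. 0"] ballI, goal_cases)
      case (1 q)
      then have "dual_force c q {q'. q' \<notin> Z (pri q')}" "q \<in> Q"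
        by (auto simp: W_def dual_force_def Compl_eq)
      then show ?case
        by (elim forcing_mono[OF forcing_dual[OF frc], rotated]) (use d that in \<open>auto
            simp: target_def dest!: d\<close>)
    qed
    ultimately show ?thesis unfolding solved_def by (intro exI[of _ W]) (auto simp: W_def)
  qed
  \<comment> \<open>A bad \<open>k\<close> is good for the opponent: dualise, apply the step,
    dualise back.\<close>
  have step: "solved Q c pri good k" if "solved Q c pri good (Suc k)" for k
  proof (cases "good k")
    case True
    then show ?thesis using solved_step[OF fin frc that] by blast
  next
    case False
    then have "solved Q (dual_force c) pri (\<lambda>i. \<not> good i) k"
      using solved_step[OF fin forcing_dual[OF frc] solved_dual[OF that]] by blast
    from solved_dual[OF this] show ?thesis by (simp add: dual_force_idem)
  qed
  have "solved Q c pri good (d - n)" for n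
  proof (induction n)
    case (Suc n)
    then show ?case using step[of "d - Suc n"] by (cases "n < d") (auto simp: Suc_diff_Suc)
  qed (simp add: base)
  from this[of "d - k"] show ?thesis using base[of k] by (cases "d \<le> k") auto
qed

text \<open>Once no priority below \<open>m\<close> occurs, component \<open>m\<close> never
  increases, and each visit to a bad \<open>m\<close> would lower it; a natural number cannot fall
  infinitely often.\<close>

lemma progress_play:
  fixes s :: "nat \<Rightarrow> 'q" and g :: "nat \<Rightarrow> 'q \<Rightarrow> nat"
  assumes dec: "\<And>t i. i \<le> pri (s (Suc t)) \<Longrightarrow> g i (s (Suc t)) \<le> g i (s t)"
    and str: "\<And>t. \<not> good (pri (s (Suc t))) \<Longrightarrow> g (pri (s (Suc t))) (s (Suc t)) < g (pri (s (Suc t)))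
        (s t)"
    and inf: "\<exists>\<^sub>\<infinity>t. pri (s t) = m" and low: "\<forall>\<^sub>\<infinity>t. m \<le> pri (s t)"
  shows "good m"
proof (rule ccontr)
  assume bad: "\<not> good m"
  from low obtain T where T: "\<And>t. t \<ge> T \<Longrightarrow> m \<le> pri (s t)"
    unfolding MOST_nat_le by blast
  have mon: "T \<le> t \<Longrightarrow> t \<le> t' \<Longrightarrow> g m (s t') \<le> g m (s t)" for t t'
  proof (induction "t' - t" arbitrary: t')
    case (Suc n)
    then obtain u where u: "t' = Suc u" "t \<le> u" by (cases t') auto
    then have "g m (s u) \<le> g m (s t)" using Suc by auto
    moreover have "g m (s t') \<le> g m (s u)" using dec T u Suc by auto
    ultimately show ?case by simp
  qed simp
  have "\<exists>t\<ge>T. g m (s t) + n \<le> g m (s T)" for n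
  proof (induction n)
    case (Suc n)
    then obtain t where t: "t \<ge> T" "g m (s t) + n \<le> g m (s T)" by blast
    obtain u where u: "u > t" "pri (s u) = m" using inf unfolding INFM_nat by blast
    then obtain w where w: "u = Suc w" by (cases u) auto
    have "g m (s u) < g m (s w)" using str[of w] u w bad by simp
    moreover have "g m (s w) \<le> g m (s t)" using mon t u w by simp
    ultimately show ?case using t u by (intro exI[of _ u]) auto
  qed (auto)
  from this[of "Suc (g m (s T))"] show False by auto
qed

text \<open>Measures depend on the current state only, so the strategies are positional. The types
  carry the asymmetry of the problem: \<open>\<tau>\<close> also sees the current letter of its
  opponent, as a C-operator does, whereas \<open>\<sigma>\<close> sees the state alone, as an
  SC-operator does.\<close>

lemma parity_game:
  fixes \<delta> :: "'q \<Rightarrow> 'a \<Rightarrow> 'b \<Rightarrow> 'q" and pri :: "'q \<Rightarrow> nat"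
  assumes fin: "finite Q" and cl: "\<And>q a b. q \<in> Q \<Longrightarrow> \<delta> q a b \<in> Q" and q0: "q0 \<in> Q"
  obtains (second) \<tau> where "\<And>s x m. s 0 = q0 \<Longrightarrow> (\<And>t. s (Suc t) = \<delta> (s t) (x t) (\<tau> (s t) (x t))) \<Longrightarrow>
      \<exists>\<^sub>\<infinity>t. pri (s t) = m \<Longrightarrow> \<forall>\<^sub>\<infinity>t. m \<le> pri (s t) \<Longrightarrow> even m"
  | (first) \<sigma> where "\<And>s y m. s 0 = q0 \<Longrightarrow> (\<And>t. s (Suc t) = \<delta> (s t) (\<sigma> (s t)) (y t)) \<Longrightarrow>
      \<exists>\<^sub>\<infinity>t. pri (s t) = m \<Longrightarrow> \<forall>\<^sub>\<infinity>t. m \<le> pri (s t) \<Longrightarrow> odd m"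
proof -
  define c where "c q W \<longleftrightarrow> (\<forall>a. \<exists>b. \<delta> q a b \<in> W)" for q W
  have frc: "forcing Q c" unfolding forcing_def c_def using cl by blast
  have dc: "dual_force c q W \<longleftrightarrow> (\<exists>a. \<forall>b. \<delta> q a b \<in> W)" for q W
    unfolding dual_force_def c_def by auto
  obtain W where W: "W \<subseteq> Q" "progress c pri even 0 (\<lambda>_. {}) W"
      "progress (dual_force c) pri (\<lambda>i. \<not> even i) 0 (\<lambda>_. - {}) (Q - W)"
    using solved_all[OF fin frc, of pri even 0] unfolding solved_def by blast
  show thesis
  proof (cases "q0 \<in> W")
    case True
    from W(2) obtain g where "\<forall>q\<in>W. \<forall>a. \<exists>b. \<delta> q a b \<in> target pri even 0 (\<lambda>_. {}) W g q"
      unfolding progress_def c_def by blast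
    then obtain \<tau> where \<tau>: "\<And>q a. q \<in> W \<Longrightarrow> \<delta> q a (\<tau> q a) \<in> target pri even 0 (\<lambda>_. {}) W g q"
      by metis
    show thesis
    proof (rule second[of \<tau>])
      fix s x m assume s: "s 0 = q0" "\<And>t. s (Suc t) = \<delta> (s t) (x t) (\<tau> (s t) (x t))"
        and m: "\<exists>\<^sub>\<infinity>t. pri (s t) = m" "\<forall>\<^sub>\<infinity>t. m \<le> pri (s t)"
      have sW: "s t \<in> W" for t by (induction t) (use s True \<tau> in \<open>auto simp: target_def\<close>)
      show "even m"
        by (rule progress_play[where g = g and pri = pri and s = s]) (use \<tau>[OF sW] s m in \<open>auto
            simp: target_def\<close>)
    qed
  next
    case False
    from W(3) obtain g
      where "\<forall>q\<in>Q - W. \<exists>a. \<forall>b. \<delta> q a b \<in> target pri (\<lambda>i. \<not> even i) 0 (\<lambda>_. - {}) (Q - W) g q"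
      unfolding progress_def dc by blast
    then obtain \<sigma> where
      \<sigma>: "\<And>q b. q \<in> Q - W \<Longrightarrow> \<delta> q (\<sigma> q) b \<in> target pri (\<lambda>i. \<not> even i) 0 (\<lambda>_. - {}) (Q - W) g q"
      by metis
    show thesis
    proof (rule first[of \<sigma>])
      fix s y m assume s: "s 0 = q0" "\<And>t. s (Suc t) = \<delta> (s t) (\<sigma> (s t)) (y t)"
        and m: "\<exists>\<^sub>\<infinity>t. pri (s t) = m" "\<forall>\<^sub>\<infinity>t. m \<le> pri (s t)"
      have sW: "s t \<in> Q - W" for t by (induction t) (use s False q0 \<sigma> in \<open>auto simp: target_def\<close>)
      have "\<not> even m"
        by (rule progress_play[where g = g and pri = pri and s = s and good = "\<lambda>i. \<not> even i"])
            (use \<sigma>[OF sW] s m in \<open>auto simp: target_def\<close>)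
      then show "odd m" .
    qed
  qed
qed

section \<open>Congruences of finite index\<close>

definition seg :: "(nat \<Rightarrow> 'l) \<Rightarrow> nat \<Rightarrow> nat \<Rightarrow> 'l list" where
  "seg \<alpha> x y = map \<alpha> [x..<y]"

lemma seg_self [simp]: "seg \<alpha> x x = []"
  by (simp add: seg_def)

lemma length_seg [simp]: "length (seg \<alpha> x y) = y - x"
  by (simp add: seg_def)

lemma nth_seg [simp]: "i < y - x \<Longrightarrow> seg \<alpha> x y ! i = \<alpha> (x + i)"
  by (simp add: seg_def)

lemma seg_append: "x \<le> y \<Longrightarrow> y \<le> z \<Longrightarrow> seg \<alpha> x z = seg \<alpha> x y @ seg \<alpha> y z"
  by (rule nth_equalityI) (auto simp: nth_append add.commute)

lemma seg_Suc: "x \<le> y \<Longrightarrow> seg \<alpha> x (Suc y) = seg \<alpha> x y @ [\<alpha> y]"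
  by (simp add: seg_def)

lemma seg_eqI: "y - x = y' - x' \<Longrightarrow> (\<And>i. i < y - x \<Longrightarrow> \<alpha> (x + i) = \<beta> (x' + i)) \<Longrightarrow> seg \<alpha> x y = seg \<beta> x' y'"
  by (rule nth_equalityI) auto

definition cuts :: "(nat \<Rightarrow> nat) \<Rightarrow> bool" where
  "cuts x \<longleftrightarrow> strict_mono x \<and> x 0 = 0"

definition congruence :: "('l list \<Rightarrow> 's) \<Rightarrow> bool" where
  "congruence f \<longleftrightarrow> (\<forall>u u' v v'. f u = f u' \<longrightarrow> f v = f v' \<longrightarrow> f (u @ v) = f (u' @ v'))"

text \<open>The saturation condition of Buechi. One implication is enough, as the two words can be
  exchanged. All blocks are nonempty because \<open>cuts\<close> is strictly increasing.\<close>

definition saturates :: "('l list \<Rightarrow> 's) \<Rightarrow> (nat \<Rightarrow> 'l) set \<Rightarrow> bool" where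
  "saturates f L \<longleftrightarrow> (\<forall>\<alpha> \<beta> x y. cuts x \<longrightarrow> cuts y \<longrightarrow>
     (\<forall>k. f (seg \<alpha> (x k) (x (Suc k))) = f (seg \<beta> (y k) (y (Suc k)))) \<longrightarrow> \<alpha> \<in> L \<longrightarrow> \<beta> \<in> L)"

text \<open>The index bound \<open>K\<close> is kept explicit because the ranges of bounded
  quantifiers are later computed from it.\<close>

definition recog :: "nat \<Rightarrow> (nat \<Rightarrow> 'l) set \<Rightarrow> bool" where
  "recog K L \<longleftrightarrow> (\<exists>f :: 'l list \<Rightarrow> nat. range f \<subseteq> {..<K} \<and> congruence f \<and> saturates f L)"

lemma congruenceD: "congruence f \<Longrightarrow> f u = f u' \<Longrightarrow> f v = f v' \<Longrightarrow> f (u @ v) = f (u' @ v')"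
  unfolding congruence_def by blast

lemma saturatesD:
  "saturates f L \<Longrightarrow> cuts x \<Longrightarrow> cuts y \<Longrightarrow>
    (\<And>k. f (seg \<alpha> (x k) (x (Suc k))) = f (seg \<beta> (y k) (y (Suc k)))) \<Longrightarrow> \<alpha> \<in> L \<longleftrightarrow> \<beta> \<in> L"
  unfolding saturates_def by metis

lemma recogI:
  fixes f :: "'l list \<Rightarrow> 's"
  assumes "range f \<subseteq> B" "finite B" "card B \<le> K" "congruence f" "saturates f L"
  shows "recog K L"
proof -
  obtain h where h: "bij_betw h B {0..<card B}"
    using ex_bij_betw_finite_nat[OF assms(2)] by blast
  have fB: "f u \<in> B" for u using assms(1) by (rule subsetD) simp
  have eq: "h (f u) = h (f v) \<longleftrightarrow> f u = f v" for u v
    by (rule inj_on_eq_iff[OF bij_betw_imp_inj_on[OF h]]) (fact fB)+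
  have "range (h \<circ> f) \<subseteq> {..<K}"
  proof (rule image_subsetI)
    fix u
    have "h (f u) \<in> {0..<card B}" using bij_betw_imp_surj_on[OF h] fB[of u] by blast
    then show "(h \<circ> f) u \<in> {..<K}" using assms(3) by simp
  qed
  moreover have "congruence (h \<circ> f)"
    using assms(4) unfolding congruence_def o_apply eq .
  moreover have "saturates (h \<circ> f) L"
    using assms(5) unfolding saturates_def o_apply eq .
  ultimately show ?thesis unfolding recog_def by blast
qed

lemma cuts_ge: "cuts x \<Longrightarrow> k \<le> x k"
  by (simp add: cuts_def strict_mono_imp_increasing)

lemma cuts_less: "cuts x \<Longrightarrow> x k < x (Suc k)"
  by (simp add: cuts_def strict_mono_def)

section \<open>Closure properties\<close>

lemma recog_compl: "recog K L \<Longrightarrow> recog K (- L)"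
proof -
  have "saturates f (- L)" if "saturates f L" for f :: "'a list \<Rightarrow> nat"
    unfolding saturates_def
  proof (intro allI impI)
    fix \<alpha> \<beta> x y assume "cuts x" "cuts y" "\<forall>k. f (seg \<alpha> (x k) (x (Suc k))) = f (seg \<beta> (y k) (y (Suc k)))"
      "\<alpha> \<in> - L"
    then show "\<beta> \<in> - L" using saturatesD[OF that, of x y \<alpha> \<beta>] by simp
  qed
  then show "recog K L \<Longrightarrow> recog K (- L)" unfolding recog_def by blast
qed

lemma recog_inter:
  assumes "recog K L" "recog M L'"
  shows "recog (K * M) (L \<inter> L')"
proof -
  from assms obtain f g :: "'a list \<Rightarrow> nat" where f: "range f \<subseteq> {..<K}" "congruence f" "saturates f L"
    and g: "range g \<subseteq> {..<M}" "congruence g" "saturates g L'"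
    unfolding recog_def by blast
  show ?thesis
  proof (rule recogI[where f = "\<lambda>u. (f u, g u)" and B = "{..<K} \<times> {..<M}"])
    show "congruence (\<lambda>u. (f u, g u))"
      using f(2) g(2) unfolding congruence_def prod.inject by blast
    show "saturates (\<lambda>u. (f u, g u)) (L \<inter> L')"
      unfolding saturates_def
    proof (intro allI impI)
      fix \<alpha> \<beta> x y assume "cuts x" "cuts y"
        "\<forall>k. (f (seg \<alpha> (x k) (x (Suc k))), g (seg \<alpha> (x k) (x (Suc k)))) =
           (f (seg \<beta> (y k) (y (Suc k))), g (seg \<beta> (y k) (y (Suc k))))" "\<alpha> \<in> L \<inter> L'"
      then show "\<beta> \<in> L \<inter> L'"
        using saturatesD[OF f(3), of x y \<alpha> \<beta>] saturatesD[OF g(3), of x y \<alpha> \<beta>] by simp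
    qed
  qed (use f(1) g(1) in auto)
qed

lemma recog_mono: "recog K L \<Longrightarrow> K \<le> K' \<Longrightarrow> recog K' L"
  unfolding recog_def by (meson lessThan_subset_iff order_trans)

text \<open>The class of a finite word is its action on the \<open>N\<close> states: for each start
  state, the state reached and whether the run stayed safe. Such an action is a list of N entries
  with 2 * N values each. Both atomic formulas and graphs of transducers are obtained from this
  lemma.\<close>

lemma recog_safety:
  fixes \<delta> :: "nat \<Rightarrow> 'l \<Rightarrow> nat"
  assumes q: "q < N" and cl: "\<And>s a. s < N \<Longrightarrow> \<delta> s a < N"
  shows "recog ((2 * N) ^ N) {\<alpha>. \<forall>n. safe (foldl \<delta> q (seg \<alpha> 0 n)) (\<alpha> n)}"
proof -
  define st where "st s u = foldl \<delta> s u" for s u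
  define ok where "ok s u \<longleftrightarrow> (\<forall>n<length u. safe (st s (take n u)) (u ! n))" for s u
  define f where "f u = map (\<lambda>s. (st s u, ok s u)) [0..<N]" for u
  have st_less: "st s u < N" if "s < N" for s u
    using that by (induction u rule: rev_induct) (use cl in \<open>simp_all add: st_def\<close>)
  have st_app: "st s (u @ v) = st (st s u) v" for s u v by (simp add: st_def)
  have ok_app: "ok s (u @ v) \<longleftrightarrow> ok s u \<and> ok (st s u) v" for s u v
  proof (intro iffI conjI)
    assume ok: "ok s (u @ v)"
    show "ok s u" unfolding ok_def
    proof (intro allI impI)
      fix n assume "n < length u"
      then show "safe (st s (take n u)) (u ! n)"
        using ok[unfolded ok_def, rule_format, of n] by (simp add: nth_append)
    qed
    show "ok (st s u) v" unfolding ok_def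
    proof (intro allI impI)
      fix n assume "n < length v"
      then show "safe (st (st s u) (take n v)) (v ! n)"
        using ok[unfolded ok_def, rule_format, of "length u + n"] by (simp add: st_app)
    qed
  next
    assume ok: "ok s u \<and> ok (st s u) v"
    show "ok s (u @ v)" unfolding ok_def
    proof (intro allI impI)
      fix n assume n: "n < length (u @ v)"
      show "safe (st s (take n (u @ v))) ((u @ v) ! n)"
      proof (cases "n < length u")
        case True
        then show ?thesis using ok by (simp add: nth_append ok_def)
      next
        case False
        then show ?thesis using ok n by (simp add: nth_append ok_def st_app)
      qed
    qed
  qed
  have f_eq: "f u = f u' \<longleftrightarrow> (\<forall>s<N. st s u = st s u' \<and> ok s u = ok s u')" for u u'
    unfolding f_def map_eq_conv by auto
  let ?B = "{xs. set xs \<subseteq> {..<N} \<times> (UNIV :: bool set) \<and> length xs = N}"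
  let ?L = "{\<alpha>. \<forall>n. safe (st q (seg \<alpha> 0 n)) (\<alpha> n)}"
  have mem: "\<alpha> \<in> ?L \<longleftrightarrow> (\<forall>k. ok (st q (seg \<alpha> 0 (z k))) (seg \<alpha> (z k) (z (Suc k))))" if z: "cuts z" for \<alpha> z
  proof -
    have step: "ok q (seg \<alpha> 0 (z (Suc k))) \<longleftrightarrow> ok q (seg \<alpha> 0 (z k)) \<and>
        ok (st q (seg \<alpha> 0 (z k))) (seg \<alpha> (z k) (z (Suc k)))" for k
      using seg_append[of 0 "z k" "z (Suc k)" \<alpha>] cuts_less[OF z, of k] by (simp add: ok_app)
    have "\<alpha> \<in> ?L \<longleftrightarrow> (\<forall>k. ok q (seg \<alpha> 0 (z k)))"
    proof (intro iffI allI)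
      fix k assume "\<alpha> \<in> ?L"
      then show "ok q (seg \<alpha> 0 (z k))" unfolding ok_def by (simp add: seg_def take_map)
    next
      assume ok: "\<forall>k. ok q (seg \<alpha> 0 (z k))"
      have "safe (st q (seg \<alpha> 0 n)) (\<alpha> n)" for n
      proof -
        have "n < z (Suc n)" using cuts_ge[OF z, of "Suc n"] by simp
        then show ?thesis using ok[rule_format, of "Suc n"] unfolding ok_def
            by (auto simp: seg_def take_map)
      qed
      then show "\<alpha> \<in> ?L" by simp
    qed
    also have "\<dots> \<longleftrightarrow> (\<forall>k. ok (st q (seg \<alpha> 0 (z k))) (seg \<alpha> (z k) (z (Suc k))))"
    proof (intro iffI allI)
      fix k assume "\<forall>k. ok (st q (seg \<alpha> 0 (z k))) (seg \<alpha> (z k) (z (Suc k)))"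
      then show "ok q (seg \<alpha> 0 (z k))"
        by (induction k) (use step z in \<open>auto simp: cuts_def ok_def\<close>)
    qed (use step in blast)
    finally show ?thesis .
  qed
  show ?thesis unfolding st_def[symmetric]
  proof (rule recogI[where f = f and B = ?B])
    have "card ?B = card ({..<N} \<times> (UNIV :: bool set)) ^ N"
      by (rule card_lists_length_eq) simp
    then show "card ?B \<le> (2 * N) ^ N" by (simp add: card_cartesian_product mult.commute)
    show "finite ?B" by (rule finite_lists_length_eq) simp
    show "range f \<subseteq> ?B" using st_less by (auto simp: f_def)
    show "congruence f" unfolding congruence_def f_eq st_app ok_app using st_less by simp
    show "saturates f ?L"
      unfolding saturates_def
    proof (intro allI impI)
      fix \<alpha> \<beta> w z assume w: "cuts w" and z: "cuts z"
        and eq: "\<forall>k. f (seg \<alpha> (w k) (w (Suc k))) = f (seg \<beta> (z k) (z (Suc k)))" and "\<alpha> \<in> ?L"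
      then have ok: "ok (st q (seg \<alpha> 0 (w k))) (seg \<alpha> (w k) (w (Suc k)))" for k using mem[OF w] by blast
      have st: "st q (seg \<alpha> 0 (w k)) = st q (seg \<beta> 0 (z k))" for k
      proof (induction k)
        case 0
        then show ?case using w z by (simp add: cuts_def)
      next
        case (Suc k)
        then show ?case
          using seg_append[of 0 "w k" "w (Suc k)" \<alpha>] cuts_less[OF w, of k] seg_append[of 0 "z k"
              "z (Suc k)" \<beta>] cuts_less[OF z, of k]
            eq[rule_format, of k] st_less[OF q] by (simp add: st_app f_eq)
      qed
      have "ok (st q (seg \<beta> 0 (z k))) (seg \<beta> (z k) (z (Suc k)))" for k
        using ok[of k] eq[rule_format, of k] st_less[OF q] unfolding f_eq st by blast
      then show "\<beta> \<in> ?L" using mem[OF z] by blast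
    qed
  qed
qed

lemma recog_ex:
  fixes Q :: "'l \<Rightarrow> bool"
  shows "recog 2 {\<alpha>. \<exists>n. Q (\<alpha> n)}"
proof -
  have "recog ((2 * 1) ^ 1) {\<alpha> :: nat \<Rightarrow> 'l. \<forall>n. \<not> Q (\<alpha> n)}"
    by (rule recog_safety[where \<delta> = "\<lambda>_ _. 0" and safe = "\<lambda>_ a. \<not> Q a"]) simp_all
  from recog_compl[OF this] show ?thesis by (simp add: Collect_neg_eq[symmetric])
qed

text \<open>State 1 remembers that \<open>Q\<close> occurred strictly earlier; two states give (2 *
  2) ^ 2 = 16.\<close>

lemma recog_ex_less:
  fixes Q R :: "'l \<Rightarrow> bool"
  shows "recog 16 {\<alpha>. \<exists>m n. m < n \<and> Q (\<alpha> m) \<and> R (\<alpha> n)}"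
proof -
  define d where "d s a = (if Q a then 1 else s)" for s :: nat and a
  have st: "foldl d 0 (seg \<alpha> 0 n) = of_bool (\<exists>m<n. Q (\<alpha> m))" for \<alpha> n
    by (induction n) (auto simp: seg_Suc d_def less_Suc_eq)
  have st_1: "foldl d 0 (seg \<alpha> 0 n) = 1 \<longleftrightarrow> (\<exists>m<n. Q (\<alpha> m))" for \<alpha> n
    unfolding st by (simp add: of_bool_def)
  have "recog ((2 * 2) ^ 2) {\<alpha>. \<forall>n. \<not> (foldl d 0 (seg \<alpha> 0 n) = 1 \<and> R (\<alpha> n))}"
    by (rule recog_safety[where safe = "\<lambda>s a. \<not> (s = 1 \<and> R a)"]) (simp_all add: d_def)
  from recog_compl[OF this] have 16: "recog 16 (- {\<alpha>. \<forall>n. \<not> ((\<exists>m<n. Q (\<alpha> m)) \<and> R (\<alpha> n))})"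
    unfolding st_1 by simp
  have eq: "- {\<alpha>. \<forall>n. \<not> ((\<exists>m<n. Q (\<alpha> m)) \<and> R (\<alpha> n))} = {\<alpha>. \<exists>m n. m < n \<and> Q (\<alpha> m) \<and> R (\<alpha> n)}"
    by blast
  show ?thesis using 16 unfolding eq .
qed

text \<open>Letters of words are sets of tracks; \<open>upd\<close> overwrites one track.\<close>

definition upd :: "(nat \<Rightarrow> 'v set) \<Rightarrow> 'v \<Rightarrow> nat set \<Rightarrow> nat \<Rightarrow> 'v set" where
  "upd \<alpha> j A n = (if n \<in> A then insert j (\<alpha> n) else \<alpha> n - {j})"

text \<open>Each position lies in exactly one block, so relabellings chosen separately for the
  blocks combine to one of the whole word. This is what makes projection compatible with
  saturation.\<close>

lemma seg_upd_glue:
  assumes x: "cuts x"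
  shows "seg (upd \<beta> j {n. \<exists>k. x k \<le> n \<and> n < x (Suc k) \<and> n \<in> A k}) (x k) (x (Suc k)) =
    seg (upd \<beta> j (A k)) (x k) (x (Suc k))"
proof (rule seg_eqI)
  fix i assume i: "i < x (Suc k) - x k"
  have "l = k" if "x l \<le> x k + i" "x k + i < x (Suc l)" for l
  proof (rule ccontr)
    assume "l \<noteq> k"
    then consider "Suc l \<le> k" | "Suc k \<le> l" by linarith
    then show False
    proof cases
      case 1
      then have "x (Suc l) \<le> x k" using x by (simp add: cuts_def strict_mono_less_eq)
      then show False using that by simp
    next
      case 2
      then have "x (Suc k) \<le> x l" using x by (simp add: cuts_def strict_mono_less_eq)
      then show False using that i by simp
    qed
  qed
  then have "(\<exists>l. x l \<le> x k + i \<and> x k + i < x (Suc l) \<and> x k + i \<in> A l) \<longleftrightarrow> x k + i \<in> A k"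
    using i by (metis add.commute le_add2 less_diff_conv)
  then show "upd \<beta> j {n. \<exists>k. x k \<le> n \<and> n < x (Suc k) \<and> n \<in> A k} (x k + i) = upd \<beta> j (A k) (x k + i)"
    by (simp add: upd_def)
qed simp

definition updl :: "'v set list \<Rightarrow> 'v \<Rightarrow> nat set \<Rightarrow> 'v set list" where
  "updl u j A = map (\<lambda>n. if n \<in> A then insert j (u ! n) else u ! n - {j}) [0..<length u]"

lemma length_updl [simp]: "length (updl u j A) = length u"
  by (simp add: updl_def)

lemma updl_append: "updl (u @ v) j A = updl u j A @ updl v j {n. length u + n \<in> A}"
  by (rule nth_equalityI) (auto simp: updl_def nth_append)

lemma updl_append': "updl u j A @ updl v j B =
    updl (u @ v) j {n. if n < length u then n \<in> A else n - length u \<in> B}"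
  by (rule nth_equalityI) (auto simp: updl_def nth_append)

lemma updl_seg: "updl (seg \<alpha> x y) j A = seg (upd \<alpha> j {n. n - x \<in> A}) x y"
  by (rule nth_equalityI) (auto simp: updl_def upd_def)

lemma seg_upd: "seg (upd \<alpha> j A) x y = updl (seg \<alpha> x y) j {n. x + n \<in> A}"
  by (rule nth_equalityI) (auto simp: updl_def upd_def)

text \<open>Power set construction: the class of a word is the set of classes of all its
  relabellings on track \<open>j\<close>. For saturation, a relabelling is matched block by block
  and the results are glued.\<close>

lemma recog_proj:
  fixes L :: "(nat \<Rightarrow> 'v set) set"
  assumes "recog K L"
  shows "recog (2 ^ K) {\<alpha>. \<exists>A. upd \<alpha> j A \<in> L}"
proof -
  from assms obtain f :: "'v set list \<Rightarrow> nat" where f: "range f \<subseteq> {..<K}" "congruence f" "saturates f L"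
    unfolding recog_def by blast
  define g where "g u = range (\<lambda>A. f (updl u j A))" for u
  have g_app: "g (u @ v) = {s. \<exists>A B. s = f (updl u j A @ updl v j B)}" for u v
  proof (intro equalityI subsetI)
    fix s assume "s \<in> g (u @ v)"
    then show "s \<in> {s. \<exists>A B. s = f (updl u j A @ updl v j B)}"
      unfolding g_def by (auto simp only: updl_append)
  next
    fix s assume "s \<in> {s. \<exists>A B. s = f (updl u j A @ updl v j B)}"
    then show "s \<in> g (u @ v)"
      unfolding g_def by (auto simp only: updl_append')
  qed
  show ?thesis
  proof (rule recogI[where f = g and B = "Pow {..<K}"])
    show "congruence g"
      unfolding congruence_def
    proof (intro allI impI)
      have sub: "g (u @ v) \<subseteq> g (u' @ v')" if "g u = g u'" "g v = g v'" for u u' v v'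
      proof
        fix s assume "s \<in> g (u @ v)"
        then obtain A B where s: "s = f (updl u j A @ updl v j B)" by (auto simp: g_app)
        have "f (updl u j A) \<in> g u'" using that by (auto simp: g_def)
        moreover have "f (updl v j B) \<in> g v'" using that by (auto simp: g_def)
        ultimately obtain A' B' where "f (updl u j A) = f (updl u' j A')"
            "f (updl v j B) = f (updl v' j B')"
          by (auto simp: g_def)
        then have "s = f (updl u' j A' @ updl v' j B')" unfolding s by (rule congruenceD[OF f(2)])
        then show "s \<in> g (u' @ v')" by (auto simp: g_app)
      qed
      fix u u' v v' assume "g u = g u'" "g v = g v'"
      then show "g (u @ v) = g (u' @ v')" using sub[of u u' v v'] sub[of u' u v' v] by auto
    qed
    show "saturates g {\<alpha>. \<exists>A. upd \<alpha> j A \<in> L}"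
      unfolding saturates_def
    proof (intro allI impI)
      fix \<alpha> \<beta> x y assume x: "cuts x" and y: "cuts y"
        and eq: "\<forall>k. g (seg \<alpha> (x k) (x (Suc k))) = g (seg \<beta> (y k) (y (Suc k)))"
        and "\<alpha> \<in> {\<alpha>. \<exists>A. upd \<alpha> j A \<in> L}"
      then obtain A where A: "upd \<alpha> j A \<in> L" by blast
      have "\<exists>B. f (seg (upd \<alpha> j A) (x k) (x (Suc k))) = f (seg (upd \<beta> j B) (y k) (y (Suc k)))" for k
      proof -
        have "f (seg (upd \<alpha> j A) (x k) (x (Suc k))) \<in> g (seg \<alpha> (x k) (x (Suc k)))"
          by (auto simp: g_def seg_upd)
        then obtain C where "f (seg (upd \<alpha> j A) (x k) (x (Suc k))) = f (updl (seg \<beta> (y k)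
            (y (Suc k))) j C)"
          using eq by (auto simp: g_def)
        then show ?thesis unfolding updl_seg by blast
      qed
      then obtain B where B: "f (seg (upd \<alpha> j A) (x k) (x (Suc k))) = f (seg (upd \<beta> j (B k)) (y k)
          (y (Suc k)))" for k
        by metis
      let ?B = "{n. \<exists>k. y k \<le> n \<and> n < y (Suc k) \<and> n \<in> B k}"
      have "upd \<beta> j ?B \<in> L"
        using saturatesD[OF f(3) x y, of "upd \<alpha> j A" "upd \<beta> j ?B"] A B by (simp add: seg_upd_glue[OF y])
      then show "\<beta> \<in> {\<alpha>. \<exists>A. upd \<alpha> j A \<in> L}" by blast
    qed
  qed (use f(1) in \<open>auto simp: g_def card_Pow\<close>)
qed

text \<open>The factor 32 is 2 * 16: index 2 for a marked position to exist, index 16 for no two of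
  them to be different. Only the restriction happens here; the projection itself follows in
  \<open>recog_lang\<close>.\<close>

lemma recog_proj_singleton:
  fixes L :: "(nat \<Rightarrow> 'v set) set"
  assumes "recog K L"
  shows "recog (32 * K) {\<alpha>. (\<exists>n. {n. j \<in> \<alpha> n} = {n}) \<and> \<alpha> \<in> L}"
proof -
  have "{\<alpha>. \<exists>n. {n. j \<in> \<alpha> n} = {n :: nat}} =
    {\<alpha>. \<exists>n. j \<in> \<alpha> n} \<inter> - {\<alpha>. \<exists>m n. m < n \<and> j \<in> \<alpha> m \<and> j \<in> (\<alpha> n :: 'v set)}"
  proof (intro equalityI subsetI)
    fix \<alpha> :: "nat \<Rightarrow> 'v set" assume "\<alpha> \<in> {\<alpha>. \<exists>n. j \<in> \<alpha> n} \<inter> - {\<alpha>. \<exists>m n. m < n \<and> j \<in> \<alpha> m \<and>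
        j \<in> (\<alpha> n :: 'v set)}"
    then obtain n where "j \<in> \<alpha> n" "\<And>m. j \<in> \<alpha> m \<Longrightarrow> \<not> m < n \<and> \<not> n < m" by blast
    then have "j \<in> \<alpha> m \<longleftrightarrow> m = n" for m
      by (metis linorder_neq_iff)
    then have "{n. j \<in> \<alpha> n} = {n}" by simp
    then show "\<alpha> \<in> {\<alpha>. \<exists>n. {n. j \<in> \<alpha> n} = {n}}" by blast
  qed (auto simp: set_eq_iff)
  then have "recog (2 * 16) {\<alpha>. \<exists>n. {n. j \<in> \<alpha> n} = {n :: nat}}"
    using recog_inter[OF recog_ex[of "\<lambda>a. j \<in> a"] recog_compl[OF recog_ex_less[of "\<lambda>a. j \<in> a"
        "\<lambda>a. j \<in> a"]]] by simp
  from recog_inter[OF this assms] show ?thesis by (simp add: Int_def)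
qed

section \<open>Deterministic parity automata\<close>

text \<open>Determinization. At time \<open>t\<close> the positions \<open>x < t\<close> are identified if \<open>f\<close> agrees on the segments
  \<open>[x, t)\<close>, and the least representatives are tracked; once identified, positions remain so. There are
  at most \<open>K\<close> representatives, so infinitely often some position is absorbed by an older one. If \<open>y\<close> is the
  oldest one that absorbs infinitely many \<open>x\<close> and \<open>e\<close> occurs infinitely often as the value of \<open>[y, x)\<close>,
  then all segments between suitable such \<open>x\<close> have value \<open>e\<close>, which decides membership in \<open>L\<close>.\<close>

locale dpa =
  fixes f :: "'l list \<Rightarrow> nat" and K :: nat and L :: "(nat \<Rightarrow> 'l) set"
  assumes range: "range f \<subseteq> {..<K}" and cong: "congruence f" and sat: "saturates f L"
begin

definition reps :: "(nat \<Rightarrow> 'l) \<Rightarrow> nat \<Rightarrow> nat set" where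
  "reps \<alpha> t = {x. x < t \<and> (\<forall>y<x. f (seg \<alpha> y t) \<noteq> f (seg \<alpha> x t))}"

text \<open>A representative is named by the value of \<open>f\<close> from there up to
  \<open>t\<close>, which is injective on representatives. The triples thus record the order and all
  inner segments without absolute positions, and only finitely many profiles exist.\<close>

definition profile :: "(nat \<Rightarrow> 'l) \<Rightarrow> nat \<Rightarrow> (nat \<times> nat \<times> nat) set" where
  "profile \<alpha> t = {(f (seg \<alpha> x t), f (seg \<alpha> y t), f (seg \<alpha> x y)) | x y. x \<in> reps \<alpha> t \<and> y \<in> reps \<alpha> t \<and>
      x \<le> y}"

text \<open>Stands for the sequence of block classes s, e, e, e, ...; by saturation one word of
  \<open>L\<close> with such a factorisation puts all of them into \<open>L\<close>.\<close>

definition good :: "nat \<Rightarrow> nat \<Rightarrow> bool" where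
  "good s e \<longleftrightarrow> (\<exists>\<alpha>\<in>L. \<exists>x. cuts x \<and> f (seg \<alpha> 0 (x (Suc 0))) = s \<and>
      (\<forall>k>0. f (seg \<alpha> (x k) (x (Suc k))) = e))"

definition merge :: "(nat \<Rightarrow> 'l) \<Rightarrow> nat \<Rightarrow> nat \<Rightarrow> nat \<Rightarrow> bool" where
  "merge \<alpha> t y x \<longleftrightarrow> y \<in> reps \<alpha> t \<and> x \<in> insert t (reps \<alpha> t) \<and> y < x \<and>
      f (seg \<alpha> y (Suc t)) = f (seg \<alpha> x (Suc t))"

definition idx :: "(nat \<Rightarrow> 'l) \<Rightarrow> nat \<Rightarrow> nat \<Rightarrow> nat" where
  "idx \<alpha> t y = card {z \<in> reps \<alpha> t. z < y}"

text \<open>Older absorbers yield smaller priorities, and the last bit tells whether the loop closed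
  by the absorption is accepted. As indices are below \<open>K\<close>, the even number
  \<open>2 * K\<close> exceeds all of these and remains as the minimum when nothing is
  absorbed.\<close>

definition prios :: "(nat \<Rightarrow> 'l) \<Rightarrow> nat \<Rightarrow> nat set" where
  "prios \<alpha> t = insert (2 * K) {2 * idx \<alpha> t y + of_bool (\<not> good (f (seg \<alpha> 0 x)) (f (seg \<alpha> y x))) | y
      x. merge \<alpha> t y x}"

definition prio :: "(nat \<Rightarrow> 'l) \<Rightarrow> nat \<Rightarrow> nat" where
  "prio \<alpha> t = Min (prios \<alpha> t)"

lemma finite_reps [simp]: "finite (reps \<alpha> t)"
  by (rule finite_subset[of _ "{..<t}"]) (auto simp: reps_def)

lemma reps_less: "x \<in> reps \<alpha> t \<Longrightarrow> x < t"
  by (simp add: reps_def)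

lemma inj_reps: "x \<in> reps \<alpha> t \<Longrightarrow> y \<in> reps \<alpha> t \<Longrightarrow> f (seg \<alpha> x t) = f (seg \<alpha> y t) \<Longrightarrow> x = y"
  unfolding reps_def by (auto) (metis linorder_neqE_nat)

lemma f_less: "f u < K"
  using range by auto

lemma card_reps: "card (reps \<alpha> t) \<le> K"
proof -
  have "card (reps \<alpha> t) \<le> card {..<K}"
    by (rule card_inj_on_le[where f = "\<lambda>x. f (seg \<alpha> x t)"]) (auto simp: inj_on_def f_less
        intro: inj_reps)
  then show ?thesis by simp
qed

lemma reps_rep:
  assumes "y < t"
  obtains y0 where "y0 \<in> reps \<alpha> t" "y0 \<le> y" "f (seg \<alpha> y0 t) = f (seg \<alpha> y t)"
proof -
  let ?y = "LEAST z. f (seg \<alpha> z t) = f (seg \<alpha> y t)"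
  have 1: "f (seg \<alpha> ?y t) = f (seg \<alpha> y t)" by (rule LeastI) simp
  have 2: "?y \<le> y" by (rule Least_le) simp
  have "f (seg \<alpha> z t) \<noteq> f (seg \<alpha> ?y t)" if "z < ?y" for z
    using not_less_Least[OF that] 1 by simp
  then have "?y \<in> reps \<alpha> t" unfolding reps_def using le_less_trans[OF 2 assms] by blast
  then show thesis using that[of ?y] 1 2 by blast
qed

lemma f_Suc: "x \<le> t \<Longrightarrow> x' \<le> t' \<Longrightarrow> f (seg \<alpha> x t) = f (seg \<beta> x' t') \<Longrightarrow> \<alpha> t = \<beta> t' \<Longrightarrow>
    f (seg \<alpha> x (Suc t)) = f (seg \<beta> x' (Suc t'))"
  unfolding seg_Suc by (rule congruenceD[OF cong]) auto

text \<open>Any position before \<open>t\<close> shares its class with a representative that is no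
  later, and equal classes stay equal under a common right extension; so comparing with current
  representatives and the new position is enough.\<close>

lemma reps_Suc: "x \<in> reps \<alpha> (Suc t) \<longleftrightarrow> x \<in> insert t (reps \<alpha> t) \<and>
    (\<forall>y \<in> insert t (reps \<alpha> t). y < x \<longrightarrow> f (seg \<alpha> y (Suc t)) \<noteq> f (seg \<alpha> x (Suc t)))"
proof (intro iffI conjI ballI impI)
  assume x: "x \<in> reps \<alpha> (Suc t)"
  show "x \<in> insert t (reps \<alpha> t)"
  proof (cases "x = t")
    case False
    then have "x < t" using x by (auto simp: reps_def)
    moreover have "f (seg \<alpha> y t) \<noteq> f (seg \<alpha> x t)" if "y < x" for y
      using f_Suc[of y t x t \<alpha> \<alpha>] that x \<open>x < t\<close> by (auto simp: reps_def)
    ultimately show ?thesis by (auto simp: reps_def)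
  qed simp
next
  fix y assume "x \<in> reps \<alpha> (Suc t)" "y < x"
  then show "f (seg \<alpha> y (Suc t)) \<noteq> f (seg \<alpha> x (Suc t))" by (auto simp: reps_def)
next
  assume x: "x \<in> insert t (reps \<alpha> t) \<and> (\<forall>y \<in> insert t (reps \<alpha> t). y < x \<longrightarrow>
      f (seg \<alpha> y (Suc t)) \<noteq> f (seg \<alpha> x (Suc t)))"
  then have "x \<le> t" by (auto dest: reps_less)
  moreover have "f (seg \<alpha> y (Suc t)) \<noteq> f (seg \<alpha> x (Suc t))" if "y < x" for y
  proof -
    have "y < t" using that \<open>x \<le> t\<close> by simp
    then obtain y0 where y0: "y0 \<in> reps \<alpha> t" "y0 \<le> y" "f (seg \<alpha> y0 t) = f (seg \<alpha> y t)"
        by (rule reps_rep)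
    have "f (seg \<alpha> y0 (Suc t)) = f (seg \<alpha> y (Suc t))"
      by (rule f_Suc) (use y0 \<open>y < t\<close> in auto)
    then show ?thesis using x y0 that by (metis insertCI order.strict_trans1)
  qed
  ultimately show "x \<in> reps \<alpha> (Suc t)" by (auto simp: reps_def)
qed

text \<open>An isomorphism between the tracked structures, with the current time as an additional
  top element. It compares different words at different times, as a finite automaton has to.\<close>

definition corr :: "(nat \<Rightarrow> 'l) \<Rightarrow> nat \<Rightarrow> (nat \<Rightarrow> 'l) \<Rightarrow> nat \<Rightarrow> (nat \<Rightarrow> nat) \<Rightarrow> bool" where
  "corr \<alpha> t \<beta> t' h \<longleftrightarrow> h ` reps \<alpha> t = reps \<beta> t' \<and> strict_mono_on (insert t (reps \<alpha> t)) h \<and> h t = t' \<and>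
    (\<forall>x \<in> insert t (reps \<alpha> t). \<forall>y \<in> insert t (reps \<alpha> t). x \<le> y \<longrightarrow> f (seg \<alpha> x y) = f (seg \<beta> (h x) (h y)))"

lemma profile_corr:
  assumes "profile \<alpha> t = profile \<beta> t'"
  obtains h where "corr \<alpha> t \<beta> t' h"
proof -
  have sub: "\<exists>x'\<in>reps \<beta> t'. f (seg \<beta> x' t') = f (seg \<alpha> x t)"
      if "x \<in> reps \<alpha> t" "profile \<alpha> t = profile \<beta> t'" for x \<alpha> \<beta> t t'
  proof -
    have "(f (seg \<alpha> x t), f (seg \<alpha> x t), f (seg \<alpha> x x)) \<in> profile \<beta> t'"
      unfolding that(2)[symmetric] using that(1) unfolding profile_def by blast
    then show ?thesis unfolding profile_def by auto
  qed
  then obtain h where h: "\<And>x. x \<in> reps \<alpha> t \<Longrightarrow> h x \<in> reps \<beta> t' \<and> f (seg \<beta> (h x) t') = f (seg \<alpha> x t)"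
    using sub[OF _ assms] by meson
  have pair: "h x \<le> h y \<and> f (seg \<alpha> x y) = f (seg \<beta> (h x) (h y))" if "x \<in> reps \<alpha> t" "y \<in> reps \<alpha> t"
      "x \<le> y" for x y
  proof -
    have "(f (seg \<alpha> x t), f (seg \<alpha> y t), f (seg \<alpha> x y)) \<in> profile \<beta> t'"
      using that unfolding assms[symmetric] by (auto simp: profile_def)
    then obtain x' y' where *: "x' \<in> reps \<beta> t'" "y' \<in> reps \<beta> t'" "x' \<le> y'"
        "f (seg \<alpha> x t) = f (seg \<beta> x' t')"
      "f (seg \<alpha> y t) = f (seg \<beta> y' t')" "f (seg \<alpha> x y) = f (seg \<beta> x' y')"
      unfolding profile_def by auto
    then have "x' = h x" "y' = h y" using h that inj_reps by metis+
    then show ?thesis using * by simp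
  qed
  have inj: "x = y" if "x \<in> reps \<alpha> t" "y \<in> reps \<alpha> t" "h x = h y" for x y
    using h that inj_reps by metis
  let ?h = "h(t := t')"
  have tR: "t \<notin> reps \<alpha> t" by (simp add: reps_def)
  have hR: "x \<in> reps \<alpha> t \<Longrightarrow> ?h x = h x" for x using tR by auto
  have "corr \<alpha> t \<beta> t' ?h"
    unfolding corr_def
  proof (intro conjI ballI impI)
    show "?h ` reps \<alpha> t = reps \<beta> t'"
    proof (intro equalityI subsetI)
      fix x' assume x': "x' \<in> reps \<beta> t'"
      then obtain x where x: "x \<in> reps \<alpha> t" "f (seg \<alpha> x t) = f (seg \<beta> x' t')" using sub assms by metis
      then have "h x = x'" using h[OF x(1)] x' inj_reps by metis
      then show "x' \<in> ?h ` reps \<alpha> t" using x hR by force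
    next
      fix x' assume "x' \<in> ?h ` reps \<alpha> t"
      then obtain x where "x \<in> reps \<alpha> t" "x' = ?h x" by blast
      then show "x' \<in> reps \<beta> t'" using h hR by metis
    qed
    show "strict_mono_on (insert t (reps \<alpha> t)) ?h"
    proof (rule strict_mono_onI)
      fix x y assume xy: "x \<in> insert t (reps \<alpha> t)" "y \<in> insert t (reps \<alpha> t)" "x < y"
      then have x: "x \<in> reps \<alpha> t" using reps_less by fastforce
      show "?h x < ?h y"
      proof (cases "y = t")
        case True
        have "h x < t'" using h[OF x] reps_less by blast
        then show ?thesis using True hR[OF x] by simp
      next
        case False
        then have y: "y \<in> reps \<alpha> t" using xy by simp
        show ?thesis using pair[OF x y] xy(3) inj[OF x y] hR x y
            by (metis le_neq_implies_less less_imp_le_nat nat_neq_iff)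
      qed
    qed
  next
    fix x y assume xy: "x \<in> insert t (reps \<alpha> t)" "y \<in> insert t (reps \<alpha> t)" "x \<le> y"
    show "f (seg \<alpha> x y) = f (seg \<beta> (?h x) (?h y))"
    proof (cases "x = t")
      case True
      then have "y = t" using xy reps_less by fastforce
      then show ?thesis using True by simp
    next
      case False
      then have x: "x \<in> reps \<alpha> t" using xy by simp
      show ?thesis using x xy pair[OF x] h[OF x] hR by (cases "y = t") auto
    qed
  qed simp
  then show thesis by (rule that)
qed

context
  fixes \<alpha> \<beta> t t' h
  assumes c: "corr \<alpha> t \<beta> t' h" and a: "\<alpha> t = \<beta> t'"
begin

lemma corr_image: "h ` insert t (reps \<alpha> t) = insert t' (reps \<beta> t')"
  using c by (simp add: corr_def)

lemma corr_reps: "x \<in> reps \<alpha> t \<Longrightarrow> h x \<in> reps \<beta> t'"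
  using c unfolding corr_def by blast

lemma corr_less: "x \<in> insert t (reps \<alpha> t) \<Longrightarrow> y \<in> insert t (reps \<alpha> t) \<Longrightarrow> h x < h y \<longleftrightarrow> x < y"
  using c unfolding corr_def by (metis linorder_neqE_nat order_less_asym strict_mono_onD)

lemma corr_le: "x \<in> insert t (reps \<alpha> t) \<Longrightarrow> y \<in> insert t (reps \<alpha> t) \<Longrightarrow> h x \<le> h y \<longleftrightarrow> x \<le> y"
  using corr_less[of y x] by (simp add: linorder_not_less[symmetric])

lemma corr_f: "x \<in> insert t (reps \<alpha> t) \<Longrightarrow> y \<in> insert t (reps \<alpha> t) \<Longrightarrow> x \<le> y \<Longrightarrow>
    f (seg \<alpha> x y) = f (seg \<beta> (h x) (h y))"
  using c unfolding corr_def by blast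

lemma corr_f_Suc: "x \<in> insert t (reps \<alpha> t) \<Longrightarrow> f (seg \<alpha> x (Suc t)) = f (seg \<beta> (h x) (Suc t'))"
proof (rule f_Suc)
  assume x: "x \<in> insert t (reps \<alpha> t)"
  show "x \<le> t" using x reps_less by fastforce
  have "h x \<in> insert t' (reps \<beta> t')" using corr_image x by blast
  then show "h x \<le> t'" using reps_less by fastforce
  show "f (seg \<alpha> x t) = f (seg \<beta> (h x) t')"
    using corr_f[OF x, of t] \<open>x \<le> t\<close> c by (simp add: corr_def)
qed (rule a)

lemma corr_reps_Suc: "x \<in> insert t (reps \<alpha> t) \<Longrightarrow> h x \<in> reps \<beta> (Suc t') \<longleftrightarrow> x \<in> reps \<alpha> (Suc t)"
  unfolding reps_Suc corr_image[symmetric] by (auto simp: corr_less corr_f_Suc)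

lemma profile_Suc_subset: "profile \<alpha> (Suc t) \<subseteq> profile \<beta> (Suc t')"
proof
  fix d assume "d \<in> profile \<alpha> (Suc t)"
  then obtain x y where xy: "x \<in> reps \<alpha> (Suc t)" "y \<in> reps \<alpha> (Suc t)" "x \<le> y"
    "d = (f (seg \<alpha> x (Suc t)), f (seg \<alpha> y (Suc t)), f (seg \<alpha> x y))" unfolding profile_def by blast
  have x: "x \<in> insert t (reps \<alpha> t)" and y: "y \<in> insert t (reps \<alpha> t)" using xy reps_Suc by blast+
  have "d = (f (seg \<beta> (h x) (Suc t')), f (seg \<beta> (h y) (Suc t')), f (seg \<beta> (h x) (h y)))"
    using xy corr_f_Suc[OF x] corr_f_Suc[OF y] corr_f[OF x y] by simp
  moreover have "h x \<in> reps \<beta> (Suc t')" "h y \<in> reps \<beta> (Suc t')" "h x \<le> h y"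
    using xy corr_reps_Suc[OF x] corr_reps_Suc[OF y] corr_le[OF x y] by auto
  ultimately show "d \<in> profile \<beta> (Suc t')" unfolding profile_def by blast
qed

lemma corr_idx: "y \<in> reps \<alpha> t \<Longrightarrow> idx \<alpha> t y = idx \<beta> t' (h y)"
proof -
  assume y: "y \<in> reps \<alpha> t"
  have "{z \<in> reps \<beta> t'. z < h y} = h ` {z \<in> reps \<alpha> t. z < y}"
  proof (intro equalityI subsetI)
    fix z' assume z': "z' \<in> {z \<in> reps \<beta> t'. z < h y}"
    then obtain z where z: "z \<in> reps \<alpha> t" "z' = h z" using c unfolding corr_def by blast
    then show "z' \<in> h ` {z \<in> reps \<alpha> t. z < y}" using z' y corr_less[of z y] by blast
  next
    fix z' assume "z' \<in> h ` {z \<in> reps \<alpha> t. z < y}"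
    then show "z' \<in> {z \<in> reps \<beta> t'. z < h y}" using y corr_less[of _ y] corr_reps by blast
  qed
  moreover have "inj_on h {z \<in> reps \<alpha> t. z < y}"
    using c unfolding corr_def
        by (metis (no_types, lifting) inj_on_subset mem_Collect_eq strict_mono_on_imp_inj_on
        subset_insertI2 subsetI)
  ultimately show ?thesis unfolding idx_def by (simp add: card_image)
qed

lemma corr_zero: "0 < t \<Longrightarrow> 0 \<in> reps \<alpha> t \<and> h 0 = 0"
proof
  assume "0 < t"
  then show 0: "0 \<in> reps \<alpha> t" by (simp add: reps_def)
  then have "h 0 < t'" using corr_reps reps_less by blast
  then have "0 \<in> reps \<beta> t'" by (simp add: reps_def)
  then obtain z where "z \<in> reps \<alpha> t" "h z = 0" using c unfolding corr_def by (metis imageE)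
  then show "h 0 = 0" using corr_le[of 0 z] 0 by simp
qed

lemma prios_subset: "prios \<alpha> t \<subseteq> prios \<beta> t'"
proof
  fix p assume "p \<in> prios \<alpha> t"
  then consider "p = 2 * K" | y x where "merge \<alpha> t y x"
    "p = 2 * idx \<alpha> t y + of_bool (\<not> good (f (seg \<alpha> 0 x)) (f (seg \<alpha> y x)))"
    unfolding prios_def by blast
  then show "p \<in> prios \<beta> t'"
  proof cases
    case 2
    then have y: "y \<in> reps \<alpha> t" and x: "x \<in> insert t (reps \<alpha> t)" and yx: "y < x"
      and eq: "f (seg \<alpha> y (Suc t)) = f (seg \<alpha> x (Suc t))" by (auto simp: merge_def)
    then have y': "y \<in> insert t (reps \<alpha> t)" by blast
    have z: "0 \<in> reps \<alpha> t" "h 0 = 0" using corr_zero y reps_less by fastforce+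
    have "merge \<beta> t' (h y) (h x)"
      unfolding merge_def
          using corr_reps[OF y] corr_image x corr_less[OF y' x] yx eq corr_f_Suc[OF x]
          corr_f_Suc[OF y'] by auto
    moreover have "p = 2 * idx \<beta> t' (h y) + of_bool (\<not> good (f (seg \<beta> 0 (h x)))
        (f (seg \<beta> (h y) (h x))))"
      using 2(2) corr_idx[OF y] corr_f[OF y' x] yx corr_f[of 0 x] z x by simp
    ultimately show ?thesis unfolding prios_def by blast
  qed (simp add: prios_def)
qed

end

text \<open>The matching given by equal profiles survives a common next letter, because absorption,
  order and inner segments are expressed in data that it preserves. This is determinism of the
  automaton.\<close>

lemma profile_step:
  assumes "profile \<alpha> t = profile \<beta> t'" "\<alpha> t = \<beta> t'"
  shows "profile \<alpha> (Suc t) = profile \<beta> (Suc t')" "prio \<alpha> t = prio \<beta> t'"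
proof -
  obtain h where h: "corr \<alpha> t \<beta> t' h" using profile_corr[OF assms(1)] .
  obtain h' where h': "corr \<beta> t' \<alpha> t h'" using profile_corr[OF assms(1)[symmetric]] .
  show "profile \<alpha> (Suc t) = profile \<beta> (Suc t')" "prio \<alpha> t = prio \<beta> t'"
    using profile_Suc_subset[OF h assms(2)] profile_Suc_subset[OF h' assms(2)[symmetric]]
      subset_antisym[OF prios_subset[OF h assms(2)] prios_subset[OF h' assms(2)[symmetric]]]
    by (simp_all add: prio_def)
qed

lemma idx_less: "y \<in> reps \<alpha> t \<Longrightarrow> idx \<alpha> t y < K"
proof -
  assume y: "y \<in> reps \<alpha> t"
  have "idx \<alpha> t y < card (reps \<alpha> t)" unfolding idx_def
    by (rule psubset_card_mono) (use y in auto)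
  then show ?thesis using card_reps[of \<alpha> t] by simp
qed

lemma finite_prios: "finite (prios \<alpha> t)"
proof (rule finite_subset[of _ "{..2 * K}"])
  show "prios \<alpha> t \<subseteq> {..2 * K}"
  proof
    fix p assume "p \<in> prios \<alpha> t"
    then consider "p = 2 * K" | y x where "merge \<alpha> t y x"
      "p = 2 * idx \<alpha> t y + of_bool (\<not> good (f (seg \<alpha> 0 x)) (f (seg \<alpha> y x)))"
      unfolding prios_def by blast
    then show "p \<in> {..2 * K}"
    proof cases
      case 2
      then have "idx \<alpha> t y < K" using idx_less by (auto simp: merge_def)
      then show ?thesis using 2 by (auto simp: of_bool_def)
    qed simp
  qed
qed simp

lemma prio_le: "prio \<alpha> t \<le> 2 * K"
  unfolding prio_def by (rule Min_le[OF finite_prios]) (simp add: prios_def)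

lemma prio_mem: "prio \<alpha> t \<in> prios \<alpha> t"
  unfolding prio_def by (rule Min_in[OF finite_prios]) (simp add: prios_def)

lemma merge_prio: "merge \<alpha> t y x \<Longrightarrow> prio \<alpha> t \<le> 2 * idx \<alpha> t y + 1"
proof -
  assume "merge \<alpha> t y x"
  then have "2 * idx \<alpha> t y + of_bool (\<not> good (f (seg \<alpha> 0 x)) (f (seg \<alpha> y x))) \<in> prios \<alpha> t" (is "?p \<in> _")
    unfolding prios_def by blast
  then have "prio \<alpha> t \<le> ?p" unfolding prio_def by (intro Min_le finite_prios)
  then show ?thesis by (auto simp: of_bool_def split: if_splits)
qed

lemma no_merge_reps_Suc:
  assumes "\<And>y x. \<not> merge \<alpha> t y x"
  shows "reps \<alpha> (Suc t) = insert t (reps \<alpha> t)"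
proof -
  have "f (seg \<alpha> y (Suc t)) \<noteq> f (seg \<alpha> x (Suc t))" if "x \<in> insert t (reps \<alpha> t)"
      "y \<in> insert t (reps \<alpha> t)" "y < x" for x y
    using assms[of y x] that unfolding merge_def using reps_less by fastforce
  then show ?thesis using reps_Suc by blast
qed

text \<open>Without absorption every step would add a representative, but there are never more than
  \<open>K\<close>.\<close>

lemma infinite_merge: "\<exists>t\<ge>T. \<exists>y x. merge \<alpha> t y x"
proof (rule ccontr)
  assume n: "\<not> ?thesis"
  have "card (reps \<alpha> (T + k)) \<ge> k" for k
  proof (induction k)
    case (Suc k)
    have "reps \<alpha> (Suc (T + k)) = insert (T + k) (reps \<alpha> (T + k))"
      by (rule no_merge_reps_Suc) (use n in auto)
    moreover have "T + k \<notin> reps \<alpha> (T + k)" by (simp add: reps_def)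
    ultimately show ?case using Suc by simp
  qed simp
  from this[of "Suc K"] card_reps[of \<alpha> "T + Suc K"] show False by simp
qed

lemma reps_dead: "x \<notin> reps \<alpha> t \<Longrightarrow> x < t \<Longrightarrow> t \<le> t' \<Longrightarrow> x \<notin> reps \<alpha> t'"
  by (rotate_tac 2, induction t' rule: dec_induct) (auto simp: reps_Suc)

lemma f_extend: "x \<le> z \<Longrightarrow> y \<le> z \<Longrightarrow> z \<le> w \<Longrightarrow> f (seg \<alpha> x z) = f (seg \<alpha> y z) \<Longrightarrow> f (seg \<alpha> x w) = f (seg \<alpha> y w)"
  unfolding seg_append[of x z w] seg_append[of y z w] by (rule congruenceD[OF cong]) simp_all

lemma parity_prio:
  assumes inf: "\<exists>\<^sub>\<infinity>t. prio \<alpha> t = m" and low: "\<forall>\<^sub>\<infinity>t. m \<le> prio \<alpha> t"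
  shows "even m \<longleftrightarrow> \<alpha> \<in> L"
proof -
  from low obtain T where T: "\<And>t. t \<ge> T \<Longrightarrow> m \<le> prio \<alpha> t" unfolding MOST_nat_le by blast
  have m: "m < 2 * K"
  proof -
    obtain t y x where "t \<ge> T" "merge \<alpha> t y x" using infinite_merge by blast
    moreover then have "idx \<alpha> t y < K" using idx_less by (auto simp: merge_def)
    ultimately show ?thesis using T[of t] merge_prio[of \<alpha> t y x] by linarith
  qed
  define i where "i = m div 2"
  have ev: "\<exists>y x. merge \<alpha> t y x \<and> idx \<alpha> t y = i \<and> (good (f (seg \<alpha> 0 x)) (f (seg \<alpha> y x)) \<longleftrightarrow> even m)"
      if "prio \<alpha> t = m" for t
  proof -
    have "m \<in> prios \<alpha> t" using prio_mem[of \<alpha> t] that by simp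
    then obtain y x where *: "merge \<alpha> t y x"
      "m = 2 * idx \<alpha> t y + of_bool (\<not> good (f (seg \<alpha> 0 x)) (f (seg \<alpha> y x)))"
      using m unfolding prios_def by blast
    have "i = idx \<alpha> t y" "good (f (seg \<alpha> 0 x)) (f (seg \<alpha> y x)) \<longleftrightarrow> even m"
      unfolding i_def by (subst *(2), simp add: of_bool_def)+
    then show ?thesis using *(1) by auto
  qed
  \<comment> \<open>A position absorbing \<open>z\<close> would have index at most i - 1 and cause a
    priority of at most 2 * i - 1, which is below \<open>m\<close>.\<close>
  have surv: "z \<in> reps \<alpha> (Suc t)" if zt: "t \<ge> T" "z \<in> reps \<alpha> t" "idx \<alpha> t z \<le> i" for t z
  proof (rule ccontr)
    assume "z \<notin> reps \<alpha> (Suc t)"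
    then obtain y where y: "y \<in> insert t (reps \<alpha> t)" "y < z" "f (seg \<alpha> y (Suc t)) = f (seg \<alpha> z (Suc t))"
      using zt(2) unfolding reps_Suc by auto
    then have yR: "y \<in> reps \<alpha> t" using that(2) reps_less by fastforce
    have "merge \<alpha> t y z" using y yR that by (simp add: merge_def)
    then have "m \<le> 2 * idx \<alpha> t y + 1" using merge_prio T that(1) le_trans by blast
    moreover have "idx \<alpha> t y < idx \<alpha> t z"
      unfolding idx_def by (rule psubset_card_mono) (use y yR in auto)
    ultimately show False using that(3) unfolding i_def by linarith
  qed
  have idx_Suc: "idx \<alpha> (Suc t) z = i" if t: "t \<ge> T" and z: "z \<in> reps \<alpha> t" "idx \<alpha> t z = i" for t z
  proof -
    have "idx \<alpha> t x \<le> idx \<alpha> t z" if "x < z" for x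
      unfolding idx_def by (rule card_mono) (use that in auto)
    then have "{x \<in> reps \<alpha> (Suc t). x < z} = {x \<in> reps \<alpha> t. x < z}"
      using surv[OF t] z reps_Suc reps_less by fastforce
    then show ?thesis using z by (simp add: idx_def)
  qed
  obtain t0 where t0: "t0 \<ge> T" "prio \<alpha> t0 = m" using inf unfolding INFM_nat_le by blast
  obtain y where y: "y \<in> reps \<alpha> t0" "idx \<alpha> t0 y = i" using ev[OF t0(2)] by (auto simp: merge_def)
  have perm: "y \<in> reps \<alpha> t \<and> idx \<alpha> t y = i" if "t0 \<le> t" for t
    using that
  proof (induction t rule: dec_induct)
    case (step t)
    then have "t \<ge> T" "y \<in> reps \<alpha> t" "idx \<alpha> t y = i" using t0 by auto
    then show ?case using surv[of t y] idx_Suc[of t y] by simp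
  qed (use y in simp)
  have uniq: "y' = y" if "t0 \<le> t" "y' \<in> reps \<alpha> t" "idx \<alpha> t y' = i" for t y'
  proof (rule ccontr)
    assume ne: "y' \<noteq> y"
    have lt: "idx \<alpha> t a < idx \<alpha> t b" if "a < b" "a \<in> reps \<alpha> t" for a b
      unfolding idx_def by (rule psubset_card_mono) (use that in auto)
    show False using lt[of y y'] lt[of y' y] ne that perm[OF that(1)]
        by (metis linorder_neqE_nat less_irrefl)
  qed
  define X where "X = {x. \<exists>t\<ge>t0. merge \<alpha> t y x \<and> (good (f (seg \<alpha> 0 x)) (f (seg \<alpha> y x)) \<longleftrightarrow> even m)}"
  have X: "infinite X"
  proof -
    let ?I = "{t. t \<ge> t0 \<and> prio \<alpha> t = m}"
    have "\<exists>x. merge \<alpha> t y x \<and> (good (f (seg \<alpha> 0 x)) (f (seg \<alpha> y x)) \<longleftrightarrow> even m)" if "t \<in> ?I" for t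
    proof -
      from ev[of t] that obtain y' x where *: "merge \<alpha> t y' x" "idx \<alpha> t y' = i"
        "good (f (seg \<alpha> 0 x)) (f (seg \<alpha> y' x)) \<longleftrightarrow> even m" by blast
      moreover have "y' = y" using uniq[of t y'] that * by (simp add: merge_def)
      ultimately show ?thesis by blast
    qed
    then obtain g where g: "\<And>t. t \<in> ?I \<Longrightarrow> merge \<alpha> t y (g t) \<and>
        (good (f (seg \<alpha> 0 (g t))) (f (seg \<alpha> y (g t))) \<longleftrightarrow> even m)"
      by metis
    \<comment> \<open>A position that has been absorbed never is a representative again, so
      different times yield different absorbed positions and \<open>X\<close> is infinite.\<close>
    have ne: "g t \<noteq> g t'" if "t \<in> ?I" "t' \<in> ?I" "t < t'" for t t'
    proof
      assume eq: "g t = g t'"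
      have "g t \<in> insert t (reps \<alpha> t)" "g t \<notin> reps \<alpha> (Suc t)" using g[OF that(1)]
          unfolding merge_def reps_Suc by blast+
      then have "g t \<le> t" using reps_less by fastforce
      then have "g t \<notin> reps \<alpha> t'" "g t \<noteq> t'" using reps_dead[OF \<open>g t \<notin> reps \<alpha> (Suc t)\<close>] that by auto
      then show False using g[OF that(2)] eq by (simp add: merge_def)
    qed
    have "inj_on g ?I"
      by (rule linorder_inj_onI) (use ne in auto)
    moreover have "infinite ?I"
      using inf by (auto simp: infinite_nat_iff_unbounded_le INFM_nat_le) (meson max.bounded_iff)
    ultimately have "infinite (g ` ?I)" using finite_imageD by blast
    moreover have "g ` ?I \<subseteq> X" unfolding X_def using g by auto
    ultimately show ?thesis using finite_subset by blast
  qed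
  have "finite ((\<lambda>x. (f (seg \<alpha> 0 x), f (seg \<alpha> y x))) ` X)"
    by (rule finite_subset[of _ "{..<K} \<times> {..<K}"]) (auto simp: f_less)
  from pigeonhole_infinite[OF X this] obtain z where z: "z \<in> X"
    "infinite {x \<in> X. (f (seg \<alpha> 0 x), f (seg \<alpha> y x)) = (f (seg \<alpha> 0 z), f (seg \<alpha> y z))}" (is
        "infinite ?Y")
    by blast
  define s where "s = f (seg \<alpha> 0 z)"
  define e where "e = f (seg \<alpha> y z)"
  have Y: "f (seg \<alpha> 0 x) = s" "f (seg \<alpha> y x) = e" "y < x" if "x \<in> ?Y" for x
    using that by (auto simp: s_def e_def X_def merge_def)
  \<comment> \<open>After the absorption of \<open>x\<close> by \<open>y\<close>, segments from
    \<open>x\<close> and from \<open>y\<close> to the same end have equal values; for an end x' in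
    \<open>?Y\<close> that value is \<open>e\<close>.\<close>
  have next_Y: "\<exists>x'. x' \<in> ?Y \<and> x < x' \<and> f (seg \<alpha> x x') = e" if x: "x \<in> ?Y" for x
  proof -
    obtain t where t: "merge \<alpha> t y x" using x unfolding X_def by blast
    obtain x' where x': "x' > Suc t" "x' \<in> ?Y" using z(2) unfolding infinite_nat_iff_unbounded by blast
    have "x \<le> Suc t" "y \<le> Suc t" "f (seg \<alpha> y (Suc t)) = f (seg \<alpha> x (Suc t))"
      using t reps_less unfolding merge_def by fastforce+
    then have "f (seg \<alpha> y x') = f (seg \<alpha> x x')" using f_extend[of y "Suc t" x x' \<alpha>] x' by simp
    then show ?thesis using x' Y[OF x'(2)] \<open>x \<le> Suc t\<close> by (intro exI[of _ x']) auto
  qed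
  have "\<exists>c. \<forall>k. c k \<in> ?Y \<and> (c k < c (Suc k) \<and> f (seg \<alpha> (c k) (c (Suc k))) = e)"
    by (rule dependent_nat_choice) (use z(1) next_Y in auto)
  then obtain c where c: "\<And>k. c k \<in> ?Y" "\<And>k. c k < c (Suc k)" "\<And>k. f (seg \<alpha> (c k) (c (Suc k))) = e"
      by blast
  define x where "x k = (case k of 0 \<Rightarrow> 0 | Suc k \<Rightarrow> c k)" for k
  have x: "cuts x"
    unfolding cuts_def strict_mono_Suc_iff using c(2) Y(3)[OF c(1)[of 0]]
        by (auto simp: x_def split: nat.split)
  have xs: "f (seg \<alpha> 0 (x (Suc 0))) = s" "\<And>k. k > 0 \<Longrightarrow> f (seg \<alpha> (x k) (x (Suc k))) = e"
    using Y[OF c(1)] c(3) by (auto simp: x_def split: nat.split)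
  have "good s e \<longleftrightarrow> \<alpha> \<in> L"
  proof
    assume "\<alpha> \<in> L"
    then show "good s e" unfolding good_def using x xs by blast
  next
    assume "good s e"
    then obtain \<beta> w where w: "\<beta> \<in> L" "cuts w" "f (seg \<beta> 0 (w (Suc 0))) = s"
      "\<forall>k>0. f (seg \<beta> (w k) (w (Suc k))) = e" unfolding good_def by blast
    have "f (seg \<beta> (w k) (w (Suc k))) = f (seg \<alpha> (x k) (x (Suc k)))" for k
      using w xs x by (cases k) (auto simp: cuts_def)
    then show "\<alpha> \<in> L" using saturatesD[OF sat w(2) x] w(1) by blast
  qed
  moreover have "good s e \<longleftrightarrow> even m" using z(1) by (auto simp: X_def s_def e_def)
  ultimately show ?thesis by blast
qed

lemma profile_prefix: "(\<And>i. i < t \<Longrightarrow> \<alpha> i = \<beta> i) \<Longrightarrow> profile \<alpha> t = profile \<beta> t"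
proof (induction t)
  case 0
  then show ?case by (simp add: profile_def reps_def)
next
  case (Suc t)
  then show ?case using profile_step(1)[of \<alpha> t \<beta> t] by simp
qed

lemma profile_range: "profile \<alpha> t \<in> Pow ({..<K} \<times> {..<K} \<times> {..<K})"
  unfolding profile_def by (auto simp: f_less)

lemma ex_prio: "\<exists>m. (\<exists>\<^sub>\<infinity>t. prio \<alpha> t = m) \<and> (\<forall>\<^sub>\<infinity>t. m \<le> prio \<alpha> t)"
proof -
  let ?m = "LEAST m. \<exists>\<^sub>\<infinity>t. prio \<alpha> t = m"
  have "finite (range (prio \<alpha>))" by (rule finite_subset[of _ "{..2 * K}"]) (use prio_le in auto)
  from pigeonhole_infinite[OF infinite_UNIV_nat this] obtain t0
      where "infinite {t. prio \<alpha> t = prio \<alpha> t0}" by auto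
  then have "\<exists>\<^sub>\<infinity>t. prio \<alpha> t = prio \<alpha> t0" by (simp add: frequently_cofinite)
  then have 1: "\<exists>\<^sub>\<infinity>t. prio \<alpha> t = ?m" by (rule LeastI)
  have "\<forall>\<^sub>\<infinity>t. prio \<alpha> t \<noteq> j" if "j < ?m" for j
    using not_less_Least[OF that] by (simp add: not_frequently)
  then have "\<forall>\<^sub>\<infinity>t. \<forall>j\<in>{..<?m}. prio \<alpha> t \<noteq> j"
    by (intro eventually_ball_finite) auto
  then have "\<forall>\<^sub>\<infinity>t. ?m \<le> prio \<alpha> t"
    by (rule eventually_mono) (auto simp: not_less[symmetric])
  with 1 show ?thesis by blast
qed

end

text \<open>The automaton is given as a map from prefixes to states, the second property being
  determinism. A state stores the priority of the step just made, so priorities appear one letter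
  late, which does not affect what recurs.\<close>

lemma recog_parity:
  fixes L :: "(nat \<Rightarrow> 'l) set"
  assumes "recog K L"
  obtains s :: "'l list \<Rightarrow> nat" and pri :: "nat \<Rightarrow> nat" where
    "finite (range s)" "\<And>u u' a. s u = s u' \<Longrightarrow> s (u @ [a]) = s (u' @ [a])"
    "\<And>\<alpha>. \<exists>m. (even m \<longleftrightarrow> \<alpha> \<in> L) \<and> (\<exists>\<^sub>\<infinity>t. pri (s (seg \<alpha> 0 t)) = m) \<and> (\<forall>\<^sub>\<infinity>t. m \<le> pri (s (seg \<alpha> 0 t)))"
proof -
  from assms obtain f :: "'l list \<Rightarrow> nat" where "range f \<subseteq> {..<K}" "congruence f" "saturates f L"
    unfolding recog_def by blast
  then interpret dpa f K L by unfold_locales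
  \<comment> \<open>\<open>(!) u\<close> is unspecified beyond the list, but a profile at time t
    reads only the first t letters. A priority at time t reads letter t as well, hence
    \<open>length u - 1\<close>.\<close>
  define s0 where "s0 u = (profile ((!) u) (length u), if u = [] then 2 * K else prio ((!) u)
      (length u - 1))" for u
  have "range s0 \<subseteq> Pow ({..<K} \<times> {..<K} \<times> {..<K}) \<times> {..2 * K}"
    unfolding s0_def using profile_range prio_le by auto
  then have fin: "finite (range s0)" by (rule finite_subset) simp
  obtain h where "bij_betw h (range s0) {0..<card (range s0)}"
    using ex_bij_betw_finite_nat[OF fin] by blast
  then have h: "inj_on h (range s0)" by (rule bij_betw_imp_inj_on)
  have heq: "h (s0 u) = h (s0 v) \<longleftrightarrow> s0 u = s0 v" for u v
    using inj_on_eq_iff[OF h, of "s0 u" "s0 v"] by simp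
  have snoc: "profile ((!) (u @ [a])) (Suc (length u)) = profile ((!) (u' @ [a])) (Suc (length u'))"
    "prio ((!) (u @ [a])) (length u) = prio ((!) (u' @ [a])) (length u')"
    if "profile ((!) u) (length u) = profile ((!) u') (length u')" for u u' a
  proof -
    have *: "profile ((!) (u @ [a])) (length u) = profile ((!) (u' @ [a])) (length u')"
      using profile_prefix[of "length u" "(!) (u @ [a])" "(!) u"] profile_prefix[of "length u'"
          "(!) (u' @ [a])" "(!) u'"] that
      by (simp add: nth_append)
    then show "profile ((!) (u @ [a])) (Suc (length u)) = profile ((!) (u' @ [a])) (Suc (length u'))"
      "prio ((!) (u @ [a])) (length u) = prio ((!) (u' @ [a])) (length u')"
      using profile_step[OF *] by simp_all
  qed
  show thesis
  proof (rule that[of "h \<circ> s0" "snd \<circ> the_inv_into (range s0) h"])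
    show "finite (range (h \<circ> s0))" using fin by (metis finite_imageI image_comp)
    show "(h \<circ> s0) (u @ [a]) = (h \<circ> s0) (u' @ [a])" if "(h \<circ> s0) u = (h \<circ> s0) u'" for u u' a
      using that snoc[of u u' a] unfolding o_apply heq by (simp add: s0_def)
    fix \<alpha>
    obtain m where m: "\<exists>\<^sub>\<infinity>t. prio \<alpha> t = m" "\<forall>\<^sub>\<infinity>t. m \<le> prio \<alpha> t" using ex_prio by blast
    have pr: "(snd \<circ> the_inv_into (range s0) h) ((h \<circ> s0) (seg \<alpha> 0 (Suc t))) = prio \<alpha> t" for t
    proof -
      have "prio ((!) (seg \<alpha> 0 (Suc t))) t = prio \<alpha> t"
        by (rule profile_step(2)) (rule profile_prefix, simp_all)
      moreover have "seg \<alpha> 0 (Suc t) \<noteq> []" by (simp add: seg_def)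
      ultimately have "snd (s0 (seg \<alpha> 0 (Suc t))) = prio \<alpha> t" by (simp add: s0_def)
      then show ?thesis by (simp add: the_inv_into_f_f[OF h])
    qed
    define p where "p t = (snd \<circ> the_inv_into (range s0) h) ((h \<circ> s0) (seg \<alpha> 0 t))" for t
    have "\<exists>\<^sub>\<infinity>t. p (Suc t) = m" "\<forall>\<^sub>\<infinity>t. m \<le> p (Suc t)"
      using m unfolding p_def pr by auto
    then have "\<exists>\<^sub>\<infinity>t. p t = m" "\<forall>\<^sub>\<infinity>t. m \<le> p t"
      using MOST_SucI[of "\<lambda>t. p t \<noteq> m"] MOST_Suc_iff[of "\<lambda>t. m \<le> p t"]
      by (auto simp only: frequently_def)
    then
    show "\<exists>m. (even m \<longleftrightarrow> \<alpha> \<in> L) \<and> (\<exists>\<^sub>\<infinity>t. (snd \<circ> the_inv_into (range s0) h) ((h \<circ> s0) (seg \<alpha> 0 t)) = m)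
       \<and> (\<forall>\<^sub>\<infinity>t. m \<le> (snd \<circ> the_inv_into (range s0) h) ((h \<circ> s0) (seg \<alpha> 0 t)))"
      using parity_prio[OF m] unfolding p_def by blast
  qed
qed

section \<open>Bounded set quantifiers\<close>

definition up_word :: "nat \<Rightarrow> nat \<Rightarrow> (nat \<Rightarrow> 'l) \<Rightarrow> bool" where
  "up_word a p \<alpha> \<longleftrightarrow> (\<forall>n\<ge>a. \<alpha> (n + p) = \<alpha> n)"

lemma upw_mult: "up_word a p \<alpha> \<Longrightarrow> a \<le> n \<Longrightarrow> \<alpha> (n + p * k) = \<alpha> n"
proof (induction k)
  case (Suc k)
  have "\<alpha> (n + p * k + p) = \<alpha> (n + p * k)" using Suc.prems unfolding up_word_def by simp
  then show ?case using Suc by (simp add: algebra_simps)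
qed simp

lemma upw_mono:
  assumes "up_word a p \<alpha>" "a \<le> a'" "p dvd p'"
  shows "up_word a' p' \<alpha>"
  unfolding up_word_def
proof (intro allI impI)
  fix n assume "a' \<le> n"
  obtain k where "p' = p * k" using assms(3) by blast
  then show "\<alpha> (n + p') = \<alpha> n" using upw_mult[OF assms(1), of n k] \<open>a' \<le> n\<close> assms(2) by simp
qed

lemma upd_cong: "\<alpha> n = \<beta> m \<Longrightarrow> (n \<in> A \<longleftrightarrow> m \<in> B) \<Longrightarrow> upd \<alpha> j A n = upd \<beta> j B m"
  by (simp add: upd_def)

text \<open>Among more than \<open>K\<close> prefixes whose lengths are multiples of
  \<open>p\<close>, two have the same class, and the part between them can be cut from
  \<open>B\<close>; the other tracks stay in phase. Counting from 1 keeps the result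
  nonempty.\<close>

lemma shorten:
  fixes f :: "'v set list \<Rightarrow> nat"
  assumes f: "range f \<subseteq> {..<K}" "congruence f" and \<alpha>: "up_word a p \<alpha>"
  shows "1 \<le> n \<Longrightarrow> \<exists>B' n'. 1 \<le> n' \<and> n' \<le> K \<and>
    f (seg (upd \<alpha> j B') a (a + p * n')) = f (seg (upd \<alpha> j B) a (a + p * n))"
proof (induction n arbitrary: B rule: less_induct)
  case (less n)
  show ?case
  proof (cases "n \<le> K")
    case True
    then show ?thesis using less.prems by blast
  next
    case False
    have "\<not> inj_on (\<lambda>i. f (seg (upd \<alpha> j B) a (a + p * i))) {1..n}"
    proof
      assume "inj_on (\<lambda>i. f (seg (upd \<alpha> j B) a (a + p * i))) {1..n}"
      then have "card {1..n} \<le> card {..<K}"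
        by (rule card_inj_on_le) (use f(1) in auto)
      then show False using False by simp
    qed
    then obtain i0 i1 where i01: "i0 \<in> {1..n}" "i1 \<in> {1..n}" "i0 \<noteq> i1"
      "f (seg (upd \<alpha> j B) a (a + p * i0)) = f (seg (upd \<alpha> j B) a (a + p * i1))"
      unfolding inj_on_def by blast
    obtain i i' where i: "i < i'" "i \<ge> 1" "i' \<le> n"
      "f (seg (upd \<alpha> j B) a (a + p * i)) = f (seg (upd \<alpha> j B) a (a + p * i'))"
    proof (cases "i0 < i1")
      case True
      then show thesis using that[of i0 i1] i01 by simp
    next
      case False
      then show thesis using that[of i1 i0] i01 by simp
    qed
    define d where "d = i' - i"
    have d: "i' = i + d" "d > 0" "n = i + d + (n - i')" using i by (simp_all add: d_def)
    define e where "e = n - i'"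
    have n: "n = i + d + e" "n - d = i + e" using d by (simp_all add: e_def)
    \<comment> \<open>\<open>B\<close> with the stretch between the two cuts removed. The shift
      \<open>p * d\<close> is a multiple of the period, so \<open>\<alpha>\<close> looks the same on
      both sides of it.\<close>
    define C where "C = {m. if m < a + p * i then m \<in> B else m + p * d \<in> B}"
    have 1: "seg (upd \<alpha> j C) a (a + p * i) = seg (upd \<alpha> j B) a (a + p * i)"
      by (rule seg_eqI) (auto simp: C_def intro!: upd_cong)
    have 2: "seg (upd \<alpha> j C) (a + p * i) (a + p * (n - d)) = seg (upd \<alpha> j B) (a + p * i') (a + p * n)"
    proof (rule seg_eqI)
      fix m assume "m < a + p * (n - d) - (a + p * i)"
      have "\<alpha> (a + p * i' + m) = \<alpha> (a + p * i + m)"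
        using upw_mult[OF \<alpha>, of "a + p * i + m" d] by (simp add: d(1) algebra_simps)
      then show "upd \<alpha> j C (a + p * i + m) = upd \<alpha> j B (a + p * i' + m)"
        by (intro upd_cong) (simp_all add: C_def d(1) algebra_simps)
    qed (simp add: n d(1) algebra_simps)
    have le: "a + p * i \<le> a + p * (n - d)" "a + p * i' \<le> a + p * n"
      using i by (simp_all add: n d(1))
    have "f (seg (upd \<alpha> j C) a (a + p * (n - d))) = f (seg (upd \<alpha> j B) a (a + p * n))"
      unfolding seg_append[OF le_add1 le(1)] seg_append[OF le_add1 le(2)] 1 2
      by (rule congruenceD[OF f(2) i(4)]) simp
    moreover have "n - d < n" "1 \<le> n - d" using d(2) i n by auto
    ultimately show ?thesis using less.IH[of "n - d" C] by simp
  qed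
qed

lemma seg_mod_periodic:
  assumes "0 < q"
  shows "(b + k * q + i - b) mod q = i mod (q :: nat)"
  by (simp add: algebra_simps)

text \<open>Ramsey's theorem makes the blocks of the witness between suitable multiples of
  \<open>p\<close> equivalent, so it can be replaced by a stem and one loop repeated forever, each
  shortened to at most \<open>K\<close> periods. The loop length depends on the witness;
  \<open>fact K\<close> is divisible by every possible number of periods.\<close>

lemma bounded_quantifier:
  fixes L :: "(nat \<Rightarrow> 'v set) set"
  assumes L: "recog K L" and \<alpha>: "up_word a p \<alpha>" and p: "0 < p" and A: "upd \<alpha> j A \<in> L"
  shows "\<exists>B. up_word (a + p * K) (p * fact K) (\<lambda>n. n \<in> B) \<and> upd \<alpha> j B \<in> L"
proof -
  obtain f :: "'v set list \<Rightarrow> nat" where f: "range f \<subseteq> {..<K}" "congruence f" "saturates f L"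
    using L unfolding recog_def by blast
  define \<beta> where "\<beta> = upd \<alpha> j A"
  define col where "col S = f (seg \<beta> (a + p * Min S) (a + p * Max S))" for S
  have "\<forall>x\<in>UNIV. \<forall>y\<in>UNIV. x \<noteq> y \<longrightarrow> col {x, y} < K"
    using f(1) unfolding col_def by blast
  from Ramsey2[OF infinite_UNIV_nat this] obtain Y e where
    Y: "infinite Y" "\<forall>x\<in>Y. \<forall>y\<in>Y. x \<noteq> y \<longrightarrow> col {x, y} = e" by (elim exE conjE)
  \<comment> \<open>Dropping the first element of \<open>Y\<close> ensures
    \<open>1 \<le> h k\<close>, which \<open>shorten\<close> demands for the stem.\<close>
  define h where "h k = enumerate Y (Suc k)" for k
  have h: "h k < h (Suc k)" "h k \<in> Y" "1 \<le> h k" for k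
  proof -
    show "h k < h (Suc k)" unfolding h_def by (rule enumerate_step[OF Y(1)])
    show "h k \<in> Y" unfolding h_def by (rule enumerate_in_set[OF Y(1)])
    have "enumerate Y k < h k" unfolding h_def by (rule enumerate_step[OF Y(1)])
    then show "1 \<le> h k" by simp
  qed
  have he: "f (seg \<beta> (a + p * h k) (a + p * h (Suc k))) = e" for k
    using Y(2)[THEN bspec[of _ _ "h k"], THEN bspec[of _ _ "h (Suc k)"]] h[of k] h(2)[of "Suc k"]
        by (simp add: col_def)
  obtain B1 n1 where 1: "1 \<le> n1" "n1 \<le> K"
    "f (seg (upd \<alpha> j B1) a (a + p * n1)) = f (seg \<beta> a (a + p * h 0))"
    using shorten[OF f(1,2) \<alpha> h(3)[of 0]] unfolding \<beta>_def by blast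
  define d where "d = h (Suc 0) - h 0"
  have d: "1 \<le> d" "h (Suc 0) = h 0 + d" using h(1)[of 0] by (simp_all add: d_def)
  \<comment> \<open>\<open>shorten\<close> works on segments beginning at \<open>a\<close>;
    periodicity of \<open>\<alpha>\<close> allows the loop block to be moved there.\<close>
  have shift: "seg (upd \<alpha> j {m. m + p * h 0 \<in> A}) a (a + p * d) = seg \<beta> (a + p * h 0) (a + p * h
      (Suc 0))"
    unfolding \<beta>_def
  proof (rule seg_eqI)
    fix m assume "m < a + p * d - a"
    show "upd \<alpha> j {m. m + p * h 0 \<in> A} (a + m) = upd \<alpha> j A (a + p * h 0 + m)"
      using upw_mult[OF \<alpha>, of "a + m" "h 0"] by (intro upd_cong) (simp_all add: algebra_simps)
  qed (simp add: d(2) algebra_simps)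
  obtain B2 n2 where 2: "1 \<le> n2" "n2 \<le> K" "f (seg (upd \<alpha> j B2) a (a + p * n2)) = e"
    using shorten[OF f(1,2) \<alpha> d(1), of j "{m. m + p * h 0 \<in> A}"] shift he[of 0] by metis
  define b where "b = a + p * n1"
  define q where "q = p * n2"
  have q: "0 < q" and b: "a \<le> b" "0 < b" using p 1 2 by (simp_all add: q_def b_def)
  define B where "B = {n. if n < a then n \<in> A else if n < b then n \<in> B1 else a + (n - b) mod q \<in> B2}"
  have "up_word b q (\<lambda>n. n \<in> B)"
    unfolding up_word_def
  proof (intro allI impI)
    fix n assume "b \<le> n"
    then have "(n + q - b) mod q = (n - b) mod q" by (metis Nat.add_diff_assoc2 mod_add_self2)
    then show "(n + q \<in> B) = (n \<in> B)" using \<open>b \<le> n\<close> b by (simp add: B_def)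
  qed
  moreover have "n2 dvd fact K" using 2 by (intro dvd_fact)
  ultimately have up: "up_word (a + p * K) (p * fact K) (\<lambda>n. n \<in> B)"
    by (rule_tac upw_mono) (use 1 in \<open>auto simp: b_def q_def\<close>)
  define x where "x k = (case k of 0 \<Rightarrow> 0 | Suc k \<Rightarrow> a + p * h k)" for k
  define y where "y k = (case k of 0 \<Rightarrow> 0 | Suc k \<Rightarrow> b + k * q)" for k
  have x: "cuts x" unfolding cuts_def strict_mono_Suc_iff
    using h(1) h(3)[of 0] p by (auto simp: x_def split: nat.split)
  have y: "cuts y" unfolding cuts_def strict_mono_Suc_iff
    using b(2) q by (auto simp: y_def split: nat.split)
  have eq: "f (seg \<beta> (x k) (x (Suc k))) = f (seg (upd \<alpha> j B) (y k) (y (Suc k)))" for k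
  proof (cases k)
    case 0
    have s1: "seg (upd \<alpha> j B) 0 a = seg \<beta> 0 a" unfolding \<beta>_def
      by (rule seg_eqI) (auto simp: B_def intro!: upd_cong)
    have s2: "seg (upd \<alpha> j B) a b = seg (upd \<alpha> j B1) a b"
      by (rule seg_eqI) (auto simp: B_def intro!: upd_cong)
    have "f (seg \<beta> 0 a @ seg \<beta> a (a + p * h 0)) = f (seg \<beta> 0 a @ seg (upd \<alpha> j B1) a (a + p * n1))"
      using congruenceD[OF f(2) refl 1(3)[symmetric]] .
    then show ?thesis
      using 0 s1 s2 b
          by (simp add: x_def y_def b_def seg_append[of 0 a "a + p * h 0"] seg_append[of 0 a
          "a + p * n1"])
  next
    case (Suc k)
    have "seg (upd \<alpha> j B) (b + k * q) (b + Suc k * q) = seg (upd \<alpha> j B2) a (a + p * n2)"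
    proof (rule seg_eqI)
      fix i assume "i < b + Suc k * q - (b + k * q)"
      then have i: "i < q" by simp
      have "b + k * q + i = a + i + p * (n1 + k * n2)" by (simp add: b_def q_def algebra_simps)
      then have "\<alpha> (b + k * q + i) = \<alpha> (a + i)" by (simp only: upw_mult[OF \<alpha> le_add1])
      moreover have "(b + k * q + i - b) mod q = i" using i by (simp add: seg_mod_periodic[OF q])
      ultimately show "upd \<alpha> j B (b + k * q + i) = upd \<alpha> j B2 (a + i)"
        by (intro upd_cong) (use b in \<open>simp_all add: B_def\<close>)
    qed (simp add: q_def)
    then show ?thesis using Suc he 2(3) by (simp add: x_def y_def)
  qed
  have "upd \<alpha> j B \<in> L"
    using saturatesD[OF f(3) x y eq] A by (simp add: \<beta>_def)
  with up show ?thesis by blast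
qed

section \<open>Monadic second-order formulas\<close>

datatype var = FO nat | SO nat | PR

definition enc :: "nat set \<Rightarrow> (nat \<Rightarrow> nat) \<Rightarrow> (nat \<Rightarrow> nat set) \<Rightarrow> nat \<Rightarrow> var set" where
  "enc P v V n = {x. case x of FO i \<Rightarrow> v i = n | SO j \<Rightarrow> n \<in> V j | PR \<Rightarrow> n \<in> P}"

lemma enc_simps [simp]:
  "FO i \<in> enc P v V n \<longleftrightarrow> v i = n" "SO j \<in> enc P v V n \<longleftrightarrow> n \<in> V j" "PR \<in> enc P v V n \<longleftrightarrow> n \<in> P"
  by (simp_all add: enc_def)

lemma upd_enc_FO: "upd (enc P v V) (FO i) {n} = enc P (v(i := n)) V"
  by (rule ext) (auto simp: upd_def enc_def split: var.splits)

lemma upd_enc_SO: "upd (enc P v V) (SO j) A = enc P v (V(j := A))"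
  by (rule ext) (auto simp: upd_def enc_def split: var.splits)

text \<open>Element quantifiers are set quantifiers restricted to one-element tracks, in the form
  required by \<open>recog_proj\<close>. Complements range over all words, including those that
  encode no valuation; \<open>sat_lang\<close> evaluates the sets on encodings only.\<close>

fun lang :: "mlo \<Rightarrow> (nat \<Rightarrow> var set) set" where
  "lang (Less i j) = {\<alpha>. \<exists>m n. m < n \<and> FO i \<in> \<alpha> m \<and> FO j \<in> \<alpha> n}"
| "lang (Equal i j) = {\<alpha>. \<exists>n. FO i \<in> \<alpha> n \<and> FO j \<in> \<alpha> n}"
| "lang (InVar i j) = {\<alpha>. \<exists>n. FO i \<in> \<alpha> n \<and> SO j \<in> \<alpha> n}"
| "lang (InP i) = {\<alpha>. \<exists>n. FO i \<in> \<alpha> n \<and> PR \<in> \<alpha> n}"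
| "lang (Neg \<phi>) = - lang \<phi>"
| "lang (Conj \<phi> \<psi>) = lang \<phi> \<inter> lang \<psi>"
| "lang (ExElem i \<phi>) = {\<alpha>. \<exists>A. upd \<alpha> (FO i) A \<in> {\<alpha>. (\<exists>n. {n. FO i \<in> \<alpha> n} = {n}) \<and> \<alpha> \<in> lang \<phi>}}"
| "lang (ExSet j \<phi>) = {\<alpha>. \<exists>A. upd \<alpha> (SO j) A \<in> lang \<phi>}"

fun lang_index :: "mlo \<Rightarrow> nat" where
  "lang_index (Less i j) = 16"
| "lang_index (Equal i j) = 2"
| "lang_index (InVar i j) = 2"
| "lang_index (InP i) = 2"
| "lang_index (Neg \<phi>) = lang_index \<phi>"
| "lang_index (Conj \<phi> \<psi>) = lang_index \<phi> * lang_index \<psi>"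
| "lang_index (ExElem i \<phi>) = 2 ^ (32 * lang_index \<phi>)"
| "lang_index (ExSet j \<phi>) = 2 ^ lang_index \<phi>"

lemma recog_lang: "recog (lang_index \<phi>) (lang \<phi>)"
proof (induction \<phi>)
  case (Less i j) show ?case using recog_ex_less[of "\<lambda>a. FO i \<in> a" "\<lambda>a. FO j \<in> a"] by simp
next
  case (Equal i j) show ?case using recog_ex[of "\<lambda>a. FO i \<in> a \<and> FO j \<in> a"] by simp
next
  case (InVar i j) show ?case using recog_ex[of "\<lambda>a. FO i \<in> a \<and> SO j \<in> a"] by simp
next
  case (InP i) show ?case using recog_ex[of "\<lambda>a. FO i \<in> a \<and> PR \<in> a"] by simp
next
  case (Neg \<phi>) then show ?case by (simp add: recog_compl)
next
  case (Conj \<phi> \<psi>) then show ?case by (simp add: recog_inter)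
next
  case (ExElem i \<phi>) then show ?case
      by (simp only: lang.simps lang_index.simps recog_proj recog_proj_singleton)
next
  case (ExSet j \<phi>) then show ?case by (simp add: recog_proj)
qed

lemma singleton_track_upd: "{n. j \<in> upd \<alpha> j A n} = A"
  by (auto simp: upd_def)

lemma sat_lang: "sat P v V \<phi> \<longleftrightarrow> enc P v V \<in> lang \<phi>"
proof (induction \<phi> arbitrary: v V)
  case (ExElem i \<phi>)
  have "enc P v V \<in> lang (ExElem i \<phi>) \<longleftrightarrow> (\<exists>A. (\<exists>n. A = {n}) \<and> upd (enc P v V) (FO i) A \<in> lang \<phi>)"
    by (simp add: singleton_track_upd)
  also have "\<dots> \<longleftrightarrow> (\<exists>n. upd (enc P v V) (FO i) {n} \<in> lang \<phi>)" by blast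
  finally show ?case by (simp only: sat.simps ExElem.IH upd_enc_FO)
qed (auto simp: upd_enc_SO)

text \<open>The offset also exceeds the values of all element variables, so that their tracks are
  blank throughout the periodic part.\<close>

definition up_env :: "nat \<Rightarrow> nat \<Rightarrow> nat set \<Rightarrow> (nat \<Rightarrow> nat) \<Rightarrow> (nat \<Rightarrow> nat set) \<Rightarrow> bool" where
  "up_env a p P v V \<longleftrightarrow> 0 < p \<and> (\<forall>i. v i < a) \<and> up_word a p (\<lambda>n. n \<in> P) \<and> (\<forall>j. up_word a p (\<lambda>n. n \<in> V j))"

lemma upw_enc: "up_env a p P v V \<Longrightarrow> up_word a p (enc P v V)"
  unfolding up_word_def
proof (intro allI impI)
  fix n assume env: "up_env a p P v V" and n: "a \<le> n"
  have "v i < a" for i using env by (simp add: up_env_def)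
  then have "v i \<noteq> n" "v i \<noteq> n + p" for i using n by (metis not_le, metis not_le trans_le_add1)
  moreover have "n + p \<in> V j \<longleftrightarrow> n \<in> V j" "n + p \<in> P \<longleftrightarrow> n \<in> P" for j
    using env n by (simp_all add: up_env_def up_word_def)
  ultimately show "enc P v V (n + p) = enc P v V n"
    unfolding enc_def by (intro Collect_cong) (simp split: var.split)
qed

lemma upenv_FO:
  assumes "up_env a p P v V" "n < a + p * K"
  shows "up_env (a + p * K) (p * fact K) P (v(i := n)) V"
  using assms unfolding up_env_def by (auto intro: upw_mono less_le_trans)

lemma upenv_SO:
  assumes "up_env a p P v V" "up_word (a + p * K) (p * fact K) (\<lambda>n. n \<in> A)"
  shows "up_env (a + p * K) (p * fact K) P v (V(j := A))"
  using assms unfolding up_env_def by (auto intro: upw_mono less_le_trans)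

lemma sat_ExSet_bounded:
  assumes env: "up_env a p P v V" and K: "lang_index \<phi> \<le> K"
  shows "sat P v V (ExSet j \<phi>) \<longleftrightarrow>
    (\<exists>A. up_word (a + p * K) (p * fact K) (\<lambda>n. n \<in> A) \<and> sat P v (V(j := A)) \<phi>)"
proof
  assume "sat P v V (ExSet j \<phi>)"
  then obtain A where "upd (enc P v V) (SO j) A \<in> lang \<phi>" by (auto simp: sat_lang upd_enc_SO)
  from bounded_quantifier[OF recog_mono[OF recog_lang K] upw_enc[OF env] _ this] env
  show "\<exists>A. up_word (a + p * K) (p * fact K) (\<lambda>n. n \<in> A) \<and> sat P v (V(j := A)) \<phi>"
    by (auto simp: up_env_def sat_lang upd_enc_SO)
qed auto

text \<open>A singleton that is periodic from some offset has its element below that offset, so the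
  bound for sets turns into one for elements. The factor 32 pays for the singleton
  condition.\<close>

lemma sat_ExElem_bounded:
  assumes env: "up_env a p P v V" and K: "32 * lang_index \<phi> \<le> K"
  shows "sat P v V (ExElem i \<phi>) \<longleftrightarrow> (\<exists>n < a + p * K. sat P (v(i := n)) V \<phi>)"
proof
  assume "sat P v V (ExElem i \<phi>)"
  then obtain A where A: "upd (enc P v V) (FO i) A \<in> {\<alpha>. (\<exists>n. {n. FO i \<in> \<alpha> n} = {n}) \<and> \<alpha> \<in> lang \<phi>}"
    unfolding sat_lang by auto
  have p: "0 < p" using env by (simp add: up_env_def)
  from bounded_quantifier[OF recog_mono[OF recog_proj_singleton[OF recog_lang] K] upw_enc[OF env] p A]
  obtain B n where B: "up_word (a + p * K) (p * fact K) (\<lambda>n. n \<in> B)" "B = {n}"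
      "upd (enc P v V) (FO i) B \<in> lang \<phi>"
    by (auto simp: singleton_track_upd)
  have "n < a + p * K"
  proof (rule ccontr)
    assume "\<not> n < a + p * K"
    then have "n + p * fact K \<in> B" using B(1)[unfolded up_word_def, rule_format, of n] B(2) by simp
    then show False using B(2) p by simp
  qed
  then show "\<exists>n < a + p * K. sat P (v(i := n)) V \<phi>"
    using B(2,3) by (auto simp: sat_lang upd_enc_FO)
qed auto

section \<open>Transducers\<close>

lemma run_0 [simp]: "run \<delta> q X 0 = q"
  by (simp add: run_def)

lemma run_Suc [simp]: "run \<delta> q X (Suc n) = \<delta> (run \<delta> q X n) (X n)"
  by (simp add: run_def)

lemma run_cong: "(\<And>i. i < n \<Longrightarrow> X i = X' i) \<Longrightarrow> run \<delta> q X n = run \<delta> q X' n"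
  by (induction n) auto

lemma run_in: "transition_system Q q \<delta> \<Longrightarrow> run \<delta> q X n \<in> Q"
  by (induction n) (auto simp: transition_system_def)

lemma computed_by_C_causal: "computed_by_C Q q \<delta> out F \<Longrightarrow> causal F"
  unfolding computed_by_C_def causal_def
proof (elim conjE, intro allI impI)
  fix X X' :: omega_string and t i
  assume F: "\<forall>X i. F X i = out (run \<delta> q X i) (X i)" and "\<forall>i\<le>t. X i = X' i" "i \<le> t"
  then have "run \<delta> q X i = run \<delta> q X' i" "X i = X' i" by (auto intro: run_cong)
  then show "F X i = F X' i" using F by simp
qed

lemma computed_by_SC_strongly_causal: "computed_by_SC Q q \<delta> out F \<Longrightarrow> strongly_causal F"
  unfolding computed_by_SC_def strongly_causal_def
proof (elim conjE, intro allI impI)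
  fix X X' :: omega_string and t i
  assume F: "\<forall>X i. F X i = out (run \<delta> q X i)" and "\<forall>i<t. X i = X' i" "i \<le> t"
  then have "run \<delta> q X i = run \<delta> q X' i" by (auto intro: run_cong)
  then show "F X i = F X' i" using F by simp
qed

lemma C_table_finite_state: "C_table_computes T F \<Longrightarrow> finite_state_C F"
  unfolding C_table_computes_def finite_state_C_def by (cases T) (auto dest: computed_by_C_causal)

lemma SC_table_finite_state: "SC_table_computes T F \<Longrightarrow> finite_state_SC F"
  unfolding SC_table_computes_def finite_state_SC_def
      by (cases T) (auto dest: computed_by_SC_strongly_causal)

text \<open>Renames the states of any finite type to row numbers. Agreement of \<open>d\<close> is
  asked for only below \<open>card Q\<close>, because lookups beyond the rows of a table are
  unspecified.\<close>

lemma enumerate_states: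
  fixes \<delta> :: "'q \<Rightarrow> bool \<Rightarrow> 'q"
  assumes fin: "finite Q" and q: "q \<in> Q" and cl: "\<And>s a. s \<in> Q \<Longrightarrow> \<delta> s a \<in> Q"
  obtains h g where "h q < card Q" "\<And>s a. s < card Q \<Longrightarrow> h (\<delta> (g s) a) < card Q"
    "\<And>d X i. (\<And>s a. s < card Q \<Longrightarrow> d s a = h (\<delta> (g s) a)) \<Longrightarrow>
      run d (h q) X i < card Q \<and> g (run d (h q) X i) = foldl \<delta> q (map X [0..<i])"
proof -
  obtain h where h: "bij_betw h Q {0..<card Q}" using ex_bij_betw_finite_nat[OF fin] by blast
  define g where "g = the_inv_into Q h"
  have hQ: "h s < card Q" if "s \<in> Q" for s using bij_betw_apply[OF h that] by simp
  have gh: "g (h s) = s" if "s \<in> Q" for s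
    unfolding g_def using the_inv_into_f_f[OF bij_betw_imp_inj_on[OF h] that] .
  have gQ: "g s \<in> Q" if "s < card Q" for s
  proof -
    have "s \<in> h ` Q" using bij_betw_imp_surj_on[OF h] that by simp
    then show ?thesis using gh by auto
  qed
  have inQ: "foldl \<delta> q (map X [0..<i]) \<in> Q" for X i by (induction i) (use q cl in auto)
  show thesis
  proof (rule that[of h g])
    fix d and X :: omega_string and i
    assume d: "\<And>s a. s < card Q \<Longrightarrow> d s a = h (\<delta> (g s) a)"
    have "run d (h q) X i = h (foldl \<delta> q (map X [0..<i]))"
    proof (induction i)
      case (Suc i)
      then show ?case using d hQ[OF inQ] gh[OF inQ] by simp
    qed simp
    then show "run d (h q) X i < card Q \<and> g (run d (h q) X i) = foldl \<delta> q (map X [0..<i])"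
      using hQ[OF inQ] gh[OF inQ] by simp
  qed (use hQ q cl gQ in auto)
qed

lemma C_table_exists:
  fixes \<delta> :: "'q \<Rightarrow> bool \<Rightarrow> 'q"
  assumes "finite Q" "q \<in> Q" "\<And>s a. s \<in> Q \<Longrightarrow> \<delta> s a \<in> Q"
    and F: "\<And>X i. F X i = out (foldl \<delta> q (map X [0..<i])) (X i)"
  shows "\<exists>T. C_table_computes T F"
proof -
  obtain h g where hg: "h q < card Q" "\<And>s a. s < card Q \<Longrightarrow> h (\<delta> (g s) a) < card Q"
    "\<And>d X i. (\<And>s a. s < card Q \<Longrightarrow> d s a = h (\<delta> (g s) a)) \<Longrightarrow>
      run d (h q) X i < card Q \<and> g (run d (h q) X i) = foldl \<delta> q (map X [0..<i])"
    using enumerate_states[where \<delta> = \<delta>, OF assms(1-3)] by blast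
  define rows where "rows = map (\<lambda>s. (h (\<delta> (g s) False), h (\<delta> (g s) True), out (g s) False,
      out (g s) True)) [0..<card Q]"
  have "C_table_computes (h q, rows) F"
    unfolding C_table_computes_def computed_by_C_def transition_system_def prod.case
  proof (intro conjI allI ballI)
    let ?d = "\<lambda>s a. case rows ! s of (d0, d1, o0, o1) \<Rightarrow> if a then d1 else d0"
    fix X i
    have "run ?d (h q) X i < card Q \<and> g (run ?d (h q) X i) = foldl \<delta> q (map X [0..<i])"
      by (rule hg(3)) (simp add: rows_def)
    then show "F X i = (case rows ! run ?d (h q) X i of (d0, d1, o0, o1) \<Rightarrow> if X i then o1 else o0)"
      unfolding F by (simp add: rows_def)
  qed (use hg(1,2) in \<open>auto simp: rows_def\<close>)
  then show ?thesis ..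
qed

lemma SC_table_exists:
  fixes \<delta> :: "'q \<Rightarrow> bool \<Rightarrow> 'q"
  assumes "finite Q" "q \<in> Q" "\<And>s a. s \<in> Q \<Longrightarrow> \<delta> s a \<in> Q"
    and F: "\<And>X i. F X i = out (foldl \<delta> q (map X [0..<i]))"
  shows "\<exists>T. SC_table_computes T F"
proof -
  obtain h g where hg: "h q < card Q" "\<And>s a. s < card Q \<Longrightarrow> h (\<delta> (g s) a) < card Q"
    "\<And>d X i. (\<And>s a. s < card Q \<Longrightarrow> d s a = h (\<delta> (g s) a)) \<Longrightarrow>
      run d (h q) X i < card Q \<and> g (run d (h q) X i) = foldl \<delta> q (map X [0..<i])"
    using enumerate_states[where \<delta> = \<delta>, OF assms(1-3)] by blast
  define rows where "rows = map (\<lambda>s. (h (\<delta> (g s) False), h (\<delta> (g s) True), out (g s))) [0..<card Q]"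
  have "SC_table_computes (h q, rows) F"
    unfolding SC_table_computes_def computed_by_SC_def transition_system_def prod.case
  proof (intro conjI allI ballI)
    let ?d = "\<lambda>s a. case rows ! s of (d0, d1, b) \<Rightarrow> if a then d1 else d0"
    fix X i
    have "run ?d (h q) X i < card Q \<and> g (run ?d (h q) X i) = foldl \<delta> q (map X [0..<i])"
      by (rule hg(3)) (simp add: rows_def)
    then show "F X i = (case rows ! run ?d (h q) X i of (d0, d1, b) \<Rightarrow> b)"
      unfolding F by (simp add: rows_def)
  qed (use hg(1,2) in \<open>auto simp: rows_def\<close>)
  then show ?thesis ..
qed

lemma C_solution_table:
  assumes "C_solution P \<psi> F"
  shows "\<exists>T. C_table_computes T F"
proof -
  from assms obtain Q q \<delta> out where "computed_by_C Q q \<delta> out F"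
    unfolding C_solution_def finite_state_C_def by blast
  then show ?thesis unfolding computed_by_C_def transition_system_def run_def
    by (intro C_table_exists[of Q q \<delta> F out]) auto
qed

lemma SC_counter_table:
  assumes "SC_counter P \<psi> F"
  shows "\<exists>T. SC_table_computes T F"
proof -
  from assms obtain Q q \<delta> out where "computed_by_SC Q q \<delta> out F"
    unfolding SC_counter_def finite_state_SC_def by blast
  then show ?thesis unfolding computed_by_SC_def transition_system_def run_def
    by (intro SC_table_exists[of Q q \<delta> F out]) auto
qed

text \<open>That one track is the output on another is a safety condition along the run; this brings
  operators within the scope of the bounded quantifiers.\<close>

lemma recog_run:
  assumes ts: "transition_system {..<N} q \<delta>"
  shows "recog ((2 * N) ^ N) {\<alpha>. \<forall>n. y \<in> \<alpha> n \<longleftrightarrow> out (run \<delta> q (\<lambda>m. x \<in> \<alpha> m) n) (x \<in> \<alpha> n)}"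
proof -
  have "run \<delta> q (\<lambda>m. x \<in> \<alpha> m) n = foldl (\<lambda>s l. \<delta> s (x \<in> l)) q (seg \<alpha> 0 n)" for \<alpha> n
    by (induction n) (simp_all add: seg_Suc)
  then show ?thesis
    using recog_safety[of q N "\<lambda>s l. \<delta> s (x \<in> l)" "\<lambda>s l. y \<in> l \<longleftrightarrow> out s (x \<in> l)"] ts
    by (simp add: transition_system_def)
qed

section \<open>Determinacy\<close>

lemma upw_ultimately_periodic:
  "ultimately_periodic P \<Longrightarrow> \<exists>a p. 0 < a \<and> 0 < p \<and> up_word a p (\<lambda>n. n \<in> P)"
  unfolding ultimately_periodic_def up_word_def by (metis Suc_le_eq zero_less_Suc)

text \<open>A state of the game pairs the automaton state with a counter moving along the lasso of
  \<open>P\<close>. The players supply only X and Y; the letters of the remaining tracks are read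
  off from the counter.\<close>

lemma determined:
  assumes "ultimately_periodic P"
  shows "(\<exists>F. C_solution P \<psi> F) \<or> (\<exists>G. SC_counter P \<psi> G)"
proof -
  obtain a p where ap: "0 < a" "0 < p" "up_word a p (\<lambda>n. n \<in> P)"
    using upw_ultimately_periodic[OF assms] by blast
  define nx where "nx c = (if Suc c = a + p then a else Suc c)" for c
  define cnt where "cnt n = (nx ^^ n) 0" for n
  have cnt0: "cnt 0 = 0" and cntS: "cnt (Suc n) = nx (cnt n)" for n by (simp_all add: cnt_def)
  have cnt: "cnt n < a + p \<and> (cnt n = n \<or> (a \<le> cnt n \<and> (\<exists>k. n = cnt n + p * k)))" for n
  proof (induction n)
    case (Suc n)
    show ?case
    proof (cases "Suc (cnt n) = a + p")
      case True
      then have "a \<le> cnt n" using ap by simp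
      then obtain k where "n = cnt n + p * k" using Suc by (metis add.right_neutral mult_0_right)
      then have "Suc n = cnt (Suc n) + p * Suc k" using True by (simp add: cntS nx_def)
      moreover have "cnt (Suc n) = a" using True by (simp add: cntS nx_def)
      ultimately show ?thesis using ap(2) by (metis less_add_same_cancel1 order_refl)
    next
      case False
      then show ?thesis using Suc by (auto simp: cntS nx_def)
    qed
  qed (use ap cnt0 in auto)
  \<comment> \<open>All element variables have value 0 in \<open>holds\<close>, so the counter must
    tell position 0 from the others; this is where \<open>0 < a\<close> enters.\<close>
  have cnt_zero: "cnt n = 0 \<longleftrightarrow> n = 0" for n
  proof
    assume "cnt n = 0"
    with cnt[of n] ap(1) show "n = 0" by linarith
  qed (simp add: cnt0)
  have cnt_P: "cnt n \<in> P \<longleftrightarrow> n \<in> P" for n 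
  proof (cases "cnt n = n")
    case False
    then obtain k where "a \<le> cnt n" "n = cnt n + p * k" using cnt[of n] by blast
    then show ?thesis using upw_mult[OF ap(3), of "cnt n" k] by simp
  qed simp
  obtain s :: "var set list \<Rightarrow> nat" and pri :: "nat \<Rightarrow> nat" where s: "finite (range s)"
    "\<And>u u' a. s u = s u' \<Longrightarrow> s (u @ [a]) = s (u' @ [a])"
    "\<And>\<alpha>. \<exists>m. (even m \<longleftrightarrow> \<alpha> \<in> lang \<psi>) \<and> (\<exists>\<^sub>\<infinity>t. pri (s (seg \<alpha> 0 t)) = m) \<and> (\<forall>\<^sub>\<infinity>t. m \<le> pri (s (seg \<alpha> 0 t)))"
    by (rule recog_parity[OF recog_lang[of \<psi>]]) (rule that)
  \<comment> \<open>Any prefix leading to \<open>r\<close> may be chosen, by determinism of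
    \<open>s\<close>.\<close>
  define step where "step r l = s ((SOME u. s u = r) @ [l])" for r l
  have step: "step (s u) l = s (u @ [l])" for u l
    unfolding step_def by (rule s(2)) (rule someI[of _ u], simp)
  define letter where "letter c b1 b2 = {x. case x of FO i \<Rightarrow> c = 0 | SO j \<Rightarrow> (j = 0 \<and> b1) \<or> (j = 1 \<and>
      b2) | PR \<Rightarrow> c \<in> P}" for c b1 b2
  define word where "word X Y = enc P (\<lambda>_. 0) ((\<lambda>_. {})(0 := {n. X n}, 1 := {n. Y n}))"
      for X Y :: omega_string
  have holds: "holds P \<psi> X Y \<longleftrightarrow> word X Y \<in> lang \<psi>" for X Y
    unfolding holds_def word_def sat_lang ..
  have letter: "letter (cnt n) (X n) (Y n) = word X Y n" for X Y n
    unfolding letter_def word_def enc_def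
    by (rule Collect_cong) (auto split: var.splits simp: cnt_zero cnt_P)
  define \<delta> where "\<delta> = (\<lambda>(c, r) b1 b2. (nx c, step r (letter c b1 b2)))"
  define Q where "Q = {..<a + p} \<times> range s"
  have Q: "finite Q" "(0, s []) \<in> Q" using s(1) ap by (auto simp: Q_def)
  have cl: "\<delta> q b1 b2 \<in> Q" if "q \<in> Q" for q b1 b2
    using that ap by (auto simp: Q_def \<delta>_def nx_def step)
  have play: "st t = (cnt t, s (seg (word X Y) 0 t))"
    if "st 0 = (0, s [])" "\<And>t. st (Suc t) = \<delta> (st t) (X t) (Y t)" for st t X Y
    by (induction t) (use that in \<open>auto simp: cnt0 cntS \<delta>_def letter step seg_Suc\<close>)
  show ?thesis
  proof (rule parity_game[where pri = "pri \<circ> snd", OF Q(1) cl Q(2)])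
    fix \<tau> assume \<tau>: "\<And>st x m. st 0 = (0, s []) \<Longrightarrow> (\<And>t. st (Suc t) = \<delta> (st t) (x t) (\<tau> (st t) (x t))) \<Longrightarrow>
      \<exists>\<^sub>\<infinity>t. (pri \<circ> snd) (st t) = m \<Longrightarrow> \<forall>\<^sub>\<infinity>t. m \<le> (pri \<circ> snd) (st t) \<Longrightarrow> even m"
    define d where "d q b = \<delta> q b (\<tau> q b)" for q b
    define st where "st X i = foldl d (0, s []) (map X [0..<i])" for X i
    define F where "F X i = \<tau> (st X i) (X i)" for X i
    have "\<exists>T. C_table_computes T F"
      by (rule C_table_exists[of Q "(0, s [])" d F \<tau>]) (use Q cl in \<open>auto simp: d_def F_def st_def\<close>)
    moreover have "holds P \<psi> X (F X)" for X
    proof -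
      have st: "st X 0 = (0, s [])" "st X (Suc t) = \<delta> (st X t) (X t) (\<tau> (st X t) (X t))" for t
        by (simp_all add: st_def d_def)
      have eq: "st X t = (cnt t, s (seg (word X (F X)) 0 t))" for t
        by (rule play) (use st in \<open>simp_all add: F_def\<close>)
      obtain m where m: "even m \<longleftrightarrow> word X (F X) \<in> lang \<psi>"
        "\<exists>\<^sub>\<infinity>t. (pri \<circ> snd) (st X t) = m" "\<forall>\<^sub>\<infinity>t. m \<le> (pri \<circ> snd) (st X t)"
        using s(3)[of "word X (F X)"] unfolding eq o_apply snd_conv by blast
      have "even m" by (rule \<tau>[OF st m(2,3)])
      then show ?thesis using m(1) holds by simp
    qed
    ultimately have "C_solution P \<psi> F" unfolding C_solution_def using C_table_finite_state by blast
    then show ?thesis by blast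
  next
    fix \<sigma> assume \<sigma>: "\<And>st y m. st 0 = (0, s []) \<Longrightarrow> (\<And>t. st (Suc t) = \<delta> (st t) (\<sigma> (st t)) (y t)) \<Longrightarrow>
      \<exists>\<^sub>\<infinity>t. (pri \<circ> snd) (st t) = m \<Longrightarrow> \<forall>\<^sub>\<infinity>t. m \<le> (pri \<circ> snd) (st t) \<Longrightarrow> odd m"
    define d where "d q b = \<delta> q (\<sigma> q) b" for q b
    define st where "st X i = foldl d (0, s []) (map X [0..<i])" for X i
    define F where "F X i = \<sigma> (st X i)" for X i
    have "\<exists>T. SC_table_computes T F"
      by (rule SC_table_exists[of Q "(0, s [])" d F \<sigma>]) (use Q cl in \<open>auto simp: d_def F_def st_def\<close>)
    moreover have "\<not> holds P \<psi> (F Y) Y" for Y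
    proof -
      have st: "st Y 0 = (0, s [])" "st Y (Suc t) = \<delta> (st Y t) (\<sigma> (st Y t)) (Y t)" for t
        by (simp_all add: st_def d_def)
      have eq: "st Y t = (cnt t, s (seg (word (F Y) Y) 0 t))" for t
        by (rule play) (use st in \<open>simp_all add: F_def\<close>)
      obtain m where m: "even m \<longleftrightarrow> word (F Y) Y \<in> lang \<psi>"
        "\<exists>\<^sub>\<infinity>t. (pri \<circ> snd) (st Y t) = m" "\<forall>\<^sub>\<infinity>t. m \<le> (pri \<circ> snd) (st Y t)"
        using s(3)[of "word (F Y) Y"] unfolding eq o_apply snd_conv by blast
      have "odd m" by (rule \<sigma>[OF st m(2,3)])
      then show ?thesis using m(1) holds by simp
    qed
    ultimately have "SC_counter P \<psi> F" unfolding SC_counter_def using SC_table_finite_state by blast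
    then show ?thesis by blast
  qed
qed

lemma not_both:
  assumes F: "C_solution P \<psi> F" and G: "SC_counter P \<psi> G"
  shows False
proof -
  have cF: "causal F" and cG: "strongly_causal G"
    using F G by (simp_all add: C_solution_def SC_counter_def finite_state_C_def finite_state_SC_def)
  \<comment> \<open>Approximations to a fixed point of G after F: letter n of the composition
    depends only on the letters before n, which \<open>pre n\<close> has already fixed.\<close>
  define pre where "pre = rec_nat (\<lambda>_. False) (\<lambda>n x. x(n := G (F x) n))"
  have pre: "pre (Suc n) = (pre n)(n := G (F (pre n)) n)" for n by (simp add: pre_def)
  define X where "X n = pre (Suc n) n" for n
  have stable: "pre m n = X n" if "n < m" for m n
    using that by (induction m) (auto simp: pre X_def less_Suc_eq)
  have "G (F X) n = X n" for n
  proof -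
    have "F (pre n) i = F X i" if "i < n" for i
    proof -
      have "\<forall>j\<le>i. pre n j = X j" using stable that by simp
      then have "\<forall>j\<le>i. F (pre n) j = F X j" using cF unfolding causal_def by blast
      then show ?thesis by simp
    qed
    then have "\<forall>i\<le>n. G (F (pre n)) i = G (F X) i"
      using cG unfolding strongly_causal_def by blast
    then have "G (F (pre n)) n = G (F X) n" by simp
    then show ?thesis by (simp add: X_def pre)
  qed
  then have "G (F X) = X" by blast
  then show False using F G unfolding C_solution_def SC_counter_def by metis
qed

definition Iff_mlo :: "mlo \<Rightarrow> mlo \<Rightarrow> mlo" where
  "Iff_mlo \<phi> \<psi> = Conj (Neg (Conj \<phi> (Neg \<psi>))) (Neg (Conj \<psi> (Neg \<phi>)))"

lemma determined_imp_ultimately_periodic: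
  assumes "\<And>\<psi>. \<psi> \<in> formulas_XYP \<Longrightarrow> (\<exists>F. C_solution P \<psi> F) \<or> (\<exists>G. SC_counter P \<psi> G)"
  shows "ultimately_periodic P"
proof -
  define \<psi> where "\<psi> = Neg (ExElem 0 (Neg (Iff_mlo (InVar 0 1) (InP 0))))"
  have holds: "holds P \<psi> X Y \<longleftrightarrow> (\<forall>n. Y n \<longleftrightarrow> n \<in> P)" for X Y
    unfolding holds_def \<psi>_def Iff_mlo_def by auto
  have "\<psi> \<in> formulas_XYP" by (auto simp: \<psi>_def Iff_mlo_def formulas_XYP_def)
  moreover have "\<not> SC_counter P \<psi> G" for G
    unfolding SC_counter_def holds by (auto intro!: exI[of _ "\<lambda>n. n \<in> P"])
  ultimately obtain F where F: "C_solution P \<psi> F" using assms by blast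
  then obtain Q q \<delta> out where c: "transition_system Q q \<delta>" "\<And>X i. F X i = out (run \<delta> q X i) (X i)"
    unfolding C_solution_def finite_state_C_def computed_by_C_def by blast
  define r where "r n = run \<delta> q (\<lambda>_. False) n" for n
  have P: "n \<in> P \<longleftrightarrow> out (r n) False" for n
    using F c(2) unfolding C_solution_def holds r_def by blast
  have "finite (range r)" by (rule finite_subset[of _ Q]) (use c(1) run_in in \<open>auto simp: r_def
      transition_system_def\<close>)
  then have "\<not> inj r" using finite_imageD infinite_UNIV_nat by blast
  then obtain i j where ij: "i < j" "r i = r j" unfolding inj_def by (metis linorder_neqE_nat)
  have per: "r (n + i) = r (n + j)" for n
    by (induction n) (use ij(2) in \<open>simp_all add: r_def\<close>)
  have "n \<in> P \<longleftrightarrow> n + (j - i) \<in> P" if "n > i" for n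
    using per[of "n - i"] that ij by (simp add: P)
  then have "\<forall>n>i. n \<in> P \<longleftrightarrow> n + (j - i) \<in> P" by blast
  moreover have "0 < j - i" using ij by simp
  ultimately show ?thesis unfolding ultimately_periodic_def by blast
qed

section \<open>Recursive functions\<close>

text \<open>Arguments are addressed as \<open>hd (tl (\<dots> xs))\<close>, so that the variables of bounded quantifiers and
  recursions can be pushed on the front of the argument list.\<close>

definition cf :: "nat \<Rightarrow> (nat list \<Rightarrow> nat) \<Rightarrow> bool" where
  "cf n F \<longleftrightarrow> (\<exists>r. \<forall>xs. length xs = n \<longrightarrow> eval r xs (F xs))"

definition cp :: "nat \<Rightarrow> (nat list \<Rightarrow> bool) \<Rightarrow> bool" where
  "cp n R \<longleftrightarrow> cf n (\<lambda>xs. of_bool (R xs))"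

lemma cf_cong: "cf n G \<Longrightarrow> (\<And>xs. length xs = n \<Longrightarrow> F xs = G xs) \<Longrightarrow> cf n F"
  unfolding cf_def by auto

lemma cp_cong: "cp n G \<Longrightarrow> (\<And>xs. length xs = n \<Longrightarrow> F xs = G xs) \<Longrightarrow> cp n F"
  unfolding cp_def by (erule cf_cong) simp

lemma cf_zero: "cf n (\<lambda>_. 0)"
  unfolding cf_def by (auto intro: eval_Zero)

lemma cf_Suc: "cf n F \<Longrightarrow> cf n (\<lambda>xs. Suc (F xs))"
proof -
  assume "cf n F"
  then obtain r where "\<And>xs. length xs = n \<Longrightarrow> eval r xs (F xs)" unfolding cf_def by blast
  then have "eval (Comp Succ [r]) xs (Suc (F xs))" if "length xs = n" for xs
    using that by (intro eval_Comp[of _ _ "[F xs]"]) (auto intro: eval_Succ)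
  then show ?thesis unfolding cf_def by blast
qed

lemma cf_nth: "i < n \<Longrightarrow> cf n (\<lambda>xs. xs ! i)"
  unfolding cf_def by (auto intro: eval_Proj)

lemma cf_num: "cf n (\<lambda>_. k)"
  by (induction k) (auto intro: cf_zero cf_Suc)

lemma cf_hd_funpow_tl: "k < n \<Longrightarrow> cf n (\<lambda>xs. hd ((tl ^^ k) xs))"
proof (rule cf_cong[OF cf_nth])
  fix xs :: "nat list" assume "k < n" "length xs = n"
  moreover have "(tl ^^ k) xs = drop k xs" by (induction k) (auto simp: drop_Suc tl_drop)
  ultimately show "hd ((tl ^^ k) xs) = xs ! k" by (simp add: hd_drop_conv_nth)
qed

lemmas cf_var =
  cf_hd_funpow_tl[of 0, simplified]
  cf_hd_funpow_tl[of "Suc 0", simplified]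
  cf_hd_funpow_tl[of "Suc (Suc 0)", simplified]
  cf_hd_funpow_tl[of "Suc (Suc (Suc 0))", simplified]
  cf_hd_funpow_tl[of "Suc (Suc (Suc (Suc 0)))", simplified]
  cf_hd_funpow_tl[of "Suc (Suc (Suc (Suc (Suc 0))))", simplified]
  cf_hd_funpow_tl[of "Suc (Suc (Suc (Suc (Suc (Suc 0)))))", simplified]
  cf_hd_funpow_tl[of "Suc (Suc (Suc (Suc (Suc (Suc (Suc 0))))))", simplified]
  cf_hd_funpow_tl[of "Suc (Suc (Suc (Suc (Suc (Suc (Suc (Suc 0)))))))", simplified]
  cf_hd_funpow_tl[of "Suc (Suc (Suc (Suc (Suc (Suc (Suc (Suc (Suc 0))))))))", simplified]
  cf_hd_funpow_tl[of "Suc (Suc (Suc (Suc (Suc (Suc (Suc (Suc (Suc (Suc 0)))))))))", simplified]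
  cf_hd_funpow_tl[of "Suc (Suc (Suc (Suc (Suc (Suc (Suc (Suc (Suc (Suc (Suc 0))))))))))", simplified]

lemma evals_Proj:
  assumes "length xs = n"
  shows "list_all2 (\<lambda>g y. eval g xs y) (map Proj [0..<n]) xs"
  using assms by (auto simp: list_all2_conv_all_nth intro: eval_Proj)

lemma cf_weaken: "cf n F \<Longrightarrow> cf (Suc n) (\<lambda>ys. F (tl ys))"
proof -
  assume "cf n F"
  then obtain r where r: "\<And>xs. length xs = n \<Longrightarrow> eval r xs (F xs)" unfolding cf_def by blast
  have "eval (Comp r (map Proj [1..<Suc n])) ys (F (tl ys))" if "length ys = Suc n" for ys
  proof (rule eval_Comp)
    have "eval (Proj (Suc i)) ys (tl ys ! i)" if "i < n" for i
      using eval_Proj[of "Suc i" ys] that \<open>length ys = Suc n\<close> by (simp add: nth_tl)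
    then show "list_all2 (\<lambda>g y. eval g ys y) (map Proj [1..<Suc n]) (tl ys)"
      using that by (auto simp: list_all2_conv_all_nth simp del: upt_Suc)
    show "eval r (tl ys) (F (tl ys))" using r that by simp
  qed
  then show ?thesis unfolding cf_def by blast
qed

lemma cf_weaken2: "cf n F \<Longrightarrow> cf (Suc (Suc n)) (\<lambda>ys. F (tl (tl ys)))"
  using cf_weaken[OF cf_weaken] .

lemma cf_rec:
  assumes "cf n A" "cf n G" "cf (Suc (Suc n)) (\<lambda>ys. H (hd ys) (hd (tl ys)) (tl (tl ys)))"
  shows "cf n (\<lambda>xs. rec_nat (G xs) (\<lambda>m y. H m y xs) (A xs))"
proof -
  from assms obtain ra rg rh where ra: "\<And>xs. length xs = n \<Longrightarrow> eval ra xs (A xs)"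
    and rg: "\<And>xs. length xs = n \<Longrightarrow> eval rg xs (G xs)"
    and rh: "\<And>xs. length xs = Suc (Suc n) \<Longrightarrow> eval rh xs (H (hd xs) (hd (tl xs)) (tl (tl xs)))"
    unfolding cf_def by blast
  have rec: "eval (PrimRec rg rh) (m # xs) (rec_nat (G xs) (\<lambda>m y. H m y xs) m)" if "length xs = n"
      for m xs
  proof (induction m)
    case 0
    show ?case using rg[OF that] by (auto intro: eval_PrimRec_0)
  next
    case (Suc m)
    show ?case using eval_PrimRec_Suc[OF Suc rh[of "m # _ # xs"]] that by simp
  qed
  have "eval (Comp (PrimRec rg rh) (ra # map Proj [0..<n])) xs (rec_nat (G xs) (\<lambda>m y. H m y xs) (A xs))"
    if "length xs = n" for xs
    using that by (intro eval_Comp[OF _ rec]) (auto intro: ra evals_Proj)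
  then show ?thesis unfolding cf_def by blast
qed

section \<open>Primitive recursive arithmetic\<close>

lemma cf_pred: "cf n A \<Longrightarrow> cf n (\<lambda>xs. A xs - 1)"
proof (rule cf_cong[OF cf_rec[of n A "\<lambda>_. 0" "\<lambda>m y xs. m"]])
  fix xs show "A xs - 1 = rec_nat 0 (\<lambda>m y. m) (A xs)" by (cases "A xs") auto
qed (auto intro: cf_var cf_zero)

lemma cf_diff: "cf n A \<Longrightarrow> cf n B \<Longrightarrow> cf n (\<lambda>xs. A xs - B xs)"
proof (rule cf_cong[OF cf_rec[of n B A "\<lambda>m y xs. y - 1"]])
  fix xs
  have "A xs - b = rec_nat (A xs) (\<lambda>m y. y - 1) b" for b by (induction b) auto
  then show "A xs - B xs = rec_nat (A xs) (\<lambda>m y. y - 1) (B xs)" .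
qed (assumption | rule cf_pred cf_var | simp; fail)+

lemma cf_add: "cf n A \<Longrightarrow> cf n B \<Longrightarrow> cf n (\<lambda>xs. A xs + B xs)"
proof (rule cf_cong[OF cf_rec[of n B A "\<lambda>m y xs. Suc y"]])
  fix xs
  have "A xs + b = rec_nat (A xs) (\<lambda>m y. Suc y) b" for b by (induction b) auto
  then show "A xs + B xs = rec_nat (A xs) (\<lambda>m y. Suc y) (B xs)" .
qed (assumption | rule cf_Suc cf_var | simp; fail)+

lemma cf_mult: "cf n A \<Longrightarrow> cf n B \<Longrightarrow> cf n (\<lambda>xs. A xs * B xs)"
proof (rule cf_cong[OF cf_rec[of n B "\<lambda>_. 0" "\<lambda>m y xs. A xs + y"]])
  fix xs
  have "A xs * b = rec_nat 0 (\<lambda>m y. A xs + y) b" for b by (induction b) auto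
  then show "A xs * B xs = rec_nat 0 (\<lambda>m y. A xs + y) (B xs)" .
qed (assumption | rule cf_add cf_zero cf_weaken2 cf_var | simp; fail)+

lemma cf_power: "cf n A \<Longrightarrow> cf n B \<Longrightarrow> cf n (\<lambda>xs. A xs ^ B xs)"
proof (rule cf_cong[OF cf_rec[of n B "\<lambda>_. 1" "\<lambda>m y xs. A xs * y"]])
  fix xs
  have "A xs ^ b = rec_nat 1 (\<lambda>m y. A xs * y) b" for b by (induction b) auto
  then show "A xs ^ B xs = rec_nat 1 (\<lambda>m y. A xs * y) (B xs)" .
qed (assumption | rule cf_mult cf_num cf_weaken2 cf_var | simp; fail)+

lemma cf_fact: "cf n A \<Longrightarrow> cf n (\<lambda>xs. fact (A xs))"
proof (rule cf_cong[OF cf_rec[of n A "\<lambda>_. 1" "\<lambda>m y xs. Suc m * y"]])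
  fix xs
  have "fact b = rec_nat 1 (\<lambda>m y. Suc m * y) b" for b by (induction b) auto
  then show "fact (A xs) = rec_nat 1 (\<lambda>m y. Suc m * y) (A xs)" .
qed (assumption | rule cf_num cf_mult cf_Suc cf_var | simp; fail)+

section \<open>Decidable relations, minimisation and bounded quantifiers\<close>

lemma cf_of_bool: "cp n R \<Longrightarrow> cf n (\<lambda>xs. of_bool (R xs))"
  by (simp add: cp_def)

lemma cp_not: "cp n R \<Longrightarrow> cp n (\<lambda>xs. \<not> R xs)"
  unfolding cp_def by (rule cf_cong[OF cf_diff[OF cf_num[of n 1]]]) auto

lemma cp_conj: "cp n R \<Longrightarrow> cp n S \<Longrightarrow> cp n (\<lambda>xs. R xs \<and> S xs)"
  unfolding cp_def by (rule cf_cong[OF cf_mult]) (assumption+, auto)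

lemma cp_disj: "cp n R \<Longrightarrow> cp n S \<Longrightarrow> cp n (\<lambda>xs. R xs \<or> S xs)"
  by (rule cp_cong[OF cp_not[OF cp_conj[OF cp_not cp_not]]]) auto

lemma cp_imp: "cp n R \<Longrightarrow> cp n S \<Longrightarrow> cp n (\<lambda>xs. R xs \<longrightarrow> S xs)"
  by (rule cp_cong[OF cp_disj[OF cp_not]]) auto

lemma cp_iff: "cp n R \<Longrightarrow> cp n S \<Longrightarrow> cp n (\<lambda>xs. R xs \<longleftrightarrow> S xs)"
  by (rule cp_cong[OF cp_conj[OF cp_imp[of n R S] cp_imp[of n S R]]]) auto

text \<open>With truncated subtraction, \<open>1 - (1 - x)\<close> is 1 for every positive x and 0
  for x = 0.\<close>

lemma cp_less: "cf n A \<Longrightarrow> cf n B \<Longrightarrow> cp n (\<lambda>xs. A xs < B xs)"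
  unfolding cp_def
  by (rule cf_cong[OF cf_diff[OF cf_num[of n 1] cf_diff[OF cf_num[of n 1] cf_diff[of n B A]]]]) auto

lemma cp_le: "cf n A \<Longrightarrow> cf n B \<Longrightarrow> cp n (\<lambda>xs. A xs \<le> B xs)"
  by (rule cp_cong[OF cp_not[OF cp_less[of n B A]]]) auto

lemma cp_eq: "cf n A \<Longrightarrow> cf n B \<Longrightarrow> cp n (\<lambda>xs. A xs = B xs)"
  by (rule cp_cong[OF cp_conj[OF cp_le[of n A B] cp_le[of n B A]]]) auto

lemma cf_If: "cp n R \<Longrightarrow> cf n A \<Longrightarrow> cf n B \<Longrightarrow> cf n (\<lambda>xs. if R xs then A xs else B xs)"
  by (rule cf_cong[OF cf_add[OF cf_mult[OF cf_of_bool[of n R]]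
      cf_mult[OF cf_of_bool[OF cp_not[of n R]]], of A B]]) auto

lemma eval_Least:
  assumes "\<And>xs. length xs = Suc n \<Longrightarrow> eval r xs (of_bool (\<not> R (hd xs) (tl xs)))"
    and "length xs = n" "\<exists>y. R y xs"
  shows "eval (Mu r) xs (LEAST y. R y xs)"
proof (rule eval_Mu)
  let ?y = "LEAST y. R y xs"
  have "R ?y xs" using assms(3) by (rule LeastI_ex)
  then show "eval r (?y # xs) 0" using assms(1)[of "?y # xs"] assms(2) by simp
  show "\<forall>i<?y. \<exists>k. eval r (i # xs) (Suc k)"
  proof (intro allI impI)
    fix i assume "i < ?y"
    then have "\<not> R i xs" by (rule not_less_Least)
    then show "\<exists>k. eval r (i # xs) (Suc k)" using assms(1)[of "i # xs"] assms(2) by auto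
  qed
qed

lemma cf_Least:
  assumes "cp (Suc n) (\<lambda>ys. R (hd ys) (tl ys))" "\<And>xs. length xs = n \<Longrightarrow> \<exists>y. R y xs"
  shows "cf n (\<lambda>xs. LEAST y. R y xs)"
proof -
  obtain r where "\<And>xs. length xs = Suc n \<Longrightarrow> eval r xs (of_bool (\<not> R (hd xs) (tl xs)))"
    using cp_not[OF assms(1)] unfolding cp_def cf_def by blast
  then show ?thesis using eval_Least[of n r R] assms(2) unfolding cf_def by blast
qed

text \<open>Admitting every number from the bound upwards makes the minimisation total; it stops
  below the bound exactly when a witness exists.\<close>

lemma cp_bex:
  assumes "cf n G" "cp (Suc n) (\<lambda>ys. R (hd ys) (tl ys))"
  shows "cp n (\<lambda>xs. \<exists>y<G xs. R y xs)"
proof (rule cp_cong[OF cp_less[OF cf_Least assms(1)]])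
  show "cp (Suc n) (\<lambda>ys. G (tl ys) \<le> hd ys \<or> R (hd ys) (tl ys))"
    by (intro cp_disj cp_le assms cf_weaken cf_var) simp
  show "\<exists>y. G xs \<le> y \<or> R y xs" for xs by blast
  fix xs
  show "(\<exists>y<G xs. R y xs) \<longleftrightarrow> (LEAST y. G xs \<le> y \<or> R y xs) < G xs"
  proof
    assume "\<exists>y<G xs. R y xs"
    then obtain y where "y < G xs" "R y xs" by blast
    then show "(LEAST y. G xs \<le> y \<or> R y xs) < G xs"
      using Least_le[of "\<lambda>y. G xs \<le> y \<or> R y xs" y] by simp
  next
    assume l: "(LEAST y. G xs \<le> y \<or> R y xs) < G xs"
    have "G xs \<le> (LEAST y. G xs \<le> y \<or> R y xs) \<or> R (LEAST y. G xs \<le> y \<or> R y xs) xs"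
      by (rule LeastI[of _ "G xs"]) simp
    then show "\<exists>y<G xs. R y xs" using l by auto
  qed
qed

lemma cp_ball:
  assumes "cf n G" "cp (Suc n) (\<lambda>ys. R (hd ys) (tl ys))"
  shows "cp n (\<lambda>xs. \<forall>y<G xs. R y xs)"
  by (rule cp_cong[OF cp_not[OF cp_bex[OF assms(1) cp_not[OF assms(2)]]]]) auto

lemmas cf_intros = cf_var cf_num cf_Suc cf_add cf_diff cf_mult cf_power cf_fact cf_of_bool cf_If
  cp_not cp_conj cp_disj cp_imp cp_iff cp_less cp_le cp_eq cp_bex cp_ball cf_rec

lemma cf_div: "cf n A \<Longrightarrow> cf n B \<Longrightarrow> cf n (\<lambda>xs. A xs div B xs)"
\<comment> \<open>The alternative \<open>B xs = 0\<close> makes the search stop at 0, the value of a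
  division by zero.\<close>
proof (rule cf_cong[OF cf_Least[of n "\<lambda>q xs. B xs = 0 \<or> A xs < Suc q * B xs"]])
  fix xs
  show "\<exists>q. B xs = 0 \<or> A xs < Suc q * B xs"
    by (intro exI[of _ "A xs"]) (cases "B xs"; simp add: less_Suc_eq_le)
  show "A xs div B xs = (LEAST q. B xs = 0 \<or> A xs < Suc q * B xs)"
  proof (rule Least_equality[symmetric])
    show "B xs = 0 \<or> A xs < Suc (A xs div B xs) * B xs"
      by (metis bot_nat_0.not_eq_extremum dividend_less_div_times mult_Suc)
    fix q assume "B xs = 0 \<or> A xs < Suc q * B xs"
    then show "A xs div B xs \<le> q"
      by (metis div_by_0 le0 less_Suc_eq_le less_mult_imp_div_less)
  qed
qed (assumption | rule cf_intros cf_weaken | simp; fail)+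

lemma cf_mod: "cf n A \<Longrightarrow> cf n B \<Longrightarrow> cf n (\<lambda>xs. A xs mod B xs)"
  by (rule cf_cong[OF cf_diff[OF _ cf_mult[OF cf_div[of n A B]], of A B]]) (simp_all
      add: minus_div_mult_eq_mod)

lemma cp_set_decode: "cf n A \<Longrightarrow> cf n B \<Longrightarrow> cp n (\<lambda>xs. A xs \<in> set_decode (B xs))"
  by (rule cp_cong[OF cp_eq[OF cf_mod[OF cf_div[OF _ cf_power[OF cf_num[of n 2], of A], of B]
      cf_num[of n 2]] cf_num[of n 1]]])
    (simp_all add: set_decode_def odd_iff_mod_2_eq_one)

section \<open>Pairing and its projections\<close>

lemma cf_triangle: "cf n A \<Longrightarrow> cf n (\<lambda>xs. triangle (A xs))"
proof (rule cf_cong[OF cf_rec[of n A "\<lambda>_. 0" "\<lambda>m y xs. y + Suc m"]])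
  fix xs
  have "triangle b = rec_nat 0 (\<lambda>m y. y + Suc m) b" for b by (induction b) auto
  then show "triangle (A xs) = rec_nat 0 (\<lambda>m y. y + Suc m) (A xs)" .
qed (assumption | rule cf_intros | simp; fail)+

lemma cf_prod_encode: "cf n A \<Longrightarrow> cf n B \<Longrightarrow> cf n (\<lambda>xs. prod_encode (A xs, B xs))"
  by (rule cf_cong[OF cf_add[OF cf_triangle[OF cf_add[of n A B]], of A]]) (simp_all
      add: prod_encode_def)

definition pfst :: "nat \<Rightarrow> nat" where
  "pfst x = fst (prod_decode x)"

definition psnd :: "nat \<Rightarrow> nat" where
  "psnd x = snd (prod_decode x)"

lemma pfst_encode [simp]: "pfst (prod_encode (a, b)) = a"
  by (simp add: pfst_def)

lemma psnd_encode [simp]: "psnd (prod_encode (a, b)) = b"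
  by (simp add: psnd_def)

lemma prod_encode_pfst_psnd [simp]: "prod_encode (pfst x, psnd x) = x"
  by (simp add: pfst_def psnd_def)

lemma psnd_le: "psnd x \<le> x"
  using le_prod_encode_2[of "psnd x" "pfst x"] by simp

text \<open>Inversion of the pairing by search: the second component never exceeds the code, which
  bounds the inner quantifier.\<close>

lemma cf_pfst: "cf n A \<Longrightarrow> cf n (\<lambda>xs. pfst (A xs))"
proof (rule cf_cong[OF cf_Least[of n "\<lambda>m xs. \<exists>k<Suc (A xs). prod_encode (m, k) = A xs"]])
  fix xs
  have ex: "\<exists>k<Suc (A xs). prod_encode (pfst (A xs), k) = A xs"
    by (intro exI[of _ "psnd (A xs)"]) (simp add: less_Suc_eq_le psnd_le)
  then show "\<exists>m. \<exists>k<Suc (A xs). prod_encode (m, k) = A xs" by blast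
  show "pfst (A xs) = (LEAST m. \<exists>k<Suc (A xs). prod_encode (m, k) = A xs)"
  proof (rule Least_equality[symmetric])
    show "pfst (A xs) \<le> m" if "\<exists>k<Suc (A xs). prod_encode (m, k) = A xs" for m
      using that by (metis order_refl pfst_encode)
  qed (rule ex)
qed (assumption | rule cf_intros cf_prod_encode cf_weaken2 cf_weaken | simp; fail)+

lemma cf_psnd: "cf n A \<Longrightarrow> cf n (\<lambda>xs. psnd (A xs))"
proof (rule cf_cong[OF cf_Least[of n "\<lambda>m xs. prod_encode (pfst (A xs), m) = A xs"]])
  fix xs
  have ex: "prod_encode (pfst (A xs), psnd (A xs)) = A xs" by simp
  then show "\<exists>m. prod_encode (pfst (A xs), m) = A xs" by blast
  show "psnd (A xs) = (LEAST m. prod_encode (pfst (A xs), m) = A xs)"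
  proof (rule Least_equality[symmetric])
    show "psnd (A xs) \<le> m" if "prod_encode (pfst (A xs), m) = A xs" for m
      using that by (metis order_refl psnd_encode)
  qed (rule ex)
qed (assumption | rule cf_intros cf_prod_encode cf_pfst cf_weaken | simp; fail)+

section \<open>Coded lists and association lists\<close>

definition hdc :: "nat \<Rightarrow> nat" where
  "hdc c = pfst (c - 1)"

text \<open>In \<open>list_encode\<close> the empty list is 0 and a nonempty list is the successor
  of the pair of head and tail; hence the predecessor before each projection and the absorbing value
  0.\<close>

definition dropc :: "nat \<Rightarrow> nat \<Rightarrow> nat" where
  "dropc k c = rec_nat c (\<lambda>_ y. if y = 0 then 0 else psnd (y - 1)) k"

definition lenc :: "nat \<Rightarrow> nat" where
  "lenc c = (LEAST k. dropc k c = 0)"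

lemma dropc_simps [simp]: "dropc 0 c = c" "dropc (Suc k) 0 = 0"
  "dropc (Suc k) (Suc (prod_encode (x, c))) = dropc k c"
proof -
  have dS: "dropc (Suc k) c = (if dropc k c = 0 then 0 else psnd (dropc k c - 1))" for k c
    by (simp add: dropc_def)
  show d0: "dropc 0 c = c" for c by (simp add: dropc_def)
  show "dropc (Suc k) 0 = 0" by (induction k) (simp_all add: dS d0)
  show "dropc (Suc k) (Suc (prod_encode (x, c))) = dropc k c"
    by (induction k) (simp_all add: dS d0)
qed

lemma dropc_list: "dropc k (list_encode xs) = list_encode (drop k xs)"
proof (induction k arbitrary: xs)
  case (Suc k)
  then show ?case by (cases xs) auto
qed simp

lemma list_encode_eq_0: "list_encode xs = 0 \<longleftrightarrow> xs = []"
  by (cases xs) auto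

lemma lenc_list: "lenc (list_encode xs) = length xs"
  unfolding lenc_def dropc_list list_encode_eq_0 by (rule Least_equality) auto

lemma hdc_dropc: "k < length xs \<Longrightarrow> hdc (dropc k (list_encode xs)) = xs ! k"
  by (simp add: dropc_list Cons_nth_drop_Suc[symmetric] hdc_def)

lemma ex_dropc_0: "\<exists>k. dropc k c = 0"
proof -
  have "dropc (length (list_decode c)) (list_encode (list_decode c)) = 0"
      by (simp only: dropc_list) simp
  then show ?thesis by auto
qed

lemma cf_hdc: "cf n A \<Longrightarrow> cf n (\<lambda>xs. hdc (A xs))"
  unfolding hdc_def by (assumption | rule cf_intros cf_pfst)+

lemma cf_dropc: "cf n A \<Longrightarrow> cf n B \<Longrightarrow> cf n (\<lambda>xs. dropc (A xs) (B xs))"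
  unfolding dropc_def by (assumption | rule cf_intros cf_psnd | simp; fail)+

lemma cf_lenc: "cf n A \<Longrightarrow> cf n (\<lambda>xs. lenc (A xs))"
  unfolding lenc_def by (assumption | rule cf_intros cf_Least cf_dropc cf_weaken ex_dropc_0 | simp;
      fail)+

text \<open>Environments are coded association lists; variables not listed have value 0.\<close>

definition lookup :: "nat \<Rightarrow> nat \<Rightarrow> nat" where
  "lookup e i = (let c = dropc (LEAST k. dropc k e = 0 \<or> pfst (hdc (dropc k e)) = i) e
     in if c = 0 then 0 else psnd (hdc c))"

definition bind_var :: "nat \<Rightarrow> nat \<Rightarrow> nat \<Rightarrow> nat" where
  "bind_var i x e = Suc (prod_encode (prod_encode (i, x), e))"

lemma lookup_0 [simp]: "lookup 0 i = 0"
proof -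
  have "dropc k 0 = 0" for k by (cases k) auto
  then show ?thesis by (simp add: lookup_def)
qed

lemma lookup_bind_var [simp]: "lookup (bind_var j x e) i = (if i = j then x else lookup e i)"
proof (cases "i = j")
  case True
  have "(LEAST k. dropc k (bind_var j x e) = 0 \<or> pfst (hdc (dropc k (bind_var j x e))) = i) = 0"
    by (rule Least_equality) (simp_all add: bind_var_def hdc_def True)
  then show ?thesis using True by (simp add: lookup_def bind_var_def hdc_def)
next
  case False
  have "(LEAST k. dropc k (bind_var j x e) = 0 \<or> pfst (hdc (dropc k (bind_var j x e))) = i) =
    Suc (LEAST k. dropc (Suc k) (bind_var j x e) = 0 \<or> pfst (hdc (dropc (Suc k) (bind_var j x e))) = i)"
    by (rule Least_Suc[of _ "Suc (SOME k. dropc k e = 0)"])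
      (use False someI_ex[OF ex_dropc_0[of e]] in \<open>auto simp: bind_var_def hdc_def\<close>)
  then show ?thesis using False by (simp add: lookup_def bind_var_def)
qed

lemma cf_lookup: "cf n A \<Longrightarrow> cf n B \<Longrightarrow> cf n (\<lambda>xs. lookup (A xs) (B xs))"
proof -
  have ex: "\<exists>k. dropc k e = 0 \<or> pfst (hdc (dropc k e)) = i" for e i using ex_dropc_0 by blast
  show "cf n A \<Longrightarrow> cf n B \<Longrightarrow> ?thesis"
    unfolding lookup_def Let_def
    by (assumption | rule ex cf_intros cf_Least cf_dropc cf_psnd cf_pfst cf_hdc cf_weaken | simp; fail)+
qed

lemma cf_bind_var: "cf n A \<Longrightarrow> cf n B \<Longrightarrow> cf n C \<Longrightarrow> cf n (\<lambda>xs. bind_var (A xs) (B xs) (C xs))"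
  unfolding bind_var_def by (assumption | rule cf_intros cf_prod_encode)+

text \<open>A value is promised only where a solution exists, so the minimisation may be partial;
  existence is supplied later by determinacy.\<close>

lemma computable_search:
  assumes "cp 2 (\<lambda>ys. R (hd ys) (hd (tl ys)))" "cf 1 (\<lambda>xs. H (hd xs))"
  shows "\<exists>r. \<forall>x. (\<exists>y. R y x) \<longrightarrow> eval r [x] (H (LEAST y. R y x))"
proof -
  obtain r where r: "\<And>xs. length xs = Suc 1 \<Longrightarrow> eval r xs (of_bool (\<not> R (hd xs) (hd (tl xs))))"
    using cp_not[OF assms(1)] unfolding cp_def cf_def by (auto simp: numeral_2_eq_2)
  obtain h where h: "\<And>xs. length xs = 1 \<Longrightarrow> eval h xs (H (hd xs))"
    using assms(2) unfolding cf_def by blast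
  have "eval (Comp h [Mu r]) [x] (H (LEAST y. R y x))" if "\<exists>y. R y x" for x
  proof (rule eval_Comp)
    show "list_all2 (\<lambda>g y. eval g [x] y) [Mu r] [LEAST y. R y x]"
      using eval_Least[of 1 r "\<lambda>y xs. R y (hd xs)" "[x]"] r that by simp
    show "eval h [LEAST y. R y x] (H (LEAST y. R y x))" using h[of "[LEAST y. R y x]"] by simp
  qed
  then show ?thesis by blast
qed

section \<open>Codes of ultimately periodic sets\<close>

definition up_code :: "nat \<Rightarrow> nat \<Rightarrow> nat \<Rightarrow> nat" where
  "up_code a p b = prod_encode (a, prod_encode (p, b))"

definition up_mem :: "nat \<Rightarrow> nat \<Rightarrow> bool" where
  "up_mem s n \<longleftrightarrow> (if n < pfst s then n else pfst s + (n - pfst s) mod pfst (psnd s)) \<in> set_decode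
      (psnd (psnd s))"

definition up_set :: "nat \<Rightarrow> nat set" where
  "up_set s = {n. up_mem s n}"

text \<open>Aligns the default 0 of \<open>lookup\<close> with the empty set, which
  \<open>holds\<close> assigns to all other set variables.\<close>

lemma up_set_0 [simp]: "up_set 0 = {}"
proof -
  have "prod_encode (0, 0) = 0" by (simp add: prod_encode_def)
  then have "psnd 0 = 0" using psnd_encode[of 0 0] by simp
  then show ?thesis by (simp add: up_set_def up_mem_def)
qed

lemma upw_up_code: "up_word a p (\<lambda>n. n \<in> up_set (up_code a p b))"
  unfolding up_word_def
proof (intro allI impI)
  fix n assume "a \<le> n"
  then have "(n + p - a) mod p = (n - a) mod p" by (metis Nat.add_diff_assoc2 mod_add_self2)
  then show "(n + p \<in> up_set (up_code a p b)) = (n \<in> up_set (up_code a p b))"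
    using \<open>a \<le> n\<close> by (simp add: up_set_def up_mem_def up_code_def)
qed

lemma set_encode_less:
  assumes "A \<subseteq> {..<m}"
  shows "set_encode A < 2 ^ m"
proof -
  have "set_encode A \<le> set_encode {..<m}"
    unfolding set_encode_def by (rule sum_mono2) (use assms in auto)
  also have "set_encode {..<m} < 2 ^ m"
  proof -
    have "(\<Sum>i<m. 2 ^ i :: nat) < 2 ^ m" by (induction m) auto
    then show ?thesis by (simp add: set_encode_def)
  qed
  finally show ?thesis .
qed

text \<open>The part below \<open>a + p\<close> determines the whole set, so a mask of a + p bits
  suffices. This turns a bounded set quantifier into a bounded quantifier over numbers.\<close>

lemma up_code_exists:
  assumes A: "up_word a p (\<lambda>n. n \<in> A)" and p: "0 < p"
  shows "\<exists>b < 2 ^ (a + p). up_set (up_code a p b) = A"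
proof (intro exI conjI)
  let ?b = "set_encode (A \<inter> {..<a + p})"
  show "?b < 2 ^ (a + p)" by (rule set_encode_less) auto
  show "up_set (up_code a p ?b) = A"
  proof (rule set_eqI)
    fix n
    have "a + (n - a) mod p < a + p" using p by simp
    moreover have "a + (n - a) mod p \<in> A \<longleftrightarrow> n \<in> A" if "a \<le> n"
    proof -
      have "n = a + (n - a) mod p + p * ((n - a) div p)" using that by simp
      then show ?thesis using upw_mult[OF A, of "a + (n - a) mod p" "(n - a) div p"] by simp
    qed
    ultimately show "n \<in> up_set (up_code a p ?b) \<longleftrightarrow> n \<in> A"
      by (auto simp: up_set_def up_mem_def up_code_def set_encode_inverse)
  qed
qed

lemma cp_up_mem: "cf n A \<Longrightarrow> cf n B \<Longrightarrow> cp n (\<lambda>xs. up_mem (A xs) (B xs))"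
  unfolding up_mem_def by (assumption | rule cp_set_decode cf_intros cf_mod cf_pfst cf_psnd)+

lemma cf_up_code: "cf n A \<Longrightarrow> cf n B \<Longrightarrow> cf n C \<Longrightarrow> cf n (\<lambda>xs. up_code (A xs) (B xs) (C xs))"
  unfolding up_code_def by (assumption | rule cf_prod_encode)+

section \<open>Certificates for the truth of formulas\<close>

text \<open>An entry \<open>(f, a, p, e, t)\<close> claims that the formula with code \<open>f\<close> has truth value \<open>t\<close> in the environment
  coded by \<open>e\<close>, all of whose sets have offset \<open>a\<close> and period \<open>p\<close>. In environments the element variable \<open>i\<close> is
  stored under \<open>2 * i\<close> and the set variable \<open>j\<close> under \<open>2 * j + 1\<close>.\<close>

definition entry :: "nat \<Rightarrow> nat \<Rightarrow> nat \<Rightarrow> nat \<Rightarrow> nat \<Rightarrow> nat" where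
  "entry f a p e t = prod_encode (f, prod_encode (a, prod_encode (p, prod_encode (e, t))))"

text \<open>The tags are those of \<open>mlo_code\<close>. A true existential statement needs one
  entry, a false one an entry for every instance within the bound. One global \<open>K\<close>
  serves all subformulas, and each quantifier enlarges offset and period, since the new set is
  periodic only with respect to the larger ones.\<close>

definition justified :: "nat \<Rightarrow> nat \<Rightarrow> nat set \<Rightarrow> nat \<Rightarrow> nat \<Rightarrow> nat \<Rightarrow> nat \<Rightarrow> nat \<Rightarrow> bool" where
  "justified K Pc C f a p e t \<longleftrightarrow> t < 2 \<and>
    (pfst f = 0 \<and> (t = 1 \<longleftrightarrow> lookup e (2 * pfst (psnd f)) < lookup e (2 * psnd (psnd f))) \<or>
     pfst f = 1 \<and> (t = 1 \<longleftrightarrow> lookup e (2 * pfst (psnd f)) = lookup e (2 * psnd (psnd f))) \<or>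
     pfst f = 2 \<and> (t = 1 \<longleftrightarrow> up_mem (lookup e (Suc (2 * psnd (psnd f)))) (lookup e (2 * pfst (psnd f)))) \<or>
     pfst f = 3 \<and> (t = 1 \<longleftrightarrow> up_mem Pc (lookup e (2 * psnd f))) \<or>
     pfst f = 4 \<and> entry (psnd f) a p e (1 - t) \<in> C \<or>
     pfst f = 5 \<and> (if t = 1 then entry (pfst (psnd f)) a p e 1 \<in> C \<and> entry (psnd (psnd f)) a p e 1 \<in> C
       else entry (pfst (psnd f)) a p e 0 \<in> C \<or> entry (psnd (psnd f)) a p e 0 \<in> C) \<or>
     pfst f = 6 \<and> (if t = 1
       then \<exists>n < a + p * K. entry (psnd (psnd f)) (a + p * K) (p * fact K) (bind_var (2 * pfst
           (psnd f)) n e) 1 \<in> C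
       else \<forall>n < a + p * K. entry (psnd (psnd f)) (a + p * K) (p * fact K) (bind_var (2 * pfst
           (psnd f)) n e) 0 \<in> C) \<or>
     pfst f = 7 \<and> (if t = 1
       then \<exists>b < 2 ^ (a + p * K + p * fact K). entry (psnd (psnd f)) (a + p * K) (p * fact K)
              (bind_var (Suc (2 * pfst (psnd f))) (up_code (a + p * K) (p * fact K) b) e) 1 \<in> C
       else \<forall>b < 2 ^ (a + p * K + p * fact K). entry (psnd (psnd f)) (a + p * K) (p * fact K)
              (bind_var (Suc (2 * pfst (psnd f))) (up_code (a + p * K) (p * fact K) b) e) 0 \<in> C))"

definition closed_table :: "nat \<Rightarrow> nat \<Rightarrow> nat set \<Rightarrow> bool" where
  "closed_table K Pc C \<longleftrightarrow> (\<forall>x\<in>C. justified K Pc C (pfst x) (pfst (psnd x)) (pfst (psnd (psnd x)))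
     (pfst (psnd (psnd (psnd x)))) (psnd (psnd (psnd (psnd x)))))"

definition sem :: "nat set \<Rightarrow> nat \<Rightarrow> mlo \<Rightarrow> bool" where
  "sem P e \<phi> \<longleftrightarrow> sat P (\<lambda>i. lookup e (2 * i)) (\<lambda>j. up_set (lookup e (Suc (2 * j)))) \<phi>"

definition up_env_code :: "nat \<Rightarrow> nat \<Rightarrow> nat set \<Rightarrow> nat \<Rightarrow> bool" where
  "up_env_code a p P e \<longleftrightarrow> up_env a p P (\<lambda>i. lookup e (2 * i)) (\<lambda>j. up_set (lookup e (Suc (2 * j))))"

lemma closed_tableD: "closed_table K Pc C \<Longrightarrow> entry f a p e t \<in> C \<Longrightarrow> justified K Pc C f a p e t"
  unfolding closed_table_def entry_def by fastforce

lemma closed_tableI: "(\<And>f a p e t. entry f a p e t \<in> C \<Longrightarrow> justified K Pc C f a p e t) \<Longrightarrow>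
    closed_table K Pc C"
  unfolding closed_table_def entry_def by (metis prod_encode_pfst_psnd)

lemma bind_FO: "(\<lambda>i. lookup (bind_var (2 * j) n e) (2 * i)) = (\<lambda>i. lookup e (2 * i))(j := n)"
  "(\<lambda>i. up_set (lookup (bind_var (2 * j) n e) (Suc (2 * i)))) = (\<lambda>i. up_set (lookup e (Suc (2 * i))))"
proof -
  have "Suc (2 * i) \<noteq> 2 * j" for i by presburger
  then show "(\<lambda>i. up_set (lookup (bind_var (2 * j) n e) (Suc (2 * i)))) = (\<lambda>i. up_set (lookup e
      (Suc (2 * i))))"
    by simp
qed auto

lemma bind_SO: "(\<lambda>i. lookup (bind_var (Suc (2 * j)) s e) (2 * i)) = (\<lambda>i. lookup e (2 * i))"
  "(\<lambda>i. up_set (lookup (bind_var (Suc (2 * j)) s e) (Suc (2 * i)))) = (\<lambda>i. up_set (lookup e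
      (Suc (2 * i))))(j := up_set s)"
proof -
  have "2 * i \<noteq> Suc (2 * j)" for i by presburger
  then show "(\<lambda>i. lookup (bind_var (Suc (2 * j)) s e) (2 * i)) = (\<lambda>i. lookup e (2 * i))" by simp
qed (auto simp: fun_eq_iff)

lemma sem_bind_FO: "sem P (bind_var (2 * i) n e) \<phi> \<longleftrightarrow>
    sat P ((\<lambda>i. lookup e (2 * i))(i := n)) (\<lambda>j. up_set (lookup e (Suc (2 * j)))) \<phi>"
  unfolding sem_def bind_FO ..

lemma sem_bind_SO: "sem P (bind_var (Suc (2 * j)) s e) \<phi> \<longleftrightarrow>
    sat P (\<lambda>i. lookup e (2 * i)) ((\<lambda>j. up_set (lookup e (Suc (2 * j))))(j := up_set s)) \<phi>"
  unfolding sem_def bind_SO ..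

lemma upe_bind_FO: "up_env_code a p P e \<Longrightarrow> n < a + p * K \<Longrightarrow>
    up_env_code (a + p * K) (p * fact K) P (bind_var (2 * i) n e)"
  unfolding up_env_code_def bind_FO by (rule upenv_FO)

lemma upe_bind_SO: "up_env_code a p P e \<Longrightarrow>
    up_env_code (a + p * K) (p * fact K) P (bind_var (Suc (2 * j)) (up_code (a + p * K) (p * fact K)
        b) e)"
  unfolding up_env_code_def bind_SO by (rule upenv_SO, assumption, rule upw_up_code)

lemma sem_ExElem:
  assumes "up_env_code a p P e" "32 * lang_index \<phi> \<le> K"
  shows "sem P e (ExElem i \<phi>) \<longleftrightarrow> (\<exists>n < a + p * K. sem P (bind_var (2 * i) n e) \<phi>)"
  unfolding sem_bind_FO unfolding sem_def
  by (rule sat_ExElem_bounded) (use assms in \<open>auto simp: up_env_code_def\<close>)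

lemma sem_ExSet:
  assumes e: "up_env_code a p P e" and K: "lang_index \<phi> \<le> K"
  shows "sem P e (ExSet j \<phi>) \<longleftrightarrow> (\<exists>b < 2 ^ (a + p * K + p * fact K).
    sem P (bind_var (Suc (2 * j)) (up_code (a + p * K) (p * fact K) b) e) \<phi>)"
proof -
  have p: "0 < p * fact K" using e by (simp add: up_env_code_def up_env_def)
  have "sem P e (ExSet j \<phi>) \<longleftrightarrow> (\<exists>A. up_word (a + p * K) (p * fact K) (\<lambda>n. n \<in> A) \<and>
    sat P (\<lambda>i. lookup e (2 * i)) ((\<lambda>j. up_set (lookup e (Suc (2 * j))))(j := A)) \<phi>)"
    unfolding sem_def by (rule sat_ExSet_bounded) (use assms in \<open>auto simp: up_env_code_def\<close>)
  then show ?thesis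
    unfolding sem_bind_SO using up_code_exists[OF _ p] upw_up_code by metis
qed

lemma index_pos: "1 \<le> lang_index \<phi>"
  by (induction \<phi>) (auto simp: Suc_le_eq)

lemma index_sub:
  "lang_index \<phi> \<le> lang_index (Conj \<phi> \<psi>)" "lang_index \<psi> \<le> lang_index (Conj \<phi> \<psi>)"
  "lang_index \<phi> \<le> lang_index (ExElem i \<phi>)" "lang_index \<phi> \<le> lang_index (ExSet j \<phi>)"
proof -
  have "lang_index \<phi> < 2 ^ lang_index \<phi>" by (rule less_exp)
  moreover have "(2::nat) ^ lang_index \<phi> \<le> 2 ^ (32 * lang_index \<phi>)" by (rule power_increasing) auto
  ultimately show "lang_index \<phi> \<le> lang_index (ExElem i \<phi>)" "lang_index \<phi> \<le> lang_index (ExSet j \<phi>)"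
    unfolding lang_index.simps by linarith+
qed (use index_pos[of \<phi>] index_pos[of \<psi>] in simp_all)

text \<open>An entry appeals only to entries for immediate subformulas, so induction on the formula
  rules out circular justifications. Nothing is claimed about entries whose environment violates
  \<open>up_env_code\<close>.\<close>

lemma closed_table_sound:
  assumes C: "closed_table K Pc C" and P: "up_set Pc = P"
  shows "entry (mlo_code \<phi>) a p e t \<in> C \<Longrightarrow> up_env_code a p P e \<Longrightarrow> 32 * lang_index \<phi> \<le> K \<Longrightarrow>
    t = of_bool (sem P e \<phi>)"
proof (induction \<phi> arbitrary: a p e t)
  case (Less i j)
  from closed_tableD[OF C Less(1)] show ?case by (auto simp: justified_def sem_def)
next
  case (Equal i j)
  from closed_tableD[OF C Equal(1)] show ?case by (auto simp: justified_def sem_def)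
next
  case (InVar i j)
  from closed_tableD[OF C InVar(1)] show ?case by (auto simp: justified_def sem_def up_set_def)
next
  case (InP i)
  from closed_tableD[OF C InP(1)] show ?case using P by (auto simp: justified_def sem_def up_set_def)
next
  case (Neg \<phi>)
  from closed_tableD[OF C Neg(2)] have *: "t < 2" "entry (mlo_code \<phi>) a p e (1 - t) \<in> C"
    by (auto simp: justified_def)
  from Neg.IH[OF *(2)] Neg.prems have "1 - t = of_bool (sem P e \<phi>)" by simp
  then show ?case using *(1) by (auto simp: sem_def of_bool_def split: if_splits)
next
  case (Conj \<phi> \<psi>)
  from closed_tableD[OF C Conj.prems(1)] have *: "t < 2"
    "if t = 1 then entry (mlo_code \<phi>) a p e 1 \<in> C \<and> entry (mlo_code \<psi>) a p e 1 \<in> C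
     else entry (mlo_code \<phi>) a p e 0 \<in> C \<or> entry (mlo_code \<psi>) a p e 0 \<in> C"
    by (auto simp: justified_def)
  have K: "32 * lang_index \<phi> \<le> K" "32 * lang_index \<psi> \<le> K"
    using Conj.prems(3) index_sub(1,2)[of \<phi> \<psi>] index_sub(2)[of \<psi> \<phi>] by linarith+
  note IH = Conj.IH(1)[OF _ Conj.prems(2) K(1)] Conj.IH(2)[OF _ Conj.prems(2) K(2)]
  have s: "sem P e (Conj \<phi> \<psi>) \<longleftrightarrow> sem P e \<phi> \<and> sem P e \<psi>" by (simp add: sem_def)
  show ?case
  proof (cases "t = 1")
    case True
    then have e: "entry (mlo_code \<phi>) a p e 1 \<in> C" "entry (mlo_code \<psi>) a p e 1 \<in> C" using *(2)
        by simp_all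
    have "sem P e \<phi>" using IH(1)[OF e(1)] by (cases "sem P e \<phi>") simp_all
    moreover have "sem P e \<psi>" using IH(2)[OF e(2)] by (cases "sem P e \<psi>") simp_all
    ultimately have "sem P e \<phi>" "sem P e \<psi>" by simp_all
    then show ?thesis using True s by simp
  next
    case False
    then have "t = 0" using *(1) by simp
    then consider "entry (mlo_code \<phi>) a p e 0 \<in> C" | "entry (mlo_code \<psi>) a p e 0 \<in> C" using *(2) by auto
    then have "\<not> sem P e \<phi> \<or> \<not> sem P e \<psi>"
    proof cases
      case 1
      from IH(1)[OF this] show ?thesis by simp
    next
      case 2
      from IH(2)[OF this] show ?thesis by simp
    qed
    then show ?thesis using \<open>t = 0\<close> s by simp
  qed
next
  case (ExElem i \<phi>)
  let ?e = "\<lambda>n. entry (mlo_code \<phi>) (a + p * K) (p * fact K) (bind_var (2 * i) n e)"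
  from closed_tableD[OF C ExElem.prems(1)] have *: "t < 2"
    "if t = 1 then \<exists>n < a + p * K. ?e n 1 \<in> C else \<forall>n < a + p * K. ?e n 0 \<in> C"
    by (auto simp: justified_def)
  have K: "32 * lang_index \<phi> \<le> K" using ExElem.prems(3) index_sub(3)[of \<phi> i] by linarith
  have IH: "t = of_bool (sem P (bind_var (2 * i) n e) \<phi>)" if "?e n t \<in> C" "n < a + p * K" for n t
    using ExElem.IH[OF that(1) upe_bind_FO[OF ExElem.prems(2) that(2)] K] .
  have IH1: "sem P (bind_var (2 * i) n e) \<phi>" if "?e n 1 \<in> C" "n < a + p * K" for n
    using IH[OF that] by (cases "sem P (bind_var (2 * i) n e) \<phi>") simp_all
  have IH0: "\<not> sem P (bind_var (2 * i) n e) \<phi>" if "?e n 0 \<in> C" "n < a + p * K" for n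
    using IH[OF that] by simp
  show ?case
  proof (cases "t = 1")
    case True
    then show ?thesis using * IH1 unfolding sem_ExElem[OF ExElem.prems(2) K] by auto
  next
    case False
    then show ?thesis using * IH0 unfolding sem_ExElem[OF ExElem.prems(2) K] by auto
  qed
next
  case (ExSet j \<phi>)
  let ?e = "\<lambda>b. entry (mlo_code \<phi>) (a + p * K) (p * fact K) (bind_var (Suc (2 * j)) (up_code
      (a + p * K) (p * fact K) b) e)"
  from closed_tableD[OF C ExSet.prems(1)] have *: "t < 2"
    "if t = 1 then \<exists>b < 2 ^ (a + p * K + p * fact K). ?e b 1 \<in> C else \<forall>b < 2 ^ (a + p * K + p * fact
        K). ?e b 0 \<in> C"
    by (auto simp: justified_def)
  have K: "32 * lang_index \<phi> \<le> K" "lang_index \<phi> \<le> K" using ExSet.prems(3) index_sub(4)[of \<phi> j]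
      by linarith+
  have IH: "t = of_bool (sem P (bind_var (Suc (2 * j)) (up_code (a + p * K) (p * fact K) b) e) \<phi>)"
      if "?e b t \<in> C" for b t
    using ExSet.IH[OF that upe_bind_SO[OF ExSet.prems(2)] K(1)] .
  have IH1: "sem P (bind_var (Suc (2 * j)) (up_code (a + p * K) (p * fact K) b) e) \<phi>"
      if "?e b 1 \<in> C" for b
    using IH[OF that] by (cases "sem P (bind_var (Suc (2 * j)) (up_code (a + p * K) (p * fact K) b)
        e) \<phi>") simp_all
  have IH0: "\<not> sem P (bind_var (Suc (2 * j)) (up_code (a + p * K) (p * fact K) b) e) \<phi>"
      if "?e b 0 \<in> C" for b
    using IH[OF that] by simp
  show ?case
  proof (cases "t = 1")
    case True
    then show ?thesis using * IH1 unfolding sem_ExSet[OF ExSet.prems(2) K(2)] by auto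
  next
    case False
    then show ?thesis using * IH0 unfolding sem_ExSet[OF ExSet.prems(2) K(2)] by auto
  qed
qed

lemma justified_mono: "justified K Pc C f a p e t \<Longrightarrow> C \<subseteq> D \<Longrightarrow> justified K Pc D f a p e t"
  unfolding justified_def by (elim conjE disjE) (auto split: if_splits)

lemma closed_table_Union: "(\<And>C. C \<in> \<C> \<Longrightarrow> closed_table K Pc C) \<Longrightarrow> closed_table K Pc (\<Union>\<C>)"
  by (rule closed_tableI) (meson Union_iff Union_upper closed_tableD justified_mono)

lemma closed_table_insert:
  "closed_table K Pc C \<Longrightarrow> justified K Pc C f a p e t \<Longrightarrow> closed_table K Pc (insert (entry f a p e t) C)"
proof (rule closed_tableI)
  fix f' a' p' e' t'
  assume C: "closed_table K Pc C" "justified K Pc C f a p e t" and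
      "entry f' a' p' e' t' \<in> insert (entry f a p e t) C"
  then have "justified K Pc C f' a' p' e' t'"
    using closed_tableD[OF C(1)] by (auto simp: entry_def)
  then show "justified K Pc (insert (entry f a p e t) C) f' a' p' e' t'" by (rule justified_mono) blast
qed

definition certifiable :: "nat \<Rightarrow> nat \<Rightarrow> nat \<Rightarrow> bool" where
  "certifiable K Pc x \<longleftrightarrow> (\<exists>C. finite C \<and> closed_table K Pc C \<and> x \<in> C)"

lemma certifiable_finite:
  assumes "finite X" "\<And>x. x \<in> X \<Longrightarrow> certifiable K Pc x"
  shows "\<exists>C. finite C \<and> closed_table K Pc C \<and> X \<subseteq> C"
proof -
  from assms(2) obtain C where C: "\<And>x. x \<in> X \<Longrightarrow> finite (C x) \<and> closed_table K Pc (C x) \<and> x \<in> C x"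
    unfolding certifiable_def by metis
  have "closed_table K Pc (\<Union>(C ` X))" by (rule closed_table_Union) (use C in blast)
  moreover have "finite (\<Union>(C ` X))" using assms(1) C by blast
  ultimately show ?thesis using C by (intro exI[of _ "\<Union>(C ` X)"]) blast
qed

lemma certifiableI:
  assumes "finite X" "\<And>x. x \<in> X \<Longrightarrow> certifiable K Pc x" "justified K Pc X f a p e t"
  shows "certifiable K Pc (entry f a p e t)"
proof -
  obtain C where "finite C" "closed_table K Pc C" "X \<subseteq> C" 
    using certifiable_finite[OF assms(1), of K Pc] assms(2) by auto
  then show ?thesis unfolding certifiable_def
    using closed_table_insert[OF _ justified_mono[OF assms(3)], of C]
    by (intro exI[of _ "insert (entry f a p e t) C"]) auto
qed

text \<open>Every step of the evaluation refers to finitely many instances, and finite closed tables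
  can be united and extended by a justified entry.\<close>

lemma certifiable_complete:
  assumes P: "up_set Pc = P"
  shows "up_env_code a p P e \<Longrightarrow> 32 * lang_index \<phi> \<le> K \<Longrightarrow>
      certifiable K Pc (entry (mlo_code \<phi>) a p e (of_bool (sem P e \<phi>)))"
proof (induction \<phi> arbitrary: a p e)
  case (Less i j)
  show ?case by (rule certifiableI[of "{}"]) (auto simp: justified_def sem_def)
next
  case (Equal i j)
  show ?case by (rule certifiableI[of "{}"]) (auto simp: justified_def sem_def)
next
  case (InVar i j)
  show ?case by (rule certifiableI[of "{}"]) (auto simp: justified_def sem_def up_set_def)
next
  case (InP i)
  show ?case by (rule certifiableI[of "{}"]) (use P in \<open>auto simp: justified_def sem_def up_set_def\<close>)
next
  case (Neg \<phi>)
  show ?case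
    by (rule certifiableI[of "{entry (mlo_code \<phi>) a p e (of_bool (sem P e \<phi>))}"])
      (use Neg in \<open>auto simp: justified_def sem_def of_bool_def\<close>)
next
  case (Conj \<phi> \<psi>)
  have K: "32 * lang_index \<phi> \<le> K" "32 * lang_index \<psi> \<le> K"
    using Conj.prems(2) index_sub(1,2)[of \<phi> \<psi>] index_sub(2)[of \<psi> \<phi>] by linarith+
  show ?case
    by (rule certifiableI[of "{entry (mlo_code \<phi>) a p e (of_bool (sem P e \<phi>)), entry (mlo_code \<psi>) a
        p e (of_bool (sem P e \<psi>))}"])
      (use Conj.IH(1)[OF Conj.prems(1) K(1)] Conj.IH(2)[OF Conj.prems(1) K(2)] in
        \<open>auto simp: justified_def sem_def of_bool_def\<close>)
next
  case (ExElem i \<phi>)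
  let ?e = "\<lambda>n. entry (mlo_code \<phi>) (a + p * K) (p * fact K) (bind_var (2 * i) n e)"
  let ?X = "(\<lambda>n. ?e n (of_bool (sem P (bind_var (2 * i) n e) \<phi>))) ` {..<a + p * K}"
  have K: "32 * lang_index \<phi> \<le> K" using ExElem.prems(2) index_sub(3)[of \<phi> i] by linarith
  have mem: "?e n 1 \<in> ?X" if "n < a + p * K" "sem P (bind_var (2 * i) n e) \<phi>" for n
    using that by (intro image_eqI[of _ _ n]) auto
  have mem0: "?e n 0 \<in> ?X" if "n < a + p * K" "\<not> sem P (bind_var (2 * i) n e) \<phi>" for n
    using that by (intro image_eqI[of _ _ n]) auto
  show ?case
  proof (rule certifiableI[of ?X])
    fix x assume "x \<in> ?X"
    then obtain n where "n < a + p * K" "x = ?e n (of_bool (sem P (bind_var (2 * i) n e) \<phi>))" by blast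
    then show "certifiable K Pc x" using ExElem.IH[OF upe_bind_FO[OF ExElem.prems(1)] K] by simp
  next
    show "justified K Pc ?X (mlo_code (ExElem i \<phi>)) a p e (of_bool (sem P e (ExElem i \<phi>)))"
      unfolding justified_def sem_ExElem[OF ExElem.prems(1) K]
      using mem mem0 by (cases "\<exists>n < a + p * K. sem P (bind_var (2 * i) n e) \<phi>") (simp_all, blast+)
  qed simp
next
  case (ExSet j \<phi>)
  let ?b = "\<lambda>b. bind_var (Suc (2 * j)) (up_code (a + p * K) (p * fact K) b) e"
  let ?e = "\<lambda>b. entry (mlo_code \<phi>) (a + p * K) (p * fact K) (?b b)"
  let ?X = "(\<lambda>b. ?e b (of_bool (sem P (?b b) \<phi>))) ` {..<2 ^ (a + p * K + p * fact K)}"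
  have K: "32 * lang_index \<phi> \<le> K" "lang_index \<phi> \<le> K" using ExSet.prems(2) index_sub(4)[of \<phi> j]
      by linarith+
  have mem: "?e b 1 \<in> ?X" if "b < 2 ^ (a + p * K + p * fact K)" "sem P (?b b) \<phi>" for b
    using that by (intro image_eqI[of _ _ b]) auto
  have mem0: "?e b 0 \<in> ?X" if "b < 2 ^ (a + p * K + p * fact K)" "\<not> sem P (?b b) \<phi>" for b
    using that by (intro image_eqI[of _ _ b]) auto
  show ?case
  proof (rule certifiableI[of ?X])
    fix x assume "x \<in> ?X"
    then obtain b where "x = ?e b (of_bool (sem P (?b b) \<phi>))" by blast
    then show "certifiable K Pc x" using ExSet.IH[OF upe_bind_SO[OF ExSet.prems(1)] K(1)] by simp
  next
    show "justified K Pc ?X (mlo_code (ExSet j \<phi>)) a p e (of_bool (sem P e (ExSet j \<phi>)))"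
      unfolding justified_def sem_ExSet[OF ExSet.prems(1) K(2)]
      using mem mem0 by (cases "\<exists>b < 2 ^ (a + p * K + p * fact K). sem P (?b b) \<phi>") (simp_all, blast+)
  qed simp
qed

lemma cf_entry: "cf n A \<Longrightarrow> cf n B \<Longrightarrow> cf n C \<Longrightarrow> cf n D \<Longrightarrow> cf n E \<Longrightarrow>
    cf n (\<lambda>xs. entry (A xs) (B xs) (C xs) (D xs) (E xs))"
  unfolding entry_def by (assumption | rule cf_prod_encode)+

lemma cp_closed_table:
  assumes "cf n A" "cf n B" "cf n C"
  shows "cp n (\<lambda>xs. closed_table (A xs) (B xs) (set_decode (C xs)))"
proof (rule cp_cong)
  let ?R = "\<lambda>xs. \<forall>x<C xs. x \<in> set_decode (C xs) \<longrightarrow>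
      justified (A xs) (B xs) (set_decode (C xs)) (pfst x) (pfst (psnd x))
     (pfst (psnd (psnd x))) (pfst (psnd (psnd (psnd x)))) (psnd (psnd (psnd (psnd x))))"
  show "cp n ?R"
    unfolding justified_def if_bool_eq_conj
    by (assumption | rule assms cf_intros cp_set_decode cf_entry cf_lookup cf_bind_var cf_up_code
        cp_up_mem
      cf_pfst cf_psnd cf_weaken cf_weaken2 | simp; fail)+
  \<comment> \<open>An element of a decoded set is smaller than the code of the set, so the
    quantifier over all entries can be bounded by the code.\<close>
  have "x < c" if "x \<in> set_decode c" for x c
  proof -
    have "0 < c div 2 ^ x" using that unfolding set_decode_def by (metis mem_Collect_eq odd_pos)
    then have "2 ^ x \<le> c" by (simp add: div_greater_zero_iff)
    then show ?thesis using less_exp[of x] by linarith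
  qed
  then show "closed_table (A xs) (B xs) (set_decode (C xs)) \<longleftrightarrow> ?R xs" for xs
    unfolding closed_table_def by blast
qed

section \<open>Verified transducers\<close>

definition table_row :: "nat \<Rightarrow> nat \<Rightarrow> nat" where
  "table_row tc s = hdc (dropc s (psnd tc))"

definition states :: "nat \<Rightarrow> nat" where
  "states tc = lenc (psnd tc)"

definition succ_state :: "nat \<Rightarrow> nat \<Rightarrow> bool \<Rightarrow> nat" where
  "succ_state tc s x = (if x then pfst (psnd (table_row tc s)) else pfst (table_row tc s))"

definition emits :: "nat \<Rightarrow> nat \<Rightarrow> nat \<Rightarrow> bool \<Rightarrow> bool" where
  "emits k tc s x \<longleftrightarrow> (if k = 0 then (if x then psnd (psnd (psnd (table_row tc s))) else pfst
      (psnd (psnd (table_row tc s)))) = 1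
     else psnd (psnd (table_row tc s)) = 1)"

definition valid_code :: "nat \<Rightarrow> nat \<Rightarrow> bool" where
  "valid_code k tc \<longleftrightarrow> pfst tc < states tc \<and> (\<forall>s<states tc. pfst (table_row tc s) < states tc \<and>
      pfst (psnd (table_row tc s)) < states tc \<and>
     (if k = 0 then pfst (psnd (psnd (table_row tc s))) < 2 \<and>
         psnd (psnd (psnd (table_row tc s))) < 2 else psnd (psnd (table_row tc s)) < 2))"

text \<open>The parameter \<open>k\<close> is the set variable read by the transducer: 0 for C-operators (solutions) and 1 for
  SC-operators (counter-strategies); the other of the two variables is written.\<close>

definition transduce :: "nat \<Rightarrow> nat \<Rightarrow> operator" where
  "transduce k tc X i = emits k tc (run (succ_state tc) (pfst tc) X i) (X i)"

lemma valid_transition_system: "valid_code k tc \<Longrightarrow>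
    transition_system {..<states tc} (pfst tc) (succ_state tc)"
  unfolding valid_code_def transition_system_def succ_state_def by auto

lemma run_agree:
  assumes "transition_system {..<N} q d" "\<And>s a. s < N \<Longrightarrow> d s a = d' s a"
  shows "run d q X i = run d' q X i"
proof (induction i)
  case (Suc i)
  then show ?case using assms run_in[OF assms(1), of X i] by simp
qed simp

lemma transduce_run:
  assumes v: "valid_code k tc"
    and d: "\<And>s a. s < states tc \<Longrightarrow> succ_state tc s a = d s a"
    and out: "\<And>s a. s < states tc \<Longrightarrow> emits k tc s a = out s a"
  shows "transition_system {..<states tc} (pfst tc) d"
    and "transduce k tc X i = out (run d (pfst tc) X i) (X i)"
proof -
  have ts: "transition_system {..<states tc} (pfst tc) (succ_state tc)"
    by (rule valid_transition_system[OF v])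
  then show "transition_system {..<states tc} (pfst tc) d"
    using d unfolding transition_system_def by (metis lessThan_iff)
  have "run (succ_state tc) (pfst tc) X i < states tc" using run_in[OF ts] by simp
  then show "transduce k tc X i = out (run d (pfst tc) X i) (X i)"
    unfolding transduce_def using run_agree[OF ts d] out by metis
qed

lemma decoded_rows:
  "length (list_decode (psnd tc)) = states tc"
  "s < states tc \<Longrightarrow> list_decode (psnd tc) ! s = table_row tc s"
proof -
  show 1: "length (list_decode (psnd tc)) = states tc"
    unfolding states_def using lenc_list[of "list_decode (psnd tc)"] by simp
  show "s < states tc \<Longrightarrow> list_decode (psnd tc) ! s = table_row tc s"
    unfolding table_row_def using hdc_dropc[of s "list_decode (psnd tc)"] 1 by simp
qed

lemma map_decoded_rows:
  assumes "\<And>s. s < states tc \<Longrightarrow> h (table_row tc s) = table_row tc s"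
  shows "map h (list_decode (psnd tc)) = list_decode (psnd tc)"
  by (rule nth_equalityI) (use assms decoded_rows in simp_all)

text \<open>Since output entries are restricted to 0 and 1, decoding a row and encoding it again
  changes nothing. So a number found by the search is itself the code of a genuine table.\<close>

lemma C_table_of_code:
  assumes v: "valid_code 0 tc"
  shows "\<exists>T. C_table_code T = tc \<and> C_table_computes T (transduce 0 tc)"
proof -
  define dec where "dec r = (pfst r, pfst (psnd r), pfst (psnd (psnd r)) = 1, psnd (psnd (psnd r)) =
      1)" for r
  define rows where "rows = map dec (list_decode (psnd tc))"
  have len: "length rows = states tc" by (simp add: rows_def decoded_rows)
  have rows: "rows ! s = dec (table_row tc s)" if "s < states tc" for s
    using that by (simp add: rows_def decoded_rows)
  have "((\<lambda>(d0, d1, o0, o1). prod_encode (d0, prod_encode (d1, prod_encode (of_bool o0,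
      of_bool o1)))) \<circ> dec)
      (table_row tc s) = table_row tc s" if "s < states tc" for s
  proof -
    have "pfst (psnd (psnd (table_row tc s))) < 2" "psnd (psnd (psnd (table_row tc s))) < 2"
      using v that by (auto simp: valid_code_def)
    then have "of_bool (pfst (psnd (psnd (table_row tc s))) = 1) = pfst (psnd (psnd (table_row tc s)))"
      "of_bool (psnd (psnd (psnd (table_row tc s))) = 1) = psnd (psnd (psnd (table_row tc s)))"
      by (auto simp: of_bool_def)
    then show ?thesis unfolding dec_def by simp
  qed
  from map_decoded_rows[OF this] have "C_table_code (pfst tc, rows) = tc"
    unfolding C_table_code_def rows_def prod.case map_map
    by (simp only: list_decode_inverse prod_encode_pfst_psnd)
  moreover have "C_table_computes (pfst tc, rows) (transduce 0 tc)"
    unfolding C_table_computes_def computed_by_C_def prod.case len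
    by (intro conjI allI transduce_run[OF v]) (simp_all add: rows dec_def succ_state_def emits_def)
  ultimately show ?thesis by blast
qed

lemma SC_table_of_code:
  assumes v: "valid_code 1 tc"
  shows "\<exists>T. SC_table_code T = tc \<and> SC_table_computes T (transduce 1 tc)"
proof -
  define dec where "dec r = (pfst r, pfst (psnd r), psnd (psnd r) = 1)" for r
  define rows where "rows = map dec (list_decode (psnd tc))"
  have len: "length rows = states tc" by (simp add: rows_def decoded_rows)
  have rows: "rows ! s = dec (table_row tc s)" if "s < states tc" for s
    using that by (simp add: rows_def decoded_rows)
  have "((\<lambda>(d0, d1, b). prod_encode (d0, prod_encode (d1, of_bool b))) \<circ> dec) (table_row tc s) =
      table_row tc s"
    if "s < states tc" for s
  proof -
    have "psnd (psnd (table_row tc s)) < 2" using v that by (auto simp: valid_code_def)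
    then have "of_bool (psnd (psnd (table_row tc s)) = 1) = psnd (psnd (table_row tc s))"
        by (auto simp: of_bool_def)
    then show ?thesis unfolding dec_def by simp
  qed
  from map_decoded_rows[OF this] have "SC_table_code (pfst tc, rows) = tc"
    unfolding SC_table_code_def rows_def prod.case map_map
    by (simp only: list_decode_inverse prod_encode_pfst_psnd)
  moreover have "SC_table_computes (pfst tc, rows) (transduce 1 tc)"
    unfolding SC_table_computes_def computed_by_SC_def prod.case len
    by (intro conjI allI transduce_run(1)[OF v] transduce_run(2)[OF v,
        where out = "\<lambda>s _. case rows ! s of (d0, d1, b) \<Rightarrow> b"])
      (simp_all add: rows dec_def succ_state_def emits_def)
  ultimately show ?thesis by blast
qed

lemma code_of_C_table:
  assumes "C_table_computes T F"
  shows "valid_code 0 (C_table_code T) \<and> F = transduce 0 (C_table_code T)"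
proof -
  obtain q rows where T: "T = (q, rows)" by (cases T)
  let ?tc = "C_table_code T"
  let ?d = "\<lambda>s a. case rows ! s of (d0, d1, o0, o1) \<Rightarrow> if a then d1 else d0"
  let ?o = "\<lambda>s a. case rows ! s of (d0, d1, o0, o1) \<Rightarrow> if a then o1 else o0"
  have c: "computed_by_C {..<length rows} q ?d ?o F"
    using assms unfolding C_table_computes_def T prod.case .
  have st: "states ?tc = length rows" and q: "pfst ?tc = q"
    by (simp_all add: states_def C_table_code_def T lenc_list)
  have table_row: "table_row ?tc s = (case rows ! s of (d0, d1, o0, o1) \<Rightarrow>
      prod_encode (d0, prod_encode (d1, prod_encode (of_bool o0, of_bool o1))))" if "s < length
          rows" for s
    using that by (simp add: table_row_def C_table_code_def T hdc_dropc)
  have d: "succ_state ?tc s a = ?d s a" and o: "emits 0 ?tc s a = ?o s a" if "s < length rows" for s a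
    using table_row[OF that] by (simp_all add: succ_state_def emits_def split: prod.split)
  have v: "valid_code 0 ?tc" unfolding valid_code_def st q
  proof (intro conjI allI impI)
    show "q < length rows" using c by (simp add: computed_by_C_def transition_system_def)
    fix s assume s: "s < length rows"
    have closed: "succ_state ?tc s a < length rows" for a
      unfolding d[OF s] using c s unfolding computed_by_C_def transition_system_def by blast
    show "pfst (table_row ?tc s) < length rows" "pfst (psnd (table_row ?tc s)) < length rows"
      using closed[of False] closed[of True] by (simp_all add: succ_state_def)
    show "if (0::nat) = 0 then pfst (psnd (psnd (table_row ?tc s))) < 2 \<and>
        psnd (psnd (psnd (table_row ?tc s))) < 2
      else psnd (psnd (table_row ?tc s)) < 2"
      unfolding table_row[OF s] by (cases "rows ! s") (simp add: of_bool_def)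
  qed
  have "F X i = transduce 0 ?tc X i" for X i
    using transduce_run(2)[where d = ?d and out = ?o, OF v, unfolded st q, OF d o] c
    unfolding computed_by_C_def by metis
  with v show ?thesis by blast
qed

lemma code_of_SC_table:
  assumes "SC_table_computes T F"
  shows "valid_code 1 (SC_table_code T) \<and> F = transduce 1 (SC_table_code T)"
proof -
  obtain q rows where T: "T = (q, rows)" by (cases T)
  let ?tc = "SC_table_code T"
  let ?d = "\<lambda>s a. case rows ! s of (d0, d1, b) \<Rightarrow> if a then d1 else d0"
  let ?o = "\<lambda>s. case rows ! s of (d0, d1, b) \<Rightarrow> b"
  have c: "computed_by_SC {..<length rows} q ?d ?o F"
    using assms unfolding SC_table_computes_def T prod.case .
  have st: "states ?tc = length rows" and q: "pfst ?tc = q"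
    by (simp_all add: states_def SC_table_code_def T lenc_list)
  have table_row: "table_row ?tc s = (case rows ! s of (d0, d1, b) \<Rightarrow>
      prod_encode (d0, prod_encode (d1, of_bool b)))" if "s < length rows" for s
    using that by (simp add: table_row_def SC_table_code_def T hdc_dropc)
  have d: "succ_state ?tc s a = ?d s a" and o: "emits 1 ?tc s a = ?o s" if "s < length rows" for s a
    using table_row[OF that] by (simp_all add: succ_state_def emits_def split: prod.split)
  have v: "valid_code 1 ?tc" unfolding valid_code_def st q
  proof (intro conjI allI impI)
    show "q < length rows" using c by (simp add: computed_by_SC_def transition_system_def)
    fix s assume s: "s < length rows"
    have closed: "succ_state ?tc s a < length rows" for a
      unfolding d[OF s] using c s unfolding computed_by_SC_def transition_system_def by blast
    show "pfst (table_row ?tc s) < length rows" "pfst (psnd (table_row ?tc s)) < length rows"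
      using closed[of False] closed[of True] by (simp_all add: succ_state_def)
    show "if (1::nat) = 0 then pfst (psnd (psnd (table_row ?tc s))) < 2 \<and>
        psnd (psnd (psnd (table_row ?tc s))) < 2
      else psnd (psnd (table_row ?tc s)) < 2"
      unfolding table_row[OF s] by (cases "rows ! s") (simp add: of_bool_def)
  qed
  have "F X i = transduce 1 ?tc X i" for X i
    using transduce_run(2)[where d = ?d and out = "\<lambda>s _. ?o s", OF v, unfolded st q, OF d o] c
    unfolding computed_by_SC_def by metis
  with v show ?thesis by blast
qed

section \<open>Finite checks on ultimately periodic inputs\<close>

text \<open>Of the N + 1 positions n, n - p, ..., n - p * N two carry the same state. Periodicity of
  the input carries this agreement forward to n and an earlier position in phase with it, where both
  words have the same letters as at n; induction then reaches the window.\<close>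

lemma run_window:
  assumes ts: "transition_system {..<N} q \<delta>" and X: "up_word a p X" and Y: "up_word a p Y" and p: "0
      < p"
    and win: "\<And>n. n < a + p * N \<Longrightarrow> Y n = out (run \<delta> q X n) (X n)"
  shows "Y n = out (run \<delta> q X n) (X n)"
proof (induction n rule: less_induct)
  case (less n)
  show ?case
  proof (cases "n < a + p * N")
    case True
    then show ?thesis by (rule win)
  next
    case False
    then have n: "a + p * N \<le> n" by simp
    have "\<not> inj_on (\<lambda>i. run \<delta> q X (n - p * i)) {..N}"
    proof
      assume "inj_on (\<lambda>i. run \<delta> q X (n - p * i)) {..N}"
      then have "card {..N} \<le> card {..<N}"
        by (rule card_inj_on_le) (use run_in[OF ts] in auto)
      then show False by simp
    qed
    then obtain i0 i1 where i01: "i0 \<le> N" "i1 \<le> N" "i0 \<noteq> i1"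
        "run \<delta> q X (n - p * i0) = run \<delta> q X (n - p * i1)"
      unfolding inj_on_def by auto
    obtain i j where ij: "i < j" "j \<le> N" "run \<delta> q X (n - p * i) = run \<delta> q X (n - p * j)"
    proof (cases "i0 < i1")
      case True
      then show thesis using that[of i0 i1] i01 by simp
    next
      case False
      then show thesis using that[of i1 i0] i01 by simp
    qed
    have pj: "a + p * j \<le> n" using n ij(2) by (meson add_le_mono1 le_trans mult_le_mono2 add_left_mono)
    define d where "d = j - i"
    have d: "j = i + d" "0 < d" using ij by (simp_all add: d_def)
    define m where "m = n - p * d"
    have "0 < p * d" "a + p * d \<le> n" using d p pj by (simp_all add: algebra_simps)
    then have m: "n = m + p * d" "a \<le> m" "m < n" unfolding m_def by linarith+
    have "run \<delta> q X (n - p * i + r) = run \<delta> q X (n - p * j + r)" for r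
    proof (induction r)
      case (Suc r)
      have "n - p * i + r = n - p * j + r + p * d" using pj d by (simp add: algebra_simps)
      then have "X (n - p * i + r) = X (n - p * j + r)"
          using upw_mult[OF X, of "n - p * j + r" d] pj by simp
      then show ?case using Suc by simp
    qed (use ij in simp)
    from this[of "p * i"] have "run \<delta> q X n = run \<delta> q X m"
      using pj d by (simp add: m_def algebra_simps)
    moreover have "X n = X m" "Y n = Y m"
        using upw_mult[OF X m(2), of d] upw_mult[OF Y m(2), of d] m(1) by simp_all
    ultimately show ?thesis using less[OF m(3)] by simp
  qed
qed

definition run_state :: "nat \<Rightarrow> nat \<Rightarrow> nat \<Rightarrow> nat" where
  "run_state tc X n = rec_nat (pfst tc) (\<lambda>m s. succ_state tc s (up_mem X m)) n"

lemma run_state: "run_state tc X n = run (succ_state tc) (pfst tc) (up_mem X) n"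
  by (induction n) (simp_all add: run_state_def)

definition io_env :: "nat \<Rightarrow> nat \<Rightarrow> nat \<Rightarrow> nat" where
  "io_env k X Y = bind_var (Suc (2 * (1 - k))) Y (bind_var (Suc (2 * k)) X 0)"

definition bad_output :: "nat \<Rightarrow> nat \<Rightarrow> nat \<Rightarrow> nat \<Rightarrow> nat \<Rightarrow> bool" where
  "bad_output k tc X Y w \<longleftrightarrow> (\<exists>n<w. \<not> (up_mem Y n \<longleftrightarrow> emits k tc (run_state tc X n) (up_mem X n)))"

text \<open>The output is guessed as a second ultimately periodic set: either a deviation from the
  transducer shows up in the window of \<open>run_window\<close>, or the table must vouch for the
  pair. The claimed truth value \<open>1 - k\<close> is true for solutions and false for
  counter-strategies. The definition is applied to an offset and a period already large enough for
  the inputs.\<close>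

definition verified :: "nat \<Rightarrow> nat \<Rightarrow> nat \<Rightarrow> nat \<Rightarrow> nat \<Rightarrow> nat \<Rightarrow> nat set \<Rightarrow> bool" where
  "verified K f a p k tc C \<longleftrightarrow> (\<forall>x < 2 ^ (a + p). \<forall>y < 2 ^ (a + p * K + p * fact K).
     bad_output k tc (up_code a p x) (up_code (a + p * K) (p * fact K) y) (a + p * K + p * fact K *
         states tc) \<or>
     entry f (a + p * K) (p * fact K) (io_env k (up_code a p x) (up_code (a + p * K) (p * fact K)
         y)) (1 - k) \<in> C)"

definition achieves :: "nat set \<Rightarrow> mlo \<Rightarrow> nat \<Rightarrow> operator \<Rightarrow> bool" where
  "achieves P \<psi> k F \<longleftrightarrow> (\<forall>X. (if k = 0 then holds P \<psi> X (F X) else \<not> holds P \<psi> (F X) X))"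

lemma sem_io_env:
  assumes "k < 2"
  shows "sem P (io_env k X Y) \<psi> \<longleftrightarrow> (if k = 0 then holds P \<psi> (up_mem X) (up_mem Y) else holds P \<psi>
      (up_mem Y) (up_mem X))"
proof -
  have FO: "(\<lambda>i. lookup (io_env k X Y) (2 * i)) = (\<lambda>_. 0)"
    unfolding io_env_def bind_SO by simp
  have SO: "(\<lambda>j. up_set (lookup (io_env k X Y) (Suc (2 * j)))) = (\<lambda>_. {})(k := up_set X,
      1 - k := up_set Y)"
    unfolding io_env_def bind_SO by simp
  consider "k = 0" | "k = 1" using assms by linarith
  then show ?thesis
    unfolding sem_def FO SO holds_def by cases (simp_all add: up_set_def fun_upd_twist)
qed

definition size_bound :: "nat \<Rightarrow> mlo \<Rightarrow> nat" where
  "size_bound tc \<psi> = (2 * states tc) ^ states tc * lang_index \<psi>"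

text \<open>A failing input with its output lies in the graph of the transducer intersected with the
  violation. Projecting the output away costs one exponential, whence
  \<open>2 ^ size_bound tc \<psi>\<close>. The input is bounded first and then, with this input
  fixed, the output; this explains the two enlargements of offset and period.\<close>

lemma verification_bound:
  assumes k: "k < 2" and v: "valid_code k tc" and P: "up_env a p P (\<lambda>_. 0) (\<lambda>_. {})"
    and K: "32 * 2 ^ size_bound tc \<psi> \<le> K"
    and fail: "\<not> achieves P \<psi> k (transduce k tc)"
  shows "\<exists>x < 2 ^ (a + p * K + p * fact K). \<exists>y < 2 ^ (a + p * K + p * fact K * K + p * fact K * fact K).
    let X = up_code (a + p * K) (p * fact K) x; Y = up_code (a + p * K + p * fact K * K) (p * fact K
        * fact K) y in
     up_mem Y = transduce k tc (up_mem X) \<and> \<not> (sem P (io_env k X Y) \<psi> \<longleftrightarrow> k = 0)"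
proof -
  define a1 where "a1 = a + p * K"
  define p1 where "p1 = p * fact K"
  define a2 where "a2 = a1 + p1 * K"
  define p2 where "p2 = p1 * fact K"
  have p: "0 < p" "0 < p1" "0 < p2" using P by (simp_all add: up_env_def p1_def p2_def)
  define RL where "RL = {\<alpha>. \<forall>n. SO (1 - k) \<in> \<alpha> n \<longleftrightarrow>
    emits k tc (run (succ_state tc) (pfst tc) (\<lambda>m. SO k \<in> \<alpha> m) n) (SO k \<in> \<alpha> n)}"
  define L where "L = (if k = 0 then - lang \<psi> else lang \<psi>)"
  have L: "recog (lang_index \<psi>) L" unfolding L_def by (simp add: recog_lang recog_compl)
  have RL: "recog ((2 * states tc) ^ states tc) RL"
    unfolding RL_def by (rule recog_run[OF valid_transition_system[OF v]])
  have R: "recog (size_bound tc \<psi>) (RL \<inter> L)"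
    unfolding size_bound_def by (rule recog_inter[OF RL L])
  have le: "size_bound tc \<psi> \<le> K" "2 ^ size_bound tc \<psi> \<le> K"
    using K less_exp[of "size_bound tc \<psi>"] by linarith+
  define \<epsilon> where "\<epsilon> = enc P (\<lambda>_. 0) (\<lambda>_. {})"
  have word: "upd (upd \<epsilon> (SO k) A) (SO (1 - k)) B = enc P (\<lambda>_. 0) ((\<lambda>_. {})(k := A, 1 - k := B))"
      for A B
    by (simp add: \<epsilon>_def upd_enc_SO)
  have k01: "k = 0 \<or> k = 1" using k by linarith
  have RL_mem: "enc P (\<lambda>_. 0) ((\<lambda>_. {})(k := {n. X n}, 1 - k := {n. Y n})) \<in> RL \<longleftrightarrow>
      Y = transduce k tc X" for X Y
  proof -
    have "1 - k \<noteq> k" using k01 by auto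
    then show ?thesis unfolding RL_def transduce_def by (simp add: fun_eq_iff)
  qed
  have L_mem: "enc P (\<lambda>_. 0) ((\<lambda>_. {})(k := {n. X n}, 1 - k := {n. Y n})) \<in> L \<longleftrightarrow>
    (if k = 0 then \<not> holds P \<psi> X Y else holds P \<psi> Y X)" for X Y
    using k01 unfolding L_def holds_def sat_lang by (auto simp: fun_upd_twist)
  obtain X where "\<not> (if k = 0 then holds P \<psi> X (transduce k tc X) else \<not> holds P \<psi> (transduce k tc
      X) X)"
    using fail unfolding achieves_def by blast
  then have "if k = 0 then \<not> holds P \<psi> X (transduce k tc X) else holds P \<psi> (transduce k tc X) X"
    by (simp split: if_splits)
  then have "enc P (\<lambda>_. 0) ((\<lambda>_. {})(k := {n. X n}, 1 - k := {n. transduce k tc X n})) \<in> RL \<inter> L"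
    using RL_mem L_mem by simp
  then have "upd \<epsilon> (SO k) {n. X n} \<in> {\<alpha>. \<exists>B. upd \<alpha> (SO (1 - k)) B \<in> RL \<inter> L}"
    unfolding word[symmetric] by blast
  from bounded_quantifier[OF recog_mono[OF recog_proj[OF R] le(2)] upw_enc[OF P, folded \<epsilon>_def] p(1)
      this]
  obtain A B where A: "up_word a1 p1 (\<lambda>n. n \<in> A)" and B: "upd (upd \<epsilon> (SO k) A) (SO (1 - k)) B \<in> RL \<inter> L"
    unfolding a1_def p1_def by blast
  have "up_word a1 p1 (upd \<epsilon> (SO k) A)"
    unfolding \<epsilon>_def upd_enc_SO a1_def p1_def
    by (rule upw_enc, rule upenv_SO[OF P]) (use A in \<open>simp add: a1_def p1_def\<close>)
  from bounded_quantifier[OF recog_mono[OF R le(1)] this p(2) B]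
  obtain B where B: "up_word a2 p2 (\<lambda>n. n \<in> B)" "upd (upd \<epsilon> (SO k) A) (SO (1 - k)) B \<in> RL \<inter> L"
    unfolding a2_def p2_def by blast
  obtain x where x: "x < 2 ^ (a1 + p1)" "up_set (up_code a1 p1 x) = A"
      using up_code_exists[OF A p(2)] by blast
  obtain y where y: "y < 2 ^ (a2 + p2)" "up_set (up_code a2 p2 y) = B"
      using up_code_exists[OF B(1) p(3)] by blast
  have "enc P (\<lambda>_. 0) ((\<lambda>_. {})(k := {n. up_mem (up_code a1 p1 x) n}, 1 - k := {n. up_mem (up_code
      a2 p2 y) n})) \<in> RL \<inter> L"
    using B(2) unfolding word x(2)[symmetric] y(2)[symmetric] up_set_def .
  then have "up_mem (up_code a2 p2 y) = transduce k tc (up_mem (up_code a1 p1 x))"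
    "\<not> (sem P (io_env k (up_code a1 p1 x) (up_code a2 p2 y)) \<psi> \<longleftrightarrow> k = 0)"
    using RL_mem L_mem sem_io_env[OF k] by (auto split: if_splits)
  then show ?thesis
    using x(1) y(1) unfolding Let_def a2_def p2_def a1_def p1_def by blast
qed

lemma upe_io_env:
  assumes "up_env a p P (\<lambda>_. 0) (\<lambda>_. {})"
  shows "up_env_code (a + p * K + p * fact K * K) (p * fact K * fact K) P
    (io_env k (up_code (a + p * K) (p * fact K) x) (up_code (a + p * K + p * fact K * K) (p * fact K
        * fact K) y))"
proof -
  have "up_env_code a p P 0" using assms by (simp add: up_env_code_def)
  then show ?thesis unfolding io_env_def by (intro upe_bind_SO)
qed

text \<open>A bounded failing pair is a true input-output pair and passes every window test, so the
  table would have to contain a false entry for it.\<close>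

lemma verified_sound:
  assumes k: "k < 2" and v: "valid_code k tc" and Pc: "up_set Pc = P" and P: "up_env a p P (\<lambda>_. 0)
      (\<lambda>_. {})"
    and K: "32 * 2 ^ size_bound tc \<psi> \<le> K" "32 * lang_index \<psi> \<le> K"
    and C: "closed_table K Pc C" "verified K (mlo_code \<psi>) (a + p * K) (p * fact K) k tc C"
  shows "achieves P \<psi> k (transduce k tc)"
proof (rule ccontr)
  let ?X = "up_code (a + p * K) (p * fact K)"
  let ?Y = "up_code (a + p * K + p * fact K * K) (p * fact K * fact K)"
  assume "\<not> achieves P \<psi> k (transduce k tc)"
  from verification_bound[OF k v P K(1) this]
  obtain x y where x: "x < 2 ^ (a + p * K + p * fact K)"
      "y < 2 ^ (a + p * K + p * fact K * K + p * fact K * fact K)"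
    "up_mem (?Y y) = transduce k tc (up_mem (?X x))" "\<not> (sem P (io_env k (?X x) (?Y y)) \<psi> \<longleftrightarrow> k = 0)"
    unfolding Let_def by blast
  have "\<not> bad_output k tc (?X x) (?Y y) w" for w
    unfolding bad_output_def x(3) transduce_def run_state by blast
  then have "entry (mlo_code \<psi>) (a + p * K + p * fact K * K) (p * fact K * fact K) (io_env k (?X x)
      (?Y y)) (1 - k) \<in> C"
    using C(2) x(1,2) unfolding verified_def by blast
  from closed_table_sound[OF C(1) Pc this upe_io_env[OF P] K(2)] x(4) k show False
    by (auto simp: of_bool_def split: if_splits)
qed

text \<open>Pairs passing the window test are genuine by \<open>run_window\<close>. The
  specification therefore has the right truth value on them, and these finitely many entries are
  certifiable.\<close>

lemma verified_complete:
  assumes k: "k < 2" and v: "valid_code k tc" and Pc: "up_set Pc = P" and P: "up_env a p P (\<lambda>_. 0)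
      (\<lambda>_. {})"
    and K: "32 * lang_index \<psi> \<le> K" and sol: "achieves P \<psi> k (transduce k tc)"
  shows "\<exists>C. finite C \<and> closed_table K Pc C \<and> verified K (mlo_code \<psi>) (a + p * K) (p * fact K) k tc C"
proof -
  let ?X = "up_code (a + p * K) (p * fact K)"
  let ?Y = "up_code (a + p * K + p * fact K * K) (p * fact K * fact K)"
  let ?e = "\<lambda>x y. entry (mlo_code \<psi>) (a + p * K + p * fact K * K) (p * fact K * fact K) (io_env k
      (?X x) (?Y y)) (1 - k)"
  let ?w = "a + p * K + p * fact K * K + p * fact K * fact K * states tc"
  define S where "S = {..<(2::nat) ^ (a + p * K + p * fact K)} \<times> {..<(2::nat) ^ (a + p * K + p *
      fact K * K + p * fact K * fact K)}"
  define Z where "Z = (\<lambda>s. ?e (fst s) (snd s)) ` {s \<in> S. \<not> bad_output k tc (?X (fst s)) (?Y (snd s))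
      ?w}"
  have "finite S" unfolding S_def by simp
  then have "finite Z" unfolding Z_def by (intro finite_imageI) (auto intro: finite_subset)
  moreover have "certifiable K Pc z" if zZ: "z \<in> Z" for z
  proof -
    obtain x y where z: "z = ?e x y" "\<not> bad_output k tc (?X x) (?Y y) ?w" 
      using zZ unfolding Z_def by blast
    have X: "up_word (a + p * K + p * fact K * K) (p * fact K * fact K) (up_mem (?X x))"
      using upw_mono[OF upw_up_code] by (simp add: up_set_def)
    have Y: "up_word (a + p * K + p * fact K * K) (p * fact K * fact K) (up_mem (?Y y))"
      using upw_up_code by (simp add: up_set_def)
    have p: "0 < p * fact K * fact K" using P by (simp add: up_env_def)
    have "up_mem (?Y y) n = emits k tc (run (succ_state tc) (pfst tc) (up_mem (?X x)) n)
        (up_mem (?X x) n)" for n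
      by (rule run_window[OF valid_transition_system[OF v] X Y p])
        (use z(2) in \<open>auto simp: bad_output_def run_state\<close>)
    then have "up_mem (?Y y) = transduce k tc (up_mem (?X x))" by (simp add: fun_eq_iff transduce_def)
    then have "sem P (io_env k (?X x) (?Y y)) \<psi> \<longleftrightarrow> k = 0"
      using sol unfolding sem_io_env[OF k] achieves_def by (auto split: if_splits)
    then have t: "of_bool (sem P (io_env k (?X x) (?Y y)) \<psi>) = 1 - k" using k
        by (auto simp: of_bool_def)
    show ?thesis using certifiable_complete[OF Pc upe_io_env[OF P, of K k x y] K] unfolding z(1) t .
  qed
  ultimately obtain C where C: "finite C" "closed_table K Pc C" "Z \<subseteq> C"
    using certifiable_finite[of Z K Pc] by blast
  have "verified K (mlo_code \<psi>) (a + p * K) (p * fact K) k tc C"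
    unfolding verified_def
  proof (intro allI impI)
    fix x y :: nat assume "x < 2 ^ (a + p * K + p * fact K)"
        "y < 2 ^ (a + p * K + p * fact K * K + p * fact K * fact K)"
    then have S: "(x, y) \<in> S" by (simp add: S_def)
    show "bad_output k tc (?X x) (?Y y) ?w \<or> ?e x y \<in> C"
    proof (cases "bad_output k tc (?X x) (?Y y) ?w")
      case False
      then have "?e x y \<in> Z"
        unfolding Z_def by (intro image_eqI[where x = "(x, y)"]) (use S in simp_all)
      then show ?thesis using C(3) by blast
    qed blast
  qed
  with C show ?thesis by blast
qed

text \<open>A recursive bound on \<open>lang_index\<close> that depends on the Goedel number only.\<close>

definition tower :: "nat \<Rightarrow> nat" where
  "tower n = rec_nat 16 (\<lambda>_ y. 2 ^ y) n"

lemma tower_0: "tower 0 = 16" and tower_Suc: "tower (Suc n) = 2 ^ tower n"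
  by (simp_all add: tower_def)

lemma tower_mono: "m \<le> n \<Longrightarrow> tower m \<le> tower n"
  by (rule lift_Suc_mono_le[of tower]) (simp_all add: tower_Suc less_exp less_imp_le)

lemma tower_ge: "16 \<le> tower n"
  using tower_mono[of 0 n] by (simp add: tower_0)

text \<open>The tag of a compound formula raises its code above that of its parts by enough to pay
  for the additional exponentials in \<open>index_le_tower\<close>.\<close>

lemma prod_encode_ge: "m + m + n \<le> prod_encode (m, n)"
proof -
  have "k \<le> triangle k" for k by (induction k) auto
  from this[of "m + n"] show ?thesis by (simp add: prod_encode_def)
qed

text \<open>Each constructor costs at most two levels of the tower, and its tag provides them. The
  base 16 covers the largest atomic index and ensures that x * x and 32 * x are at most 2 ^ x for
  every x in the tower.\<close>

lemma index_le_tower: "lang_index \<phi> \<le> tower (mlo_code \<phi>)"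
proof (induction \<phi>)
  case (Neg \<phi>)
  have "mlo_code \<phi> \<le> mlo_code (Neg \<phi>)" by (simp add: le_prod_encode_2)
  then show ?case using Neg tower_mono by (metis lang_index.simps(5) le_trans)
next
  case (Conj \<phi> \<psi>)
  define u where "u = prod_encode (mlo_code \<phi>, mlo_code \<psi>)"
  have "lang_index \<phi> \<le> tower u" "lang_index \<psi> \<le> tower u"
    using Conj tower_mono[OF le_prod_encode_1[of "mlo_code \<phi>" "mlo_code \<psi>"]]
      tower_mono[OF le_prod_encode_2[of "mlo_code \<psi>" "mlo_code \<phi>"]] unfolding u_def by linarith+
  then have "lang_index \<phi> * lang_index \<psi> \<le> tower u * tower u" by (rule mult_le_mono)
  also have "\<dots> \<le> 2 ^ tower u"
  proof -
    have "(k + 16) * (k + 16) \<le> (2::nat) ^ (k + 16)" for k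
    proof (induction k)
      case (Suc k)
      have "(Suc k + 16) * (Suc k + 16) \<le> 2 * ((k + 16) * (k + 16))" by (simp add: algebra_simps)
      also have "\<dots> \<le> 2 * 2 ^ (k + 16)" using Suc by (rule mult_le_mono2)
      also have "\<dots> = 2 ^ (Suc k + 16)" by (simp only: add_Suc power_Suc)
      finally show ?case .
    qed simp
    from this[of "tower u - 16"] show ?thesis using tower_ge[of u] by simp
  qed
  also have "\<dots> = tower (Suc u)" by (simp add: tower_Suc)
  also have "\<dots> \<le> tower (mlo_code (Conj \<phi> \<psi>))"
    by (rule tower_mono) (use prod_encode_ge[of 5 u] in \<open>simp add: u_def\<close>)
  finally show ?case by simp
next
  case (ExElem i \<phi>)
  define u where "u = prod_encode (i, mlo_code \<phi>)"
  have u: "lang_index \<phi> \<le> tower u"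
    using ExElem tower_mono[OF le_prod_encode_2[of "mlo_code \<phi>" i]] unfolding u_def by linarith
  have "32 * (k + 16) \<le> (2::nat) ^ (k + 16)" for k
  proof (induction k)
    case (Suc k)
    have "32 * (Suc k + 16) \<le> 2 * (32 * (k + 16))" by simp
    also have "\<dots> \<le> 2 * 2 ^ (k + 16)" using Suc by (rule mult_le_mono2)
    also have "\<dots> = 2 ^ (Suc k + 16)" by (simp only: add_Suc power_Suc)
    finally show ?case .
  qed simp
  from this[of "tower u - 16"] have "32 * tower u \<le> 2 ^ tower u" using tower_ge[of u] by simp
  then have "32 * lang_index \<phi> \<le> tower (Suc u)" using u by (simp add: tower_Suc)
  then have "2 ^ (32 * lang_index \<phi>) \<le> (2::nat) ^ tower (Suc u)" by (rule power_increasing) simp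
  also have "\<dots> = tower (Suc (Suc u))" by (simp add: tower_Suc)
  also have "\<dots> \<le> tower (mlo_code (ExElem i \<phi>))"
    by (rule tower_mono) (use prod_encode_ge[of 6 u] in \<open>simp add: u_def\<close>)
  finally show ?case by simp
next
  case (ExSet j \<phi>)
  define u where "u = prod_encode (j, mlo_code \<phi>)"
  have u: "lang_index \<phi> \<le> tower u"
    using ExSet tower_mono[OF le_prod_encode_2[of "mlo_code \<phi>" j]] unfolding u_def by linarith
  then have "2 ^ lang_index \<phi> \<le> (2::nat) ^ tower u" by (rule power_increasing) simp
  also have "\<dots> = tower (Suc u)" by (simp add: tower_Suc)
  also have "\<dots> \<le> tower (mlo_code (ExSet j \<phi>))"
    by (rule tower_mono) (use prod_encode_ge[of 7 u] in \<open>simp add: u_def\<close>)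
  finally show ?case by simp
qed (use tower_ge in \<open>auto intro: order_trans[OF _ tower_ge]\<close>)

section \<open>The witness predicate and its decidability\<close>

text \<open>Meets both requirements on \<open>K\<close> at once: 32 times the exponential of the
  size bound for the transducer, and 32 times the index for the table. It is a function of the two
  codes alone, so the checker can compute it.\<close>

definition bound :: "nat \<Rightarrow> nat \<Rightarrow> nat" where
  "bound tc f = 32 * 2 ^ ((2 * states tc) ^ states tc * tower f)"

lemma bound_ge:
  assumes "valid_code k tc"
  shows "32 * 2 ^ size_bound tc \<psi> \<le> bound tc (mlo_code \<psi>)" "32 * lang_index \<psi> \<le> bound tc (mlo_code \<psi>)"
proof -
  have s: "size_bound tc \<psi> \<le> (2 * states tc) ^ states tc * tower (mlo_code \<psi>)"
    unfolding size_bound_def by (intro mult_le_mono2 index_le_tower)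
  then show 1: "32 * 2 ^ size_bound tc \<psi> \<le> bound tc (mlo_code \<psi>)"
    unfolding bound_def by (intro mult_le_mono2 power_increasing) auto
  have "0 < 2 * states tc" using assms by (simp add: valid_code_def)
  then have "0 < (2 * states tc) ^ states tc" by (rule zero_less_power)
  then have "1 * lang_index \<psi> \<le> size_bound tc \<psi>" unfolding size_bound_def
      by (intro mult_le_mono1) linarith
  then have "lang_index \<psi> \<le> 2 ^ size_bound tc \<psi>" using less_exp[of "size_bound tc \<psi>"] by linarith
  then show "32 * lang_index \<psi> \<le> bound tc (mlo_code \<psi>)" using 1 by linarith
qed

text \<open>A witness packs the kind of operator, its table and the certificate into one number, so
  that a single minimisation finds all three. The description of \<open>P\<close> by
  \<open>a\<close>, \<open>p\<close> and \<open>Pc\<close> is built into the algorithm as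
  constants.\<close>

definition witness :: "nat \<Rightarrow> nat \<Rightarrow> nat \<Rightarrow> nat \<Rightarrow> nat \<Rightarrow> bool" where
  "witness a p Pc z f \<longleftrightarrow> pfst z < 2 \<and> valid_code (pfst z) (pfst (psnd z)) \<and>
     closed_table (bound (pfst (psnd z)) f) Pc (set_decode (psnd (psnd z))) \<and>
     verified (bound (pfst (psnd z)) f) f (a + p * bound (pfst (psnd z)) f) (p * fact
         (bound (pfst (psnd z)) f))
       (pfst z) (pfst (psnd z)) (set_decode (psnd (psnd z)))"

lemmas cf_basic = cf_intros cp_set_decode cf_entry cf_lookup cf_bind_var cf_up_code cp_up_mem
  cf_pfst cf_psnd cf_hdc cf_dropc cf_lenc cf_prod_encode

lemma cf_states: "cf n A \<Longrightarrow> cf n (\<lambda>xs. states (A xs))"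
  unfolding states_def by (assumption | rule cf_basic)+

lemma cf_row: "cf n A \<Longrightarrow> cf n B \<Longrightarrow> cf n (\<lambda>xs. table_row (A xs) (B xs))"
  unfolding table_row_def by (assumption | rule cf_basic)+

lemma cf_succ_state: "cf n A \<Longrightarrow> cf n B \<Longrightarrow> cp n R \<Longrightarrow> cf n (\<lambda>xs. succ_state (A xs) (B xs) (R xs))"
  unfolding succ_state_def by (assumption | rule cf_basic cf_row)+

lemma cp_emits: "cf n k \<Longrightarrow> cf n A \<Longrightarrow> cf n B \<Longrightarrow> cp n R \<Longrightarrow> cp n (\<lambda>xs. emits (k xs) (A xs) (B xs) (R xs))"
  unfolding emits_def if_bool_eq_conj by (assumption | rule cf_basic cf_row)+

lemma cp_valid_code: "cf n k \<Longrightarrow> cf n A \<Longrightarrow> cp n (\<lambda>xs. valid_code (k xs) (A xs))"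
  unfolding valid_code_def if_bool_eq_conj
      by (assumption | rule cf_basic cf_row cf_states cf_weaken | simp; fail)+

lemma cf_run_state: "cf n A \<Longrightarrow> cf n B \<Longrightarrow> cf n C \<Longrightarrow> cf n (\<lambda>xs. run_state (A xs) (B xs) (C xs))"
  unfolding run_state_def by (assumption | rule cf_basic cf_succ_state cf_weaken2 | simp; fail)+

lemma cp_bad_output: "cf n k \<Longrightarrow> cf n A \<Longrightarrow> cf n B \<Longrightarrow> cf n C \<Longrightarrow> cf n D \<Longrightarrow>
    cp n (\<lambda>xs. bad_output (k xs) (A xs) (B xs) (C xs) (D xs))"
  unfolding bad_output_def by (assumption | rule cf_basic cp_emits cf_run_state cf_weaken | simp; fail)+

lemma cf_io_env: "cf n k \<Longrightarrow> cf n A \<Longrightarrow> cf n B \<Longrightarrow> cf n (\<lambda>xs. io_env (k xs) (A xs) (B xs))"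
  unfolding io_env_def by (assumption | rule cf_basic)+

lemma cf_tower: "cf n A \<Longrightarrow> cf n (\<lambda>xs. tower (A xs))"
  unfolding tower_def by (assumption | rule cf_basic | simp; fail)+

lemma cf_bound: "cf n A \<Longrightarrow> cf n B \<Longrightarrow> cf n (\<lambda>xs. bound (A xs) (B xs))"
  unfolding bound_def by (assumption | rule cf_basic cf_states cf_tower)+

lemma cp_verified: "cf n K \<Longrightarrow> cf n f \<Longrightarrow> cf n a \<Longrightarrow> cf n p \<Longrightarrow> cf n k \<Longrightarrow> cf n T \<Longrightarrow> cf n C \<Longrightarrow>
    cp n (\<lambda>xs. verified (K xs) (f xs) (a xs) (p xs) (k xs) (T xs) (set_decode (C xs)))"
  unfolding verified_def
  by (assumption | rule cf_basic cp_bad_output cf_io_env cf_states cf_weaken cf_weaken2 | simp; fail)+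

lemma cp_witness: "cp 2 (\<lambda>ys. witness a p Pc (hd ys) (hd (tl ys)))"
  unfolding witness_def
  by (assumption | rule cf_basic cp_valid_code cp_closed_table cp_verified cf_bound | simp; fail)+

lemma achieves_C: "achieves P \<psi> 0 F \<Longrightarrow> C_table_computes T F \<Longrightarrow> C_solution P \<psi> F"
  unfolding achieves_def C_solution_def using C_table_finite_state by auto

lemma achieves_SC: "achieves P \<psi> 1 F \<Longrightarrow> SC_table_computes T F \<Longrightarrow> SC_counter P \<psi> F"
  unfolding achieves_def SC_counter_def using SC_table_finite_state by auto

lemma ultimately_periodic_imp_effectively_determined:
  assumes up: "ultimately_periodic P"
  shows "effectively_determined P"
proof -
  obtain a p where ap: "0 < a" "0 < p" "up_word a p (\<lambda>n. n \<in> P)"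
    using upw_ultimately_periodic[OF up] by blast
  have env: "up_env a p P (\<lambda>_. 0) (\<lambda>_. {})" using ap by (simp add: up_env_def up_word_def)
  obtain b where Pc: "up_set (up_code a p b) = P" using up_code_exists[OF ap(3,2)] by blast
  let ?W = "witness a p (up_code a p b)"
  have sound: "achieves P \<psi> (pfst z) (transduce (pfst z) (pfst (psnd z)))" if "?W z (mlo_code \<psi>)"
      for z \<psi>
    using that unfolding witness_def
    by (elim conjE) (rule verified_sound[OF _ _ Pc env bound_ge], assumption+)
  have complete: "\<exists>z. ?W z (mlo_code \<psi>)" if "k < 2" "valid_code k tc"
      "achieves P \<psi> k (transduce k tc)" for k tc \<psi>
  proof -
    from verified_complete[OF that(1,2) Pc env bound_ge(2)[OF that(2)] that(3)]
    obtain C where "finite C" "closed_table (bound tc (mlo_code \<psi>)) (up_code a p b) C"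
      "verified (bound tc (mlo_code \<psi>)) (mlo_code \<psi>) (a + p * bound tc (mlo_code \<psi>))
        (p * fact (bound tc (mlo_code \<psi>))) k tc C" by blast
    then have "?W (prod_encode (k, prod_encode (tc, set_encode C))) (mlo_code \<psi>)"
      unfolding witness_def using that(1,2) by (simp add: set_encode_inverse)
    then show ?thesis ..
  qed
  \<comment> \<open>Here determinacy guarantees that the search halts on every formula.\<close>
  have ex: "\<exists>z. ?W z (mlo_code \<psi>)" for \<psi>
  proof -
    consider F where "C_solution P \<psi> F" | G where "SC_counter P \<psi> G" using determined[OF up] by blast
    then show ?thesis
    proof cases
      case 1
      then obtain T where "C_table_computes T F" using C_solution_table by blast
      from code_of_C_table[OF this] show ?thesis
        using 1 complete[of 0 "C_table_code T" \<psi>] by (auto simp: achieves_def C_solution_def)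
    next
      case 2
      then obtain T where "SC_table_computes T G" using SC_counter_table by blast
      from code_of_SC_table[OF this] show ?thesis
        using 2 complete[of 1 "SC_table_code T" \<psi>] by (auto simp: achieves_def SC_counter_def)
    qed
  qed
  define z where "z \<psi> = (LEAST z. ?W z (mlo_code \<psi>))" for \<psi>
  have z: "?W (z \<psi>) (mlo_code \<psi>)" for \<psi> unfolding z_def using ex by (rule LeastI_ex)
  have search: "\<exists>r. \<forall>\<psi>. eval r [mlo_code \<psi>] (H (z \<psi>))" if H: "cf 1 (\<lambda>xs. H (hd xs))" for H
  proof -
    obtain r where "\<And>x. \<exists>y. ?W y x \<Longrightarrow> eval r [x] (H (LEAST y. ?W y x))"
      using computable_search[OF cp_witness[of a p "up_code a p b"] H] by auto
    then show ?thesis unfolding z_def using ex by blast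
  qed
  have C: "\<exists>T. C_table_code T = pfst (psnd (z \<psi>)) \<and>
      C_table_computes T (transduce 0 (pfst (psnd (z \<psi>)))) \<and>
      C_solution P \<psi> (transduce 0 (pfst (psnd (z \<psi>))))" if "pfst (z \<psi>) = 0" for \<psi>
    using C_table_of_code[of "pfst (psnd (z \<psi>))"] z[of \<psi>] sound[OF z, of \<psi>] that achieves_C
    unfolding witness_def by metis
  have SC: "\<exists>T. SC_table_code T = pfst (psnd (z \<psi>)) \<and>
      SC_table_computes T (transduce 1 (pfst (psnd (z \<psi>)))) \<and>
      SC_counter P \<psi> (transduce 1 (pfst (psnd (z \<psi>))))" if "pfst (z \<psi>) = 1" for \<psi>
    using SC_table_of_code[of "pfst (psnd (z \<psi>))"] z[of \<psi>] sound[OF z, of \<psi>] that achieves_SC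
    unfolding witness_def by metis
  have z01: "pfst (z \<psi>) = 0 \<or> pfst (z \<psi>) = 1" for \<psi> using z[of \<psi>] unfolding witness_def by linarith
  \<comment> \<open>The kind of the least witness answers both questions, because a solution and a
    counter-strategy exclude each other.\<close>
  have exC: "(\<exists>F. C_solution P \<psi> F) \<longleftrightarrow> pfst (z \<psi>) = 0" for \<psi>
    using C SC z01 not_both by (metis zero_neq_one)
  have exSC: "(\<exists>G. SC_counter P \<psi> G) \<longleftrightarrow> pfst (z \<psi>) = 1" for \<psi>
    using C SC z01 not_both by (metis zero_neq_one)
  have "decidable (\<lambda>\<psi>. \<exists>F. C_solution P \<psi> F)"
  proof -
    have "cf 1 (\<lambda>xs. 1 - pfst (hd xs))" by (rule cf_basic | simp; fail)+
    from search[OF this] obtain r where "\<And>\<psi>. eval r [mlo_code \<psi>] (1 - pfst (z \<psi>))" by blast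
    moreover have "1 - pfst (z \<psi>) = (if pfst (z \<psi>) = 0 then 1 else 0)" for \<psi> by simp
    ultimately show ?thesis unfolding decidable_def exC by metis
  qed
  moreover have "decidable (\<lambda>\<psi>. \<exists>G. SC_counter P \<psi> G)"
  proof -
    have "cf 1 (\<lambda>xs. pfst (hd xs))" by (rule cf_basic | simp; fail)+
    from search[OF this] obtain r where "\<And>\<psi>. eval r [mlo_code \<psi>] (pfst (z \<psi>))" by blast
    moreover have "pfst (z \<psi>) = (if pfst (z \<psi>) = 1 then 1 else 0)" for \<psi> using z01[of \<psi>] by auto
    ultimately show ?thesis unfolding decidable_def exSC by metis
  qed
  moreover have "cf 1 (\<lambda>xs. pfst (psnd (hd xs)))" by (rule cf_basic | simp; fail)+
  from search[OF this] obtain r where r: "\<And>\<psi>. eval r [mlo_code \<psi>] (pfst (psnd (z \<psi>)))" by blast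
  have "C_solutions_computable P"
    unfolding C_solutions_computable_def exC using C r by metis
  moreover have "SC_counters_computable P"
    unfolding SC_counters_computable_def exSC using SC r by metis
  ultimately show ?thesis unfolding effectively_determined_def using determined[OF up] by blast
qed

theorem theorem5p2:
  fixes P :: "nat set"
  shows "(ultimately_periodic P \<longleftrightarrow> effectively_determined P) \<and>
         (ultimately_periodic P \<longrightarrow> problem_computable P) \<and>
         (effectively_determined P \<longrightarrow> problem_computable P)"
proof -
  have "effectively_determined P \<Longrightarrow> problem_computable P"
    by (simp add: effectively_determined_def problem_computable_def)
  moreover have "effectively_determined P \<Longrightarrow> ultimately_periodic P"
    by (rule determined_imp_ultimately_periodic) (simp add: effectively_determined_def)
  ultimately show ?thesis using ultimately_periodic_imp_effectively_determined by blast
qed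

end
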